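(* Let $\alpha \in (0,\pi]$ and suppose that the i.i.d. random angles $\Theta_j$ are uniformly distributed on $[-\alpha,\alpha]$. Let $X^n$ be the linearly interpolated walk associated with these angles (defined in the context), viewed as a random element of $C([0,1],\mathbb{R}^2)$ with the uniform topology. Then, as $n \to \infty$, $$\frac{1}{\sqrt{n}}\,X^n \rightharpoonup \sigma_\alpha B^{(2)} \quad \text{in } C([0,1],\mathbb{R}^2), \qquad \text{with } \sigma_\alpha^2 = \frac{1}{2}\,\frac{1+\operatorname{sinc}\alpha}{1-\operatorname{sinc}\alpha},\ \sigma_\alpha \ge 0,$$ where $B^{(2)}$ is the standard 2-dimensional Brownian motion (restricted to $[0,1]$).
   Context: $\operatorname{sinc}\alpha = \sin(\alpha)/\alpha$. $\mathbb{R}^2$ is identified with $\mathbb{C}$ and $\mathbb{S}^1$ is the unit circle. $\rightharpoonup$ denotes weak convergence of probability laws (convergence in distribution). The walk: $\{\Theta_j\}_{j\ge 2}$ is an i.i.d. sequence of real random variables, $U_1$ is uniformly distributed on $\mathbb{S}^1$ and independent of $\{\Theta_j\}_{j\ge2}$, and $U_j = e^{i\Theta_j}U_{j-1}$ for $j \ge 2$. For $n\ge 1$ and $t\in[0,1]$, $X^n_t = \sum_{j=1}^{\lfloor nt\rfloor} U_j + (nt-\lfloor nt\rfloor)\,U_{\lfloor nt\rfloor+1}$. *)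

theory Defs
  imports "HOL-Probability.Probability" "HOL-Probability.Sinc_Integral"
begin

definition borel_of_topology :: "'a topology \<Rightarrow> 'a measure" where
  "borel_of_topology X = sigma (topspace X) {V. openin X V}"

definition weak_conv_in :: "'a topology \<Rightarrow> (nat \<Rightarrow> 'a measure) \<Rightarrow> 'a measure \<Rightarrow> bool" where
  "weak_conv_in X \<mu> \<nu> \<longleftrightarrow>
     (\<forall>f. continuous_map X euclideanreal f \<and> bounded (f ` topspace X) \<longrightarrow>
        (\<lambda>n. integral\<^sup>L (\<mu> n) f) \<longlonglongrightarrow> integral\<^sup>L \<nu> f)"

text \<open>Measurability is part of the definition, since \<^const>\<open>distr\<close> along a non-measurable map
  carries no information.\<close>

definition conv_in_distribution ::
    "'c topology \<Rightarrow> 'a measure \<Rightarrow> (nat \<Rightarrow> 'a \<Rightarrow> 'c) \<Rightarrow> 'b measure \<Rightarrow> ('b \<Rightarrow> 'c) \<Rightarrow> bool" where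
  "conv_in_distribution X M Y N Z \<longleftrightarrow>
     (\<forall>n. Y n \<in> M \<rightarrow>\<^sub>M borel_of_topology X) \<and> Z \<in> N \<rightarrow>\<^sub>M borel_of_topology X \<and>
     weak_conv_in X (\<lambda>n. distr M (borel_of_topology X) (Y n)) (distr N (borel_of_topology X) Z)"

text \<open>The space $C([0,1],\mathbb{R}^2)$ with the supremum metric, $\mathbb{R}^2$ being identified
  with $\mathbb{C}$. Its points are functions that are \<^const>\<open>undefined\<close> outside $[0,1]$
  (\<^const>\<open>extensional\<close>), so paths have to be passed through \<^const>\<open>restrict\<close>.\<close>

definition C01 :: "(real \<Rightarrow> complex) topology" where
  "C01 = mtopology_of (cfunspace (top_of_set {0..1}) euclidean_metric)"

text \<open>The library's \<^const>\<open>prob_space.indep_var\<close> requires both variables to have values in the same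
  type.\<close>

definition indep_rv :: "'a measure \<Rightarrow> 'c measure \<Rightarrow> ('a \<Rightarrow> 'c) \<Rightarrow> 'd measure \<Rightarrow> ('a \<Rightarrow> 'd) \<Rightarrow> bool" where
  "indep_rv M S X T Y \<longleftrightarrow> X \<in> M \<rightarrow>\<^sub>M S \<and> Y \<in> M \<rightarrow>\<^sub>M T \<and>
     prob_space.indep_set M (sets (vimage_algebra (space M) X S)) (sets (vimage_algebra (space M) Y T))"

definition uniform_circle :: "complex measure" where
  "uniform_circle = distr (uniform_measure lborel {0..<2 * pi}) borel cis"

definition interpolated_walk :: "(nat \<Rightarrow> 'a \<Rightarrow> complex) \<Rightarrow> nat \<Rightarrow> real \<Rightarrow> 'a \<Rightarrow> complex" where
  "interpolated_walk U n t \<omega> =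
     (\<Sum>j = 1..nat \<lfloor>real n * t\<rfloor>. U j \<omega>)
     + complex_of_real (real n * t - of_int \<lfloor>real n * t\<rfloor>) * U (nat \<lfloor>real n * t\<rfloor> + 1) \<omega>"

text \<open>Standard planar Brownian motion on $[0,\infty)$. The density of an increment is that of
  $\mathcal{N}(0,(t-s)I_2)$ written as a product over the two coordinates; the second argument of
  \<^const>\<open>normal_density\<close> is the standard deviation.\<close>

locale brownian_motion_2d = prob_space N
  for N :: "'b measure" and B :: "real \<Rightarrow> 'b \<Rightarrow> complex" +
  assumes measurable: "\<And>t. 0 \<le> t \<Longrightarrow> random_variable borel (B t)"
    and start: "AE \<omega> in N. B 0 \<omega> = 0"
    and continuous_paths: "\<And>\<omega>. \<omega> \<in> space N \<Longrightarrow> continuous_on {0..} (\<lambda>t. B t \<omega>)"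
    and independent_increments:
      "\<And>(k :: nat) (t :: nat \<Rightarrow> real). 0 \<le> t 0 \<Longrightarrow> (\<And>i. i < k \<Longrightarrow> t i < t (Suc i)) \<Longrightarrow>
         indep_vars (\<lambda>_. borel) (\<lambda>i \<omega>. B (t (Suc i)) \<omega> - B (t i) \<omega>) {..<k}"
    and gaussian_increments:
      "\<And>s t. 0 \<le> s \<Longrightarrow> s < t \<Longrightarrow>
         distributed N lborel (\<lambda>\<omega>. B t \<omega> - B s \<omega>)
           (\<lambda>z. ennreal (normal_density 0 (sqrt (t - s)) (Re z)
                          * normal_density 0 (sqrt (t - s)) (Im z)))"

end

theory Submission
  imports Defs
begin

text \<open>Put $V_0 = U_1$ and $V_j = e^{i\Theta_{j+1}}$ for $j \ge 1$. Then $U_{k+1} = V_0 V_1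
  \cdots V_k$ is a product of independent unit complex numbers, and the law of the angles enters
  through the two real numbers $r = E V_j = \mathrm{sinc}\,\alpha$ and $s = E V_j^2 =
  \mathrm{sinc}(2\alpha)$, both of modulus less than 1. From here on the walk is numbered from 0, so
  that $U_k = V_0 \cdots V_k$.

  The variables $d_k = U_k (V_{k+1} - r) = U_{k+1} - r U_k$ are bounded martingale differences, and
  they telescope to $(1 - r) \sum_{j<k} U_j = M_k + U_0 - U_k$ with $M_k = \sum_{j<k} d_j$
  (\<open>partial_sum_eq_mart\<close>). Up to a bounded error the walk is therefore the martingale $M / (1 - r)$.
  Given the past, $E |d_k|^2 = 1 - r^2$ while $E d_k^2 = (s - r^2) U_k^2$. The second quantity would
  destroy isotropy, but $E U_k^2$ decays like $|s|^k$, so that it averages out and each coordinate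
  gains the variance $(1 - r^2)/2$ per step. Division by $(1 - r)^2$ gives $\sigma^2 = \frac12 (1 +
  r)/(1 - r)$.

  Two estimates on the martingale carry the proof. The first is \<open>char_error_le\<close>: for deterministic
  coefficients $\mu_j$ of size $\epsilon$, the characteristic function of $\sum_{j<k}
  \mathrm{Re}(\mu_j d_j)$ is Gaussian up to $O(\epsilon^2 + k \epsilon^3)$. With coefficients that
  are constant on blocks of times this yields the joint characteristic functions of the increments
  of the rescaled walk. The second is \<open>mart_maximal_inequality\<close>, a bound on the oscillation of $M$
  over a block of times, which follows from fourth moments of the stopped martingale.

  The passage to $C([0,1])$ goes through bounded Lipschitz functionals, which suffice for weak
  convergence (\<open>weak_conv_in_from_Lipschitz\<close>). A path is replaced by its piecewise linear
  interpolation at the points $l/m$. For the walk this changes the expectation of the functional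
  little, uniformly in $n$, by the maximal inequality; for Brownian motion, by uniform continuity of
  its paths. For fixed $m$ what remains is a bounded Lipschitz function of finitely many increments,
  and convergence of their joint characteristic functions is enough by a continuity theorem in
  several variables (\<open>multivariate_levy\<close>), obtained from Levy's theorem on the line one coordinate
  at a time.\<close>

section \<open>Weak convergence tested on bounded Lipschitz functions\<close>

lemma space_borel_of_topology: "space (borel_of_topology X) = topspace X"
  unfolding borel_of_topology_def by (intro space_measure_of) (auto dest: openin_subset)

lemma openin_in_sets_borel_of_topology: "openin X V \<Longrightarrow> V \<in> sets (borel_of_topology X)"
  unfolding borel_of_topology_def by (auto dest: openin_subset)

lemma measurable_borel_of_topologyI:
  assumes "\<And>\<omega>. \<omega> \<in> space P \<Longrightarrow> Y \<omega> \<in> topspace X"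
    and "\<And>V. openin X V \<Longrightarrow> Y -` V \<inter> space P \<in> sets P"
  shows "Y \<in> P \<rightarrow>\<^sub>M borel_of_topology X"
  unfolding borel_of_topology_def
  using assms by (intro measurable_measure_of) (auto dest: openin_subset)

lemma borel_measurable_continuous_map:
  fixes g :: "'a \<Rightarrow> real"
  assumes "continuous_map X euclideanreal g"
  shows "g \<in> borel_measurable (borel_of_topology X)"
proof (rule borel_measurableI)
  fix S :: "real set" assume "open S"
  then have "openin X {x \<in> topspace X. g x \<in> S}"
    using assms by (auto simp: continuous_map_def)
  moreover have "g -` S \<inter> space (borel_of_topology X) = {x \<in> topspace X. g x \<in> S}"
    by (auto simp: space_borel_of_topology)
  ultimately show "g -` S \<inter> space (borel_of_topology X) \<in> sets (borel_of_topology X)"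
    by (simp add: openin_in_sets_borel_of_topology)
qed

context Metric_space
begin

text \<open>The inf-convolution of \<open>f\<close> with the cone \<open>k * d\<close>: the largest \<open>k\<close>-Lipschitz function
  below \<open>f\<close>.\<close>

definition lip_minorant :: "('a \<Rightarrow> real) \<Rightarrow> real \<Rightarrow> 'a \<Rightarrow> real" where
  "lip_minorant f k x = (INF y\<in>M. f y + k * d x y)"

context
  fixes f :: "'a \<Rightarrow> real" and C k :: real
  assumes bnd: "\<And>x. x \<in> M \<Longrightarrow> \<bar>f x\<bar> \<le> C" and k: "0 \<le> k"
begin

lemma lip_minorant_bdd: "bdd_below ((\<lambda>y. f y + k * d x y) ` M)"
proof (rule bdd_belowI2)
  fix y assume "y \<in> M"
  then show "- C \<le> f y + k * d x y"
    using bnd[of y] k nonneg[of x y] mult_nonneg_nonneg[of k "d x y"] by linarith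
qed

lemma lip_minorant_le:
  assumes "x \<in> M" shows "lip_minorant f k x \<le> f x"
proof -
  have "lip_minorant f k x \<le> f x + k * d x x"
    unfolding lip_minorant_def using assms lip_minorant_bdd by (intro cINF_lower) auto
  then show ?thesis using assms by simp
qed

lemma lip_minorant_ge:
  assumes "x \<in> M" shows "- C \<le> lip_minorant f k x"
  unfolding lip_minorant_def
proof (rule cINF_greatest)
  fix y assume "y \<in> M"
  then show "- C \<le> f y + k * d x y"
    using bnd[of y] k nonneg[of x y] mult_nonneg_nonneg[of k "d x y"] by linarith
qed (use assms in auto)

lemma abs_lip_minorant_le:
  assumes "x \<in> M" shows "\<bar>lip_minorant f k x\<bar> \<le> C"
  using lip_minorant_le[OF assms] lip_minorant_ge[OF assms] bnd[OF assms] by linarith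

lemma lip_minorant_diff:
  assumes "x \<in> M" "y \<in> M" shows "lip_minorant f k x \<le> lip_minorant f k y + k * d x y"
proof -
  have "lip_minorant f k x - k * d x y \<le> lip_minorant f k y"
    unfolding lip_minorant_def[of f k y]
  proof (rule cINF_greatest)
    fix z assume z: "z \<in> M"
    have "lip_minorant f k x \<le> f z + k * d x z"
      unfolding lip_minorant_def using z lip_minorant_bdd by (intro cINF_lower) auto
    also have "k * d x z \<le> k * (d x y + d y z)"
      using assms z k by (intro mult_left_mono triangle) auto
    finally show "lip_minorant f k x - k * d x y \<le> f z + k * d y z"
      by (simp add: algebra_simps)
  qed (use assms in auto)
  then show ?thesis by simp
qed

lemma lip_minorant_Lipschitz:
  assumes "x \<in> M" "y \<in> M" shows "\<bar>lip_minorant f k x - lip_minorant f k y\<bar> \<le> k * d x y"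
  using lip_minorant_diff[OF assms] lip_minorant_diff[OF assms(2,1)] by (simp add: commute abs_le_iff)

end

lemma continuous_map_Lipschitz_real:
  assumes "\<And>x y. x \<in> M \<Longrightarrow> y \<in> M \<Longrightarrow> \<bar>g x - g y\<bar> \<le> L * d x y"
  shows "continuous_map mtopology euclideanreal g"
proof -
  have "continuous_map mtopology (Metric_space.mtopology UNIV dist) g"
  proof (subst metric_continuous_map[OF Met_TC.Metric_space_axioms], intro conjI ballI allI impI)
    fix a \<epsilon> :: real and x assume x: "x \<in> M" and e: "0 < \<epsilon>"
    show "\<exists>\<delta>>0. \<forall>y. y \<in> M \<and> d x y < \<delta> \<longrightarrow> dist (g x) (g y) < \<epsilon>"
    proof (intro exI conjI allI impI)
      show "0 < \<epsilon> / (\<bar>L\<bar> + 1)" using e by simp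
      fix y assume y: "y \<in> M \<and> d x y < \<epsilon> / (\<bar>L\<bar> + 1)"
      have "\<bar>g x - g y\<bar> \<le> L * d x y" using assms x y by auto
      also have "\<dots> \<le> (\<bar>L\<bar> + 1) * d x y" by (intro mult_right_mono) auto
      also have "\<dots> < \<epsilon>" using y by (simp add: pos_less_divide_eq mult.commute)
      finally show "dist (g x) (g y) < \<epsilon>" by (simp add: dist_real_def)
    qed
  qed auto
  then show ?thesis by simp
qed

text \<open>A point at distance at least \<open>\<delta>\<close> from \<open>x\<close> is penalised by \<open>k * \<delta>\<close>, which exceeds the
  oscillation \<open>2 * C\<close> of \<open>f\<close> once \<open>k\<close> is large; at nearer points \<open>f\<close> is close to \<open>f x\<close> by
  continuity. So the infimum is nearly attained at \<open>x\<close>.\<close>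

lemma lip_minorant_tendsto:
  assumes f: "continuous_map mtopology euclideanreal f"
    and bnd: "\<And>x. x \<in> M \<Longrightarrow> \<bar>f x\<bar> \<le> C" and x: "x \<in> M"
  shows "(\<lambda>k. lip_minorant f (real k) x) \<longlonglongrightarrow> f x"
proof (rule LIMSEQ_I)
  fix e :: real assume e: "0 < e"
  have "continuous_map mtopology (Metric_space.mtopology UNIV dist) f" using f by simp
  then obtain \<delta> where \<delta>: "\<delta> > 0" "\<And>y. y \<in> M \<Longrightarrow> d x y < \<delta> \<Longrightarrow> dist (f x) (f y) < e / 2"
    using metric_continuous_map[OF Met_TC.Metric_space_axioms] x e by (metis half_gt_zero)
  have C: "C \<ge> 0" using bnd[OF x] by linarith
  obtain K :: nat where K: "real K > 2 * C / \<delta>" using reals_Archimedean2 by blast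
  have "\<bar>lip_minorant f (real k) x - f x\<bar> < e" if k: "k \<ge> K" for k
  proof -
    have "f x - e / 2 \<le> lip_minorant f (real k) x"
      unfolding lip_minorant_def
    proof (rule cINF_greatest)
      fix y assume y: "y \<in> M"
      show "f x - e / 2 \<le> f y + real k * d x y"
      proof (cases "d x y < \<delta>")
        case True
        then have "\<bar>f x - f y\<bar> < e / 2" using \<delta>(2)[OF y] by (simp add: dist_real_def)
        moreover have "real k * d x y \<ge> 0" by (simp add: nonneg)
        ultimately show ?thesis by linarith
      next
        case False
        have "2 * C < real K * \<delta>" using K \<delta>(1) by (simp add: pos_divide_less_eq)
        also have "\<dots> \<le> real k * d x y" using False k \<delta>(1) by (intro mult_mono) auto
        finally show ?thesis using bnd[OF x] bnd[OF y] e by linarith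
      qed
    qed (use x in auto)
    moreover have "lip_minorant f (real k) x \<le> f x"
      using bnd x by (intro lip_minorant_le) auto
    ultimately show ?thesis using e by linarith
  qed
  then show "\<exists>no. \<forall>n\<ge>no. norm (lip_minorant f (real n) x - f x) < e" by auto
qed

text \<open>Passing from \<open>f\<close> to its Lipschitz minorant decreases the integral under every law, and
  costs as little as desired under the limit law when \<open>k\<close> is large, by dominated convergence.
  Convergence for Lipschitz functions therefore bounds the lower limit of the integrals of \<open>f\<close> from
  below; the same for \<open>- f\<close> bounds the upper limit.\<close>

lemma weak_conv_in_from_Lipschitz:
  assumes "prob_space P" "prob_space Q"
    and Y[measurable]: "\<And>n. Y n \<in> P \<rightarrow>\<^sub>M borel_of_topology mtopology"
    and Z[measurable]: "Z \<in> Q \<rightarrow>\<^sub>M borel_of_topology mtopology"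
    and lip: "\<And>g C L. (\<And>x. x \<in> M \<Longrightarrow> \<bar>g x\<bar> \<le> C) \<Longrightarrow>
        (\<And>x y. x \<in> M \<Longrightarrow> y \<in> M \<Longrightarrow> \<bar>g x - g y\<bar> \<le> L * d x y) \<Longrightarrow>
        (\<lambda>n. \<integral>\<omega>. g (Y n \<omega>) \<partial>P) \<longlonglongrightarrow> (\<integral>\<omega>. g (Z \<omega>) \<partial>Q)"
  shows "weak_conv_in mtopology (\<lambda>n. distr P (borel_of_topology mtopology) (Y n))
           (distr Q (borel_of_topology mtopology) Z)"
proof -
  interpret P: prob_space P by fact
  interpret Q: prob_space Q by fact
  have YM: "\<And>n \<omega>. \<omega> \<in> space P \<Longrightarrow> Y n \<omega> \<in> M" and ZM: "\<And>\<omega>. \<omega> \<in> space Q \<Longrightarrow> Z \<omega> \<in> M"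
    using measurable_space[OF Y] measurable_space[OF Z] by (auto simp: space_borel_of_topology)
  have lower: "eventually (\<lambda>n. (\<integral>\<omega>. f (Z \<omega>) \<partial>Q) - e < (\<integral>\<omega>. f (Y n \<omega>) \<partial>P)) sequentially"
    if f: "continuous_map mtopology euclideanreal f"
      and bnd: "\<And>x. x \<in> M \<Longrightarrow> \<bar>f x\<bar> \<le> C" and e: "0 < e" for f C and e :: real
  proof -
    define g where "g k = lip_minorant f (real k)" for k :: nat
    have gC: "\<bar>g k x\<bar> \<le> C" and glip: "\<bar>g k x - g k y\<bar> \<le> real k * d x y" and gle: "g k x \<le> f x"
      if "x \<in> M" "y \<in> M" for k x y
      unfolding g_def
      using that abs_lip_minorant_le[of f C "real k", OF bnd]
        lip_minorant_Lipschitz[of f C "real k", OF bnd] lip_minorant_le[of f C "real k", OF bnd]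
      by auto
    have mf[measurable]: "f \<in> borel_measurable (borel_of_topology mtopology)"
      by (rule borel_measurable_continuous_map[OF f])
    have mg[measurable]: "g k \<in> borel_measurable (borel_of_topology mtopology)" for k
      using glip by (intro borel_measurable_continuous_map continuous_map_Lipschitz_real)
    have "(\<lambda>k. \<integral>\<omega>. g k (Z \<omega>) \<partial>Q) \<longlonglongrightarrow> (\<integral>\<omega>. f (Z \<omega>) \<partial>Q)"
    proof (rule integral_dominated_convergence[where w="\<lambda>_. C"])
      show "AE \<omega> in Q. (\<lambda>k. g k (Z \<omega>)) \<longlonglongrightarrow> f (Z \<omega>)"
        unfolding g_def using lip_minorant_tendsto[OF f bnd] ZM by auto
    qed (use gC[OF ZM ZM] in \<open>auto intro!: AE_I2\<close>)
    then have "eventually (\<lambda>k. (\<integral>\<omega>. g k (Z \<omega>) \<partial>Q) > (\<integral>\<omega>. f (Z \<omega>) \<partial>Q) - e / 2) sequentially"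
      using e by (intro order_tendstoD) auto
    then obtain k where k: "(\<integral>\<omega>. g k (Z \<omega>) \<partial>Q) > (\<integral>\<omega>. f (Z \<omega>) \<partial>Q) - e / 2"
      by (auto simp: eventually_sequentially)
    have "(\<lambda>n. \<integral>\<omega>. g k (Y n \<omega>) \<partial>P) \<longlonglongrightarrow> (\<integral>\<omega>. g k (Z \<omega>) \<partial>Q)"
      using gC glip by (intro lip[of "g k" C "real k"]) auto
    then have "eventually (\<lambda>n. (\<integral>\<omega>. g k (Y n \<omega>) \<partial>P) > (\<integral>\<omega>. g k (Z \<omega>) \<partial>Q) - e / 2) sequentially"
      using e by (intro order_tendstoD) auto
    then show ?thesis
    proof (eventually_elim)
      case (elim n)
      have "(\<integral>\<omega>. g k (Y n \<omega>) \<partial>P) \<le> (\<integral>\<omega>. f (Y n \<omega>) \<partial>P)"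
      proof (rule integral_mono)
        show "integrable P (\<lambda>\<omega>. g k (Y n \<omega>))" "integrable P (\<lambda>\<omega>. f (Y n \<omega>))"
          using gC[OF YM YM] bnd[OF YM] by (auto intro!: P.integrable_const_bound[where B=C] AE_I2)
      qed (use gle[OF YM YM] in auto)
      then show ?case using elim k by linarith
    qed
  qed
  show ?thesis
    unfolding weak_conv_in_def
  proof (intro allI impI)
    fix f assume f: "continuous_map mtopology euclideanreal f \<and> bounded (f ` topspace mtopology)"
    then obtain C where C: "\<And>x. x \<in> M \<Longrightarrow> \<bar>f x\<bar> \<le> C"
      by (auto simp: bounded_iff)
    have f': "continuous_map mtopology euclideanreal f"
      "continuous_map mtopology euclideanreal (\<lambda>x. - f x)"
      using f by (auto intro: continuous_intros)
    have mf[measurable]: "f \<in> borel_measurable (borel_of_topology mtopology)"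
      by (rule borel_measurable_continuous_map[OF f'(1)])
    have "(\<lambda>n. \<integral>\<omega>. f (Y n \<omega>) \<partial>P) \<longlonglongrightarrow> (\<integral>\<omega>. f (Z \<omega>) \<partial>Q)"
    proof (rule tendstoI)
      fix e :: real assume e: "0 < e"
      have "eventually (\<lambda>n. (\<integral>\<omega>. f (Z \<omega>) \<partial>Q) - e < (\<integral>\<omega>. f (Y n \<omega>) \<partial>P)) sequentially"
        using C by (intro lower[OF f'(1) _ e]) auto
      moreover have "eventually (\<lambda>n. (\<integral>\<omega>. - f (Z \<omega>) \<partial>Q) - e < (\<integral>\<omega>. - f (Y n \<omega>) \<partial>P)) sequentially"
        using C by (intro lower[OF f'(2) _ e]) auto
      ultimately show "\<forall>\<^sub>F n in sequentially. dist (\<integral>\<omega>. f (Y n \<omega>) \<partial>P) (\<integral>\<omega>. f (Z \<omega>) \<partial>Q) < e"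
        by eventually_elim (auto simp: dist_real_def abs_less_iff)
    qed
    then show "(\<lambda>n. integral\<^sup>L (distr P (borel_of_topology mtopology) (Y n)) f)
        \<longlonglongrightarrow> integral\<^sup>L (distr Q (borel_of_topology mtopology) Z) f"
      by (simp add: integral_distr)
  qed
qed

text \<open>Every open set is the set where some bounded Lipschitz function is positive, namely the
  1-Lipschitz minorant of its indicator.\<close>

lemma measurable_from_Lipschitz:
  assumes YM: "\<And>\<omega>. \<omega> \<in> space P \<Longrightarrow> Y \<omega> \<in> M"
    and lip: "\<And>g C L. (\<And>x. x \<in> M \<Longrightarrow> \<bar>g x\<bar> \<le> C) \<Longrightarrow>
        (\<And>x y. x \<in> M \<Longrightarrow> y \<in> M \<Longrightarrow> \<bar>g x - g y\<bar> \<le> L * d x y) \<Longrightarrow>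
        (\<lambda>\<omega>. g (Y \<omega>)) \<in> borel_measurable P"
  shows "Y \<in> P \<rightarrow>\<^sub>M borel_of_topology mtopology"
proof (rule measurable_borel_of_topologyI)
  fix V assume V: "openin mtopology V"
  define g where "g = lip_minorant (indicator V) 1"
  have ind: "\<And>x. x \<in> M \<Longrightarrow> \<bar>indicator V x :: real\<bar> \<le> 1" by (auto simp: indicator_def)
  have V_iff: "x \<in> V \<longleftrightarrow> 0 < g x" if x: "x \<in> M" for x
  proof
    assume "x \<in> V"
    then obtain r where r: "r > 0" "mball x r \<subseteq> V" using V by (auto simp: openin_mtopology)
    have "min 1 r \<le> g x"
      unfolding g_def lip_minorant_def
    proof (rule cINF_greatest)
      fix y assume y: "y \<in> M"
      show "min 1 r \<le> indicator V y + 1 * d x y"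
      proof (cases "d x y < r")
        case True
        then have "y \<in> V" using r x y by (auto simp: mball_def)
        moreover have "min 1 r \<le> 1 + d x y" using nonneg[of x y] by linarith
          ultimately show ?thesis by simp
      next
        case False
        then show ?thesis by (auto simp: indicator_def min_def)
      qed
    qed (use x in auto)
    then show "0 < g x" using r(1) by linarith
  next
    assume "0 < g x"
    moreover have "g x \<le> indicator V x"
      unfolding g_def using ind x by (intro lip_minorant_le[where C=1]) auto
    ultimately show "x \<in> V" by (cases "x \<in> V") auto
  qed
  have [measurable]: "(\<lambda>\<omega>. g (Y \<omega>)) \<in> borel_measurable P"
  proof (rule lip)
    show "\<And>x. x \<in> M \<Longrightarrow> \<bar>g x\<bar> \<le> 1"
      unfolding g_def using ind by (intro abs_lip_minorant_le) auto
    show "\<And>x y. x \<in> M \<Longrightarrow> y \<in> M \<Longrightarrow> \<bar>g x - g y\<bar> \<le> 1 * d x y"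
      unfolding g_def using ind by (intro lip_minorant_Lipschitz) auto
  qed
  have "Y -` V \<inter> space P = {\<omega> \<in> space P. 0 < g (Y \<omega>)}"
    using V_iff YM by auto
  then show "Y -` V \<inter> space P \<in> sets P" by simp
qed (use YM in auto)

end

section \<open>Interpolation by hat functions\<close>

definition hat :: "real \<Rightarrow> real" where
  "hat s = max 0 (1 - \<bar>s\<bar>)"

lemma hat_nonneg [simp]: "0 \<le> hat s" and hat_le_1 [simp]: "hat s \<le> 1"
  by (auto simp: hat_def)

lemma continuous_on_hat [continuous_intros]:
  "continuous_on A f \<Longrightarrow> continuous_on A (\<lambda>x. hat (f x))"
  unfolding hat_def by (intro continuous_intros)

lemma sum_hat_eq:
  assumes "0 \<le> s" shows "(\<Sum>l\<le>m. hat (s - real l)) = min 1 (max 0 (real m + 1 - s))"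
proof (induction m)
  case 0
  then show ?case using assms by (simp add: hat_def min_def max_def)
next
  case (Suc m)
  have "(\<Sum>l\<le>Suc m. hat (s - real l)) = min 1 (max 0 (real m + 1 - s)) + hat (s - real (Suc m))"
    using Suc by simp
  also have "\<dots> = min 1 (max 0 (real (Suc m) + 1 - s))"
    using assms by (auto simp: hat_def min_def max_def abs_if)
  finally show ?case .
qed

text \<open>On \<open>[0, m]\<close> the weights \<open>hat (s - l)\<close> sum up to 1, and only nodes at distance less than 1
  from \<open>s\<close> have a positive weight. So the average inherits every bound that holds at these nodes.\<close>

lemma norm_hat_average_le:
  fixes x :: "nat \<Rightarrow> 'b::real_normed_vector"
  assumes s: "0 \<le> s" "s \<le> real m"
    and near: "\<And>l. l \<le> m \<Longrightarrow> \<bar>s - real l\<bar> < 1 \<Longrightarrow> norm (x l - z) \<le> e"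
  shows "norm ((\<Sum>l\<le>m. hat (s - real l) *\<^sub>R x l) - z) \<le> e"
proof -
  have one: "(\<Sum>l\<le>m. hat (s - real l)) = 1"
    using s by (simp add: sum_hat_eq)
  have "(\<Sum>l\<le>m. hat (s - real l) *\<^sub>R x l) - z = (\<Sum>l\<le>m. hat (s - real l) *\<^sub>R (x l - z))"
    using one by (simp add: scaleR_diff_right sum_subtractf flip: scaleR_left.sum)
  also have "norm \<dots> \<le> (\<Sum>l\<le>m. hat (s - real l) * e)"
  proof (intro sum_norm_le)
    fix l assume l: "l \<in> {..m}"
    show "norm (hat (s - real l) *\<^sub>R (x l - z)) \<le> hat (s - real l) * e"
    proof (cases "\<bar>s - real l\<bar> < 1")
      case True
      then show ?thesis using near[of l] l by (auto intro!: mult_left_mono)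
    next
      case False
      then have "hat (s - real l) = 0" by (simp add: hat_def)
      then show ?thesis by simp
    qed
  qed
  also have "\<dots> = e" using one by (simp flip: sum_distrib_right)
  finally show ?thesis .
qed

text \<open>The piecewise linear function with the value \<open>x l\<close> at \<open>l / m\<close>. As a sum of hat functions
  it is visibly continuous in \<open>t\<close> and linear in \<open>x\<close>.\<close>

definition hat_interp :: "nat \<Rightarrow> (nat \<Rightarrow> 'b::real_normed_vector) \<Rightarrow> real \<Rightarrow> 'b" where
  "hat_interp m x t = (\<Sum>l\<le>m. hat (real m * t - real l) *\<^sub>R x l)"

lemma continuous_on_hat_interp [continuous_intros]: "continuous_on A (hat_interp m x)"
  unfolding hat_interp_def by (intro continuous_intros)

lemma norm_hat_interp_diff_le:
  "norm (hat_interp m x t - hat_interp m y t) \<le> (\<Sum>l\<le>m. norm (x l - y l))"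
proof -
  have "hat_interp m x t - hat_interp m y t = (\<Sum>l\<le>m. hat (real m * t - real l) *\<^sub>R (x l - y l))"
    by (simp add: hat_interp_def sum_subtractf scaleR_diff_right)
  also have "norm \<dots> \<le> (\<Sum>l\<le>m. norm (x l - y l))"
    by (intro sum_norm_le) (auto intro!: mult_left_le_one_le)
  finally show ?thesis .
qed

lemma hat_interp_uniform_tendsto:
  fixes y :: "real \<Rightarrow> 'b::real_normed_vector"
  assumes y: "continuous_on {0..1} y" and e: "0 < e"
  shows "eventually (\<lambda>m. \<forall>t\<in>{0..1}. norm (hat_interp m (\<lambda>l. y (real l / real m)) t - y t) \<le> e) sequentially"
proof -
  have "uniformly_continuous_on {0..1} y" using y by (intro compact_uniformly_continuous) auto
  then obtain \<delta> where \<delta>: "\<delta> > 0"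
    "\<And>t t'. t \<in> {0..1} \<Longrightarrow> t' \<in> {0..1} \<Longrightarrow> dist t' t < \<delta> \<Longrightarrow> dist (y t') (y t) < e"
    using e unfolding uniformly_continuous_on_def by metis
  have "eventually (\<lambda>m. 1 / real m < \<delta>) sequentially"
    using lim_inverse_n' \<delta>(1) by (rule order_tendstoD)
  then show ?thesis using eventually_gt_at_top[of 0]
  proof eventually_elim
    case (elim m)
    show ?case
    proof
      fix t :: real assume t: "t \<in> {0..1}"
      show "norm (hat_interp m (\<lambda>l. y (real l / real m)) t - y t) \<le> e"
        unfolding hat_interp_def
      proof (rule norm_hat_average_le)
        show "0 \<le> real m * t" "real m * t \<le> real m" using t by (auto intro: mult_left_le)
        fix l assume l: "l \<le> m" "\<bar>real m * t - real l\<bar> < 1"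
        have "\<bar>real l / real m - t\<bar> = \<bar>real m * t - real l\<bar> / real m"
        proof -
          have "real l / real m - t = - ((real m * t - real l) / real m)"
            using elim by (simp add: field_simps)
          then show ?thesis by (simp add: abs_divide)
        qed
        also have "\<dots> < \<delta>" using l elim by (meson divide_strict_right_mono less_trans of_nat_0_less_iff)
        finally have "dist (y (real l / real m)) (y t) < e"
          using t l elim by (intro \<delta>(2)) (auto simp: dist_real_def)
        then show "norm (y (real l / real m) - y t) \<le> e" by (simp add: dist_norm)
      qed
    qed
  qed
qed

lemma continuous_on_Lipschitz_coordinates:
  fixes \<Phi> :: "(nat \<Rightarrow> 'b::real_normed_vector) \<Rightarrow> real"
  assumes "\<And>x y. \<bar>\<Phi> x - \<Phi> y\<bar> \<le> L * (\<Sum>j\<in>J. norm (x j - y j))"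
  shows "continuous_on UNIV \<Phi>"
  unfolding continuous_on_def
proof
  fix x :: "nat \<Rightarrow> 'b"
  have coord: "((\<lambda>y. y j) \<longlongrightarrow> x j) (at x within UNIV)" for j
    using continuous_on_product_coordinates[of j] by (auto simp: continuous_on_def)
  have "((\<lambda>y. L * (\<Sum>j\<in>J. norm (y j - x j))) \<longlongrightarrow> L * (\<Sum>j\<in>J. norm (x j - x j))) (at x within UNIV)"
    by (intro tendsto_intros coord)
  then have lim: "((\<lambda>y. L * (\<Sum>j\<in>J. norm (y j - x j))) \<longlongrightarrow> 0) (at x within UNIV)"
    by simp
  have "((\<lambda>y. \<Phi> y - \<Phi> x) \<longlongrightarrow> 0) (at x within UNIV)"
    by (rule Lim_null_comparison[OF _ lim]) (use assms in auto)
  then show "(\<Phi> \<longlongrightarrow> \<Phi> x) (at x within UNIV)" by (simp add: LIM_zero_iff)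
qed

lemma borel_measurable_Lipschitz_coordinates:
  fixes \<Phi> :: "(nat \<Rightarrow> 'b::{real_normed_vector,second_countable_topology}) \<Rightarrow> real"
  assumes "\<And>x y. \<bar>\<Phi> x - \<Phi> y\<bar> \<le> L * (\<Sum>j\<in>J. norm (x j - y j))"
    and X: "\<And>j. X j \<in> borel_measurable P"
  shows "(\<lambda>\<omega>. \<Phi> (\<lambda>j. X j \<omega>)) \<in> borel_measurable P"
proof -
  have "\<Phi> \<in> borel_measurable borel"
    using continuous_on_Lipschitz_coordinates[OF assms(1)] by (rule borel_measurable_continuous_onI)
  moreover have "(\<lambda>\<omega> j. X j \<omega>) \<in> borel_measurable P"
    using X by (intro measurable_coordinatewise_then_product)
  ultimately show ?thesis by (rule measurable_compose[rotated])
qed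

section \<open>Functionals of continuous paths\<close>

text \<open>Bounded Lipschitz functionals for the supremum distance on \<open>[0, 1]\<close>. They are applied to
  functions on the whole line; by the last clause with \<open>e = 0\<close>, for functions that are continuous on
  \<open>[0, 1]\<close> only the values there matter. This spares the restriction of paths until the topology of
  \<^const>\<open>C01\<close> is needed.\<close>

definition path_functional :: "real \<Rightarrow> real \<Rightarrow> ((real \<Rightarrow> complex) \<Rightarrow> real) \<Rightarrow> bool" where
  "path_functional C L F \<longleftrightarrow> 0 \<le> C \<and> 0 \<le> L \<and> (\<forall>y. continuous_on {0..1} y \<longrightarrow> \<bar>F y\<bar> \<le> C) \<and>
     (\<forall>y z e. continuous_on {0..1} y \<longrightarrow> continuous_on {0..1} z \<longrightarrow>
        (\<forall>t\<in>{0..1}. norm (y t - z t) \<le> e) \<longrightarrow> \<bar>F y - F z\<bar> \<le> L * e)"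

lemma path_functionalD:
  assumes "path_functional C L F"
  shows "0 \<le> C" "0 \<le> L" "\<And>y. continuous_on {0..1} y \<Longrightarrow> \<bar>F y\<bar> \<le> C"
    "\<And>y z e. continuous_on {0..1} y \<Longrightarrow> continuous_on {0..1} z \<Longrightarrow>
        (\<And>t. t \<in> {0..1} \<Longrightarrow> norm (y t - z t) \<le> e) \<Longrightarrow> \<bar>F y - F z\<bar> \<le> L * e"
  using assms unfolding path_functional_def by blast+

lemma path_functional_hat_interp_Lipschitz:
  assumes F: "path_functional C L F"
  shows "\<bar>F (hat_interp m x) - F (hat_interp m y)\<bar> \<le> L * (\<Sum>l\<in>{..m}. norm (x l - y l))"
  by (rule path_functionalD(4)[OF F]) (auto intro!: continuous_intros norm_hat_interp_diff_le)

lemma path_functional_hat_interp_tendsto: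
  assumes F: "path_functional C L F" and y: "continuous_on {0..1} y"
  shows "(\<lambda>m. F (hat_interp m (\<lambda>l. y (real l / real m)))) \<longlonglongrightarrow> F y"
proof (rule tendstoI)
  fix e :: real assume e: "0 < e"
  define e' where "e' = e / (L + 1)"
  have e': "0 < e'" and L: "0 \<le> L" using e path_functionalD[OF F] by (auto simp: e'_def)
  have "L * e' < e" using e L by (simp add: e'_def field_simps)
  show "eventually (\<lambda>m. dist (F (hat_interp m (\<lambda>l. y (real l / real m)))) (F y) < e) sequentially"
    using hat_interp_uniform_tendsto[OF y e']
  proof eventually_elim
    case (elim m)
    have "\<bar>F (hat_interp m (\<lambda>l. y (real l / real m))) - F y\<bar> \<le> L * e'"
      using elim by (intro path_functionalD(4)[OF F] y continuous_intros) auto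
    then show ?case using \<open>L * e' < e\<close> by (simp add: dist_real_def)
  qed
qed

text \<open>The functional is the pointwise limit of its values at the interpolated paths, and these
  are Lipschitz functions of finitely many evaluations.\<close>

lemma borel_measurable_path_functional:
  assumes F: "path_functional C L F"
    and cont: "\<And>\<omega>. \<omega> \<in> space P \<Longrightarrow> continuous_on {0..1} (\<lambda>t. Y t \<omega>)"
    and meas: "\<And>t. t \<in> {0..1} \<Longrightarrow> Y t \<in> borel_measurable P"
  shows "(\<lambda>\<omega>. F (\<lambda>t. Y t \<omega>)) \<in> borel_measurable P"
proof (rule borel_measurable_LIMSEQ_real)
  show "\<And>\<omega>. \<omega> \<in> space P \<Longrightarrow>
      (\<lambda>m. F (hat_interp m (\<lambda>l. if l \<le> m then Y (real l / real m) \<omega> else 0))) \<longlonglongrightarrow> F (\<lambda>t. Y t \<omega>)"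
  proof -
    fix \<omega> assume \<omega>: "\<omega> \<in> space P"
    have "hat_interp m (\<lambda>l. if l \<le> m then Y (real l / real m) \<omega> else 0) =
        hat_interp m (\<lambda>l. Y (real l / real m) \<omega>)" for m
      by (auto simp: hat_interp_def fun_eq_iff)
    then show "(\<lambda>m. F (hat_interp m (\<lambda>l. if l \<le> m then Y (real l / real m) \<omega> else 0))) \<longlonglongrightarrow> F (\<lambda>t. Y t \<omega>)"
      using path_functional_hat_interp_tendsto[OF F cont[OF \<omega>]] by simp
  qed
  show "(\<lambda>\<omega>. F (hat_interp m (\<lambda>l. if l \<le> m then Y (real l / real m) \<omega> else 0))) \<in> borel_measurable P" for m
  proof (rule borel_measurable_Lipschitz_coordinates[OF path_functional_hat_interp_Lipschitz[OF F]])
    show "(\<lambda>\<omega>. if l \<le> m then Y (real l / real m) \<omega> else 0) \<in> borel_measurable P" for l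
      using meas[of "real l / real m"] by (cases "l \<le> m") (auto simp: divide_le_eq_1)
  qed
qed

abbreviation path_metric :: "(real \<Rightarrow> complex) metric" where
  "path_metric \<equiv> cfunspace (top_of_set {0..1}) euclidean_metric"

lemma C01_eq: "C01 = Metric_space.mtopology (mspace path_metric) (mdist path_metric)"
  by (simp add: C01_def mtopology_of_def)

lemma restrict_in_path_metric:
  assumes "continuous_on {0..1} y" shows "restrict y {0..1} \<in> mspace path_metric"
proof -
  have "continuous_on {0..1} (restrict y {0..1})"
      by (subst continuous_on_cong[OF refl, of _ _ y]) (use assms in auto)
  moreover have "bounded (restrict y {0..1} ` {0..1})"
    using assms compact_continuous_image[of "{0..1}" y] compact_imp_bounded
    by (metis compact_Icc image_restrict_eq)
  ultimately show ?thesis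
    by (auto simp: Met_TC.mbounded_def)
qed

lemma mdist_restrict_le:
  assumes "continuous_on {0..1} y" "continuous_on {0..1} z"
    and "\<And>t. t \<in> {0..1} \<Longrightarrow> norm (y t - z t) \<le> e"
  shows "mdist path_metric (restrict y {0..1}) (restrict z {0..1}) \<le> e"
  using assms by (subst cfunspace_mdist_le) (auto simp: restrict_in_path_metric dist_norm simp del:
      mspace_cfunspace)

lemma path_functional_of_Lipschitz:
  fixes g :: "(real \<Rightarrow> complex) \<Rightarrow> real"
  assumes bnd: "\<And>x. x \<in> mspace path_metric \<Longrightarrow> \<bar>g x\<bar> \<le> C"
    and lip: "\<And>x y. x \<in> mspace path_metric \<Longrightarrow> y \<in> mspace path_metric \<Longrightarrow>
          \<bar>g x - g y\<bar> \<le> L * mdist path_metric x y"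
  shows "path_functional C \<bar>L\<bar> (\<lambda>y. g (restrict y {0..1}))"
  unfolding path_functional_def
proof (intro conjI allI impI)
  have "continuous_on {0..1} (\<lambda>t::real. 0::complex)" by simp
  from bnd[OF restrict_in_path_metric[OF this]] show "0 \<le> C" by linarith
next
  fix y z :: "real \<Rightarrow> complex" and e assume yz: "continuous_on {0..1} y" "continuous_on {0..1} z"
    and e: "\<forall>t\<in>{0..1}. norm (y t - z t) \<le> e"
  have "\<bar>g (restrict y {0..1}) - g (restrict z {0..1})\<bar>
      \<le> L * mdist path_metric (restrict y {0..1}) (restrict z {0..1})"
    using yz by (intro lip restrict_in_path_metric)
  also have "\<dots> \<le> \<bar>L\<bar> * mdist path_metric (restrict y {0..1}) (restrict z {0..1})"
    by (intro mult_right_mono) auto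
  also have "\<dots> \<le> \<bar>L\<bar> * e" using yz e by (intro mult_left_mono mdist_restrict_le) auto
  finally show "\<bar>g (restrict y {0..1}) - g (restrict z {0..1})\<bar> \<le> \<bar>L\<bar> * e" .
qed (use bnd restrict_in_path_metric in auto)

text \<open>A process with continuous paths and measurable evaluations is a random element of the
  path space: by \<open>measurable_from_Lipschitz\<close> it is enough to look at Lipschitz functionals.\<close>

lemma measurable_C01:
  assumes cont: "\<And>\<omega>. \<omega> \<in> space P \<Longrightarrow> continuous_on {0..1} (\<lambda>t. Y t \<omega>)"
    and meas: "\<And>t. t \<in> {0..1} \<Longrightarrow> Y t \<in> borel_measurable P"
  shows "(\<lambda>\<omega>. \<lambda>t\<in>{0..1}. Y t \<omega>) \<in> P \<rightarrow>\<^sub>M borel_of_topology C01"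
proof -
  interpret Metric_space "mspace path_metric" "mdist path_metric" by (rule Metric_space_mspace_mdist)
  show ?thesis
    unfolding C01_eq
  proof (rule measurable_from_Lipschitz)
    fix g C L
    assume g: "\<And>x. x \<in> mspace path_metric \<Longrightarrow> \<bar>g x\<bar> \<le> C"
      "\<And>x y. x \<in> mspace path_metric \<Longrightarrow> y \<in> mspace path_metric \<Longrightarrow>
          \<bar>g x - g y\<bar> \<le> L * mdist path_metric x y"
    from borel_measurable_path_functional[OF path_functional_of_Lipschitz[OF g] cont meas]
    show "(\<lambda>\<omega>. g (\<lambda>t\<in>{0..1}. Y t \<omega>)) \<in> borel_measurable P" by simp
  qed (use cont restrict_in_path_metric in auto)
qed

lemma conv_in_distribution_C01I:
  assumes P: "prob_space P" and Q: "prob_space Q"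
    and Yc: "\<And>n \<omega>. \<omega> \<in> space P \<Longrightarrow> continuous_on {0..1} (\<lambda>t. Y n t \<omega>)"
    and Ym: "\<And>n t. t \<in> {0..1} \<Longrightarrow> Y n t \<in> borel_measurable P"
    and Zc: "\<And>\<omega>. \<omega> \<in> space Q \<Longrightarrow> continuous_on {0..1} (\<lambda>t. Z t \<omega>)"
    and Zm: "\<And>t. t \<in> {0..1} \<Longrightarrow> Z t \<in> borel_measurable Q"
    and lim: "\<And>C L F. path_functional C L F \<Longrightarrow>
        (\<lambda>n. \<integral>\<omega>. F (\<lambda>t. Y n t \<omega>) \<partial>P) \<longlonglongrightarrow> (\<integral>\<omega>. F (\<lambda>t. Z t \<omega>) \<partial>Q)"
  shows "conv_in_distribution C01 P (\<lambda>n \<omega>. \<lambda>t\<in>{0..1}. Y n t \<omega>) Q (\<lambda>\<omega>. \<lambda>t\<in>{0..1}. Z t \<omega>)"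
proof -
  interpret Metric_space "mspace path_metric" "mdist path_metric" by (rule Metric_space_mspace_mdist)
  have mY: "(\<lambda>\<omega>. \<lambda>t\<in>{0..1}. Y n t \<omega>) \<in> P \<rightarrow>\<^sub>M borel_of_topology C01" for n
    by (rule measurable_C01[OF Yc Ym])
  have mZ: "(\<lambda>\<omega>. \<lambda>t\<in>{0..1}. Z t \<omega>) \<in> Q \<rightarrow>\<^sub>M borel_of_topology C01"
    by (rule measurable_C01[OF Zc Zm])
  have "weak_conv_in C01 (\<lambda>n. distr P (borel_of_topology C01) (\<lambda>\<omega>. \<lambda>t\<in>{0..1}. Y n t \<omega>))
      (distr Q (borel_of_topology C01) (\<lambda>\<omega>. \<lambda>t\<in>{0..1}. Z t \<omega>))"
    using mY mZ unfolding C01_eq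
  proof (intro weak_conv_in_from_Lipschitz[OF P Q])
    fix g C L
    assume g: "\<And>x. x \<in> mspace path_metric \<Longrightarrow> \<bar>g x\<bar> \<le> C"
      "\<And>x y. x \<in> mspace path_metric \<Longrightarrow> y \<in> mspace path_metric \<Longrightarrow>
          \<bar>g x - g y\<bar> \<le> L * mdist path_metric x y"
    from lim[OF path_functional_of_Lipschitz[OF g]]
    show "(\<lambda>n. \<integral>\<omega>. g (\<lambda>t\<in>{0..1}. Y n t \<omega>) \<partial>P) \<longlonglongrightarrow> (\<integral>\<omega>. g (\<lambda>t\<in>{0..1}. Z t \<omega>) \<partial>Q)" by simp
  qed auto
  then show ?thesis using mY mZ by (simp add: conv_in_distribution_def)
qed

section \<open>Levy's continuity theorem in several variables\<close>

text \<open>Both \<open>a\<close> and its limit may depend on \<open>e\<close>, so this interchanges two limits without any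
  uniformity beyond the stated error bounds.\<close>

lemma tendsto_by_approximation:
  fixes x :: "nat \<Rightarrow> 'b::real_normed_vector"
  assumes "\<And>e. 0 < e \<Longrightarrow> \<exists>a L. a \<longlonglongrightarrow> L \<and> eventually (\<lambda>n. norm (x n - a n) < e) sequentially \<and> norm (l - L) < e"
  shows "x \<longlonglongrightarrow> l"
proof (rule tendstoI)
  fix e :: real assume "0 < e"
  then obtain a L where a: "a \<longlonglongrightarrow> L" and xa: "eventually (\<lambda>n. norm (x n - a n) < e / 3) sequentially"
    and lL: "norm (l - L) < e / 3"
    using assms[of "e / 3"] by auto
  have "eventually (\<lambda>n. dist (a n) L < e / 3) sequentially"
    using a \<open>0 < e\<close> by (intro tendstoD) auto
  with xa show "eventually (\<lambda>n. dist (x n) l < e) sequentially"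
  proof eventually_elim
    case (elim n)
    have "norm (x n - l) \<le> norm (x n - a n) + norm (a n - L) + norm (L - l)"
      using norm_triangle_ineq[of "x n - a n + (a n - L)" "L - l"] norm_triangle_ineq[of "x n - a n" "a n - L"]
      by simp
    then show ?case using elim lL by (simp add: dist_norm norm_minus_commute)
  qed
qed

lemma borel_measurable_cis [measurable]: "cis \<in> borel_measurable borel"
  by (intro borel_measurable_continuous_onI continuous_intros)

lemma borel_measurable_cnj [measurable]: "cnj \<in> borel_measurable borel"
  by (intro borel_measurable_continuous_onI continuous_intros)

definition weighted_law :: "'c measure \<Rightarrow> ('c \<Rightarrow> real) \<Rightarrow> ('c \<Rightarrow> real) \<Rightarrow> real measure" where
  "weighted_law R V T = distr (density R (\<lambda>\<omega>. ennreal (V \<omega> / (\<integral>\<omega>. V \<omega> \<partial>R)))) borel T"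

lemma weighted_law:
  fixes V T :: "'c \<Rightarrow> real"
  assumes R: "prob_space R" and [measurable]: "V \<in> borel_measurable R" "T \<in> borel_measurable R"
    and V: "\<And>\<omega>. 1 \<le> V \<omega> \<and> V \<omega> \<le> C"
  shows one_le_weighted_mass: "1 \<le> (\<integral>\<omega>. V \<omega> \<partial>R)"
    and real_distribution_weighted_law: "real_distribution (weighted_law R V T)"
    and integral_weighted_law: "\<And>g :: real \<Rightarrow> 'd::{banach,second_countable_topology}. g \<in> borel_measurable borel \<Longrightarrow>
         integral\<^sup>L (weighted_law R V T) g = (1 / (\<integral>\<omega>. V \<omega> \<partial>R)) *\<^sub>R (\<integral>\<omega>. V \<omega> *\<^sub>R g (T \<omega>) \<partial>R)"
proof -
  interpret R: prob_space R by fact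
  let ?m = "\<integral>\<omega>. V \<omega> \<partial>R"
  have Vabs: "\<bar>V \<omega>\<bar> \<le> C" for \<omega> using V[of \<omega>] by linarith
  then have Vint: "integrable R V"
    by (intro R.integrable_const_bound[where B=C]) auto
  have "(\<integral>\<omega>. 1 \<partial>R) \<le> ?m" using V Vint by (intro integral_mono) auto
  then show m: "1 \<le> ?m" by (simp add: R.prob_space)
  have nn: "0 \<le> V \<omega> / ?m" for \<omega>
    using m V[of \<omega>] by (intro divide_nonneg_nonneg) linarith+
  have "prob_space (density R (\<lambda>\<omega>. ennreal (V \<omega> / ?m)))"
  proof (rule prob_spaceI)
    have "emeasure (density R (\<lambda>\<omega>. ennreal (V \<omega> / ?m))) (space R) = (\<integral>\<^sup>+\<omega>. ennreal (V \<omega> / ?m) \<partial>R)"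
      by (subst emeasure_density) (auto intro!: nn_integral_cong simp: indicator_def)
    also have "\<dots> = ennreal (\<integral>\<omega>. V \<omega> / ?m \<partial>R)"
      using nn Vint by (intro nn_integral_eq_integral) auto
    also have "\<dots> = 1" using m by simp
    finally show "emeasure (density R (\<lambda>\<omega>. ennreal (V \<omega> / ?m))) (space (density R (\<lambda>\<omega>. ennreal (V \<omega> / ?m)))) = 1"
      by simp
  qed
  then show "real_distribution (weighted_law R V T)"
    unfolding weighted_law_def by (intro real_distribution.intro prob_space.prob_space_distr
        real_distribution_axioms.intro) auto
  show "integral\<^sup>L (weighted_law R V T) g = (1 / ?m) *\<^sub>R (\<integral>\<omega>. V \<omega> *\<^sub>R g (T \<omega>) \<partial>R)"
    if [measurable]: "g \<in> borel_measurable borel" for g :: "real \<Rightarrow> 'd"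
  proof -
    have "integral\<^sup>L (weighted_law R V T) g = (\<integral>\<omega>. (V \<omega> / ?m) *\<^sub>R g (T \<omega>) \<partial>R)"
      unfolding weighted_law_def using nn by (simp add: integral_distr integral_density)
    also have "\<dots> = (\<integral>\<omega>. (1 / ?m) *\<^sub>R (V \<omega> *\<^sub>R g (T \<omega>)) \<partial>R)" by simp
    finally show ?thesis by (simp only: integral_scaleR_right)
  qed
qed

text \<open>The hypothesis at \<open>t = 0\<close> says that the total masses of the weights converge; dividing by
  them turns the remaining hypotheses into convergence of the characteristic functions of the
  weighted laws.\<close>

lemma weighted_levy:
  fixes P :: "'a measure" and Q :: "'b measure"
  assumes P: "prob_space P" and Q: "prob_space Q"
    and X[measurable]: "\<And>n. X n \<in> borel_measurable P" and Y[measurable]: "Y \<in> borel_measurable Q"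
    and W[measurable]: "\<And>n. W n \<in> borel_measurable P" and W'[measurable]: "W' \<in> borel_measurable Q"
    and Wb: "\<And>n \<omega>. 1 \<le> W n \<omega> \<and> W n \<omega> \<le> C" and Wb': "\<And>\<omega>. 1 \<le> W' \<omega> \<and> W' \<omega> \<le> C"
    and lim: "\<And>t. (\<lambda>n. \<integral>\<omega>. of_real (W n \<omega>) * cis (t * X n \<omega>) \<partial>P) \<longlonglongrightarrow> (\<integral>\<omega>. of_real (W' \<omega>) * cis (t * Y \<omega>) \<partial>Q)"
    and f: "\<And>x. isCont f x" and fb: "\<And>x. \<bar>f x\<bar> \<le> D"
  shows "(\<lambda>n. \<integral>\<omega>. W n \<omega> * f (X n \<omega>) \<partial>P) \<longlonglongrightarrow> (\<integral>\<omega>. W' \<omega> * f (Y \<omega>) \<partial>Q)"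
proof -
  have mlim: "(\<lambda>n. \<integral>\<omega>. W n \<omega> \<partial>P) \<longlonglongrightarrow> (\<integral>\<omega>. W' \<omega> \<partial>Q)"
    using tendsto_Re[OF lim[of 0]] by simp
  have m1: "1 \<le> (\<integral>\<omega>. W n \<omega> \<partial>P)" for n by (rule one_le_weighted_mass[OF P W X Wb])
  have m2: "1 \<le> (\<integral>\<omega>. W' \<omega> \<partial>Q)" by (rule one_le_weighted_mass[OF Q W' Y Wb'])
  then have mQ: "(\<integral>\<omega>. W' \<omega> \<partial>Q) \<noteq> 0" by linarith
  have rd: "real_distribution (weighted_law P (W n) (X n))" for n
    by (rule real_distribution_weighted_law[OF P W X Wb])
  have rd': "real_distribution (weighted_law Q W' Y)"
    by (rule real_distribution_weighted_law[OF Q W' Y Wb'])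
  have "weak_conv_m (\<lambda>n. weighted_law P (W n) (X n)) (weighted_law Q W' Y)"
  proof (rule levy_continuity[OF rd rd'])
    fix t
    have c: "(\<lambda>x. cis (t * x)) \<in> borel_measurable borel" by measurable
    have "(\<lambda>n. (1 / (\<integral>\<omega>. W n \<omega> \<partial>P)) *\<^sub>R (\<integral>\<omega>. W n \<omega> *\<^sub>R cis (t * X n \<omega>) \<partial>P))
      \<longlonglongrightarrow> (1 / (\<integral>\<omega>. W' \<omega> \<partial>Q)) *\<^sub>R (\<integral>\<omega>. W' \<omega> *\<^sub>R cis (t * Y \<omega>) \<partial>Q)"
      unfolding scaleR_conv_of_real[of _ "cis _"]
      using mQ by (intro tendsto_scaleR tendsto_divide tendsto_const lim mlim)
    then show "(\<lambda>n. char (weighted_law P (W n) (X n)) t) \<longlonglongrightarrow> char (weighted_law Q W' Y) t"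
      unfolding char_def cis_conv_exp[symmetric]
      by (simp only: integral_weighted_law[OF P W X Wb c] integral_weighted_law[OF Q W' Y Wb' c])
  qed
  then have lim_f: "(\<lambda>n. integral\<^sup>L (weighted_law P (W n) (X n)) f) \<longlonglongrightarrow> integral\<^sup>L (weighted_law Q W' Y) f"
    using f fb by (intro weak_conv_imp_integral_bdd_continuous_conv[OF rd rd', where B=D]) auto
  have fm: "f \<in> borel_measurable borel"
    using f by (intro borel_measurable_continuous_onI continuous_at_imp_continuous_on) auto
  have "(\<lambda>n. (\<integral>\<omega>. W n \<omega> \<partial>P) *\<^sub>R ((1 / (\<integral>\<omega>. W n \<omega> \<partial>P)) *\<^sub>R (\<integral>\<omega>. W n \<omega> *\<^sub>R f (X n \<omega>) \<partial>P)))
     \<longlonglongrightarrow> (\<integral>\<omega>. W' \<omega> \<partial>Q) *\<^sub>R ((1 / (\<integral>\<omega>. W' \<omega> \<partial>Q)) *\<^sub>R (\<integral>\<omega>. W' \<omega> *\<^sub>R f (Y \<omega>) \<partial>Q))"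
    using tendsto_scaleR[OF mlim lim_f]
    by (simp only: integral_weighted_law[OF P W X Wb fm] integral_weighted_law[OF Q W' Y Wb' fm])
  moreover have "(\<integral>\<omega>. W n \<omega> \<partial>P) \<noteq> 0" for n using m1[of n] by linarith
  ultimately show ?thesis using mQ by simp
qed

text \<open>Adding \<open>C + 1\<close> makes the weight at least 1. The contribution of the added constant is
  removed again by the unweighted continuity theorem, which is where \<open>lim1\<close> is used.\<close>

lemma signed_weighted_levy:
  fixes P :: "'a measure" and Q :: "'b measure"
  assumes P: "prob_space P" and Q: "prob_space Q"
    and X[measurable]: "\<And>n. X n \<in> borel_measurable P" and Y[measurable]: "Y \<in> borel_measurable Q"
    and W[measurable]: "\<And>n. W n \<in> borel_measurable P" and W'[measurable]: "W' \<in> borel_measurable Q"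
    and Wb: "\<And>n \<omega>. \<bar>W n \<omega>\<bar> \<le> C" and Wb': "\<And>\<omega>. \<bar>W' \<omega>\<bar> \<le> C"
    and lim1: "\<And>t. (\<lambda>n. \<integral>\<omega>. cis (t * X n \<omega>) \<partial>P) \<longlonglongrightarrow> (\<integral>\<omega>. cis (t * Y \<omega>) \<partial>Q)"
    and lim: "\<And>t. (\<lambda>n. \<integral>\<omega>. of_real (W n \<omega>) * cis (t * X n \<omega>) \<partial>P) \<longlonglongrightarrow> (\<integral>\<omega>. of_real (W' \<omega>) * cis (t * Y \<omega>) \<partial>Q)"
    and f: "\<And>x. isCont f x" and fb: "\<And>x. \<bar>f x\<bar> \<le> D"
  shows "(\<lambda>n. \<integral>\<omega>. W n \<omega> * f (X n \<omega>) \<partial>P) \<longlonglongrightarrow> (\<integral>\<omega>. W' \<omega> * f (Y \<omega>) \<partial>Q)"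
proof -
  interpret P: prob_space P by fact
  interpret Q: prob_space Q by fact
  have [measurable]: "f \<in> borel_measurable borel"
    using f by (intro borel_measurable_continuous_onI continuous_at_imp_continuous_on) auto
  have D: "0 \<le> D" using fb[of 0] by linarith
  have C: "0 \<le> C" using Wb'[of undefined] by linarith
  have int: "integrable P (\<lambda>\<omega>. of_real (W n \<omega>) * cis (t * X n \<omega>))" "integrable P (\<lambda>\<omega>. cis (t * X n \<omega>))"
    "integrable P (\<lambda>\<omega>. W n \<omega> * f (X n \<omega>))" "integrable P (\<lambda>\<omega>. f (X n \<omega>))" for n t
    subgoal using Wb by (intro P.integrable_const_bound[where B=C]) (auto simp: norm_mult)
    subgoal by (intro P.integrable_const_bound[where B=1]) auto
    subgoal using Wb fb C D by (intro P.integrable_const_bound[where B="C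
        * D"]) (auto simp: abs_mult intro!: mult_mono)
    subgoal using fb by (intro P.integrable_const_bound[where B=D]) auto
    done
  have int': "integrable Q (\<lambda>\<omega>. of_real (W' \<omega>) * cis (t * Y \<omega>))" "integrable Q (\<lambda>\<omega>. cis (t * Y \<omega>))"
    "integrable Q (\<lambda>\<omega>. W' \<omega> * f (Y \<omega>))" "integrable Q (\<lambda>\<omega>. f (Y \<omega>))" for t
    subgoal using Wb' by (intro Q.integrable_const_bound[where B=C]) (auto simp: norm_mult)
    subgoal by (intro Q.integrable_const_bound[where B=1]) auto
    subgoal using Wb' fb C D by (intro Q.integrable_const_bound[where B="C
        * D"]) (auto simp: abs_mult intro!: mult_mono)
    subgoal using fb by (intro Q.integrable_const_bound[where B=D]) auto
    done
  have "(\<lambda>n. \<integral>\<omega>. 1 * f (X n \<omega>) \<partial>P) \<longlonglongrightarrow> (\<integral>\<omega>. 1 * f (Y \<omega>) \<partial>Q)"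
    by (rule weighted_levy[OF P Q X Y _ _ _ _ _ f fb, where C=1]) (auto simp: lim1)
  then have plain: "(\<lambda>n. \<integral>\<omega>. f (X n \<omega>) \<partial>P) \<longlonglongrightarrow> (\<integral>\<omega>. f (Y \<omega>) \<partial>Q)" by simp
  have "(\<lambda>n. \<integral>\<omega>. (W n \<omega> + (C + 1)) * f (X n \<omega>) \<partial>P) \<longlonglongrightarrow> (\<integral>\<omega>. (W' \<omega> + (C + 1)) * f (Y \<omega>) \<partial>Q)"
  proof (rule weighted_levy[OF P Q X Y _ _ _ _ _ f fb, where C="2 * C + 1"])
    show "1 \<le> W n \<omega> + (C + 1) \<and> W n \<omega> + (C + 1) \<le> 2 * C + 1" for n \<omega> using Wb[of n \<omega>] by linarith
    show "1 \<le> W' \<omega> + (C + 1) \<and> W' \<omega> + (C + 1) \<le> 2 * C + 1" for \<omega> using Wb'[of \<omega>] by linarith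
    fix t
    have "(\<lambda>n. (\<integral>\<omega>. of_real (W n \<omega>) * cis (t * X n \<omega>) \<partial>P) + of_real (C + 1) * (\<integral>\<omega>. cis (t * X n \<omega>) \<partial>P))
      \<longlonglongrightarrow> (\<integral>\<omega>. of_real (W' \<omega>) * cis (t * Y \<omega>) \<partial>Q) + of_real (C + 1) * (\<integral>\<omega>. cis (t * Y \<omega>) \<partial>Q)"
      by (intro tendsto_intros lim lim1)
    then show "(\<lambda>n. \<integral>\<omega>. of_real (W n \<omega> + (C + 1)) * cis (t * X n \<omega>) \<partial>P)
      \<longlonglongrightarrow> (\<integral>\<omega>. of_real (W' \<omega> + (C + 1)) * cis (t * Y \<omega>) \<partial>Q)"
      unfolding of_real_add[of _ "C + 1"] distrib_right using int int' by simp
  qed measurable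
  then have "(\<lambda>n. (\<integral>\<omega>. W n \<omega> * f (X n \<omega>) \<partial>P) + (C + 1) * (\<integral>\<omega>. f (X n \<omega>) \<partial>P))
      \<longlonglongrightarrow> (\<integral>\<omega>. W' \<omega> * f (Y \<omega>) \<partial>Q) + (C + 1) * (\<integral>\<omega>. f (Y \<omega>) \<partial>Q)"
    unfolding distrib_right[of _ "C + 1"] using int int' by simp
  from tendsto_diff[OF this tendsto_mult_left[OF plain, of "C + 1"]] show ?thesis by simp
qed

text \<open>Real and imaginary part of the weight are combinations of \<open>W\<close> and \<open>cnj W\<close>, and the limits
  for \<open>cnj W\<close> at \<open>t\<close> are the conjugates of the limits for \<open>W\<close> at \<open>- t\<close>.\<close>

lemma complex_weighted_levy:
  fixes P :: "'a measure" and Q :: "'b measure" and W :: "nat \<Rightarrow> 'a \<Rightarrow> complex" and W' :: "'b \<Rightarrow> complex"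
  assumes P: "prob_space P" and Q: "prob_space Q"
    and X[measurable]: "\<And>n. X n \<in> borel_measurable P" and Y[measurable]: "Y \<in> borel_measurable Q"
    and W[measurable]: "\<And>n. W n \<in> borel_measurable P" and W'[measurable]: "W' \<in> borel_measurable Q"
    and Wb: "\<And>n \<omega>. cmod (W n \<omega>) \<le> C" and Wb': "\<And>\<omega>. cmod (W' \<omega>) \<le> C"
    and lim1: "\<And>t. (\<lambda>n. \<integral>\<omega>. cis (t * X n \<omega>) \<partial>P) \<longlonglongrightarrow> (\<integral>\<omega>. cis (t * Y \<omega>) \<partial>Q)"
    and lim: "\<And>t. (\<lambda>n. \<integral>\<omega>. W n \<omega> * cis (t * X n \<omega>) \<partial>P) \<longlonglongrightarrow> (\<integral>\<omega>. W' \<omega> * cis (t * Y \<omega>) \<partial>Q)"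
    and f: "\<And>x. isCont f x" and fb: "\<And>x. \<bar>f x\<bar> \<le> D"
  shows "(\<lambda>n. \<integral>\<omega>. W n \<omega> * of_real (f (X n \<omega>)) \<partial>P) \<longlonglongrightarrow> (\<integral>\<omega>. W' \<omega> * of_real (f (Y \<omega>)) \<partial>Q)"
proof -
  interpret P: prob_space P by fact
  interpret Q: prob_space Q by fact
  have [measurable]: "f \<in> borel_measurable borel"
    using f by (intro borel_measurable_continuous_onI continuous_at_imp_continuous_on) auto
  have D: "0 \<le> D" using fb[of 0] by linarith
  have C: "0 \<le> C" using Wb'[of undefined] norm_ge_zero order_trans by blast
  have int: "integrable P (\<lambda>\<omega>. W n \<omega> * cis (t * X n \<omega>))" "integrable P (\<lambda>\<omega>. W n \<omega> * of_real (f (X n \<omega>)))" for n t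
    subgoal using Wb by (intro P.integrable_const_bound[where B=C]) (auto simp: norm_mult)
    subgoal using Wb fb C D by (intro P.integrable_const_bound[where B="C
        * D"]) (auto simp: norm_mult intro!: mult_mono)
    done
  have int': "integrable Q (\<lambda>\<omega>. W' \<omega> * cis (t * Y \<omega>))" "integrable Q (\<lambda>\<omega>. W' \<omega> * of_real (f (Y \<omega>)))" for t
    subgoal using Wb' by (intro Q.integrable_const_bound[where B=C]) (auto simp: norm_mult)
    subgoal using Wb' fb C D by (intro Q.integrable_const_bound[where B="C
        * D"]) (auto simp: norm_mult intro!: mult_mono)
    done
  have conj_lim: "(\<lambda>n. \<integral>\<omega>. cnj (W n \<omega>) * cis (t * X n \<omega>) \<partial>P) \<longlonglongrightarrow> (\<integral>\<omega>. cnj (W' \<omega>) * cis (t * Y \<omega>) \<partial>Q)" for t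
  proof -
    have "(\<lambda>n. cnj (\<integral>\<omega>. W n \<omega> * cis (- t * X n \<omega>) \<partial>P)) \<longlonglongrightarrow> cnj (\<integral>\<omega>. W' \<omega> * cis (- t * Y \<omega>) \<partial>Q)"
      by (intro tendsto_cnj lim)
    then show ?thesis by (simp only: Bochner_Integration.integral_cnj[symmetric] complex_cnj_mult cis_cnj) simp
  qed
  have cint: "integrable P (\<lambda>\<omega>. cnj (W n \<omega>) * cis (t * X n \<omega>))" for n t
    using Wb by (intro P.integrable_const_bound[where B=C]) (auto simp: norm_mult)
  have cint': "integrable Q (\<lambda>\<omega>. cnj (W' \<omega>) * cis (t * Y \<omega>))" for t
    using Wb' by (intro Q.integrable_const_bound[where B=C]) (auto simp: norm_mult)
  have Re_eq: "of_real (Re w) * c = (w * c + cnj w * c) / 2" for w c :: complex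
    by (simp add: complex_add_cnj flip: distrib_right)
  have Im_eq: "of_real (Im w) * c = (w * c - cnj w * c) / (2 * \<i>)" for w c :: complex
  proof -
    have "w * c - cnj w * c = (2 * \<i>) * (of_real (Im w) * c)"
      unfolding left_diff_distrib[symmetric] complex_diff_cnj by simp
    then show ?thesis by simp
  qed
  have re: "(\<lambda>n. \<integral>\<omega>. Re (W n \<omega>) * f (X n \<omega>) \<partial>P) \<longlonglongrightarrow> (\<integral>\<omega>. Re (W' \<omega>) * f (Y \<omega>) \<partial>Q)"
  proof (rule signed_weighted_levy[OF P Q X Y _ _ _ _ lim1 _ f fb, where C=C])
    fix t
    have "(\<lambda>n. ((\<integral>\<omega>. W n \<omega> * cis (t * X n \<omega>) \<partial>P) + (\<integral>\<omega>. cnj (W n \<omega>) * cis (t * X n \<omega>) \<partial>P)) / 2)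
      \<longlonglongrightarrow> ((\<integral>\<omega>. W' \<omega> * cis (t * Y \<omega>) \<partial>Q) + (\<integral>\<omega>. cnj (W' \<omega>) * cis (t * Y \<omega>) \<partial>Q)) / 2"
      by (intro tendsto_intros lim conj_lim) auto
    then show "(\<lambda>n. \<integral>\<omega>. of_real (Re (W n \<omega>)) * cis (t * X n \<omega>) \<partial>P)
      \<longlonglongrightarrow> (\<integral>\<omega>. of_real (Re (W' \<omega>)) * cis (t * Y \<omega>) \<partial>Q)"
      unfolding Re_eq using int int' cint cint' by simp
  qed (auto intro: order_trans[OF abs_Re_le_cmod] Wb Wb')
  have im: "(\<lambda>n. \<integral>\<omega>. Im (W n \<omega>) * f (X n \<omega>) \<partial>P) \<longlonglongrightarrow> (\<integral>\<omega>. Im (W' \<omega>) * f (Y \<omega>) \<partial>Q)"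
  proof (rule signed_weighted_levy[OF P Q X Y _ _ _ _ lim1 _ f fb, where C=C])
    fix t
    have "(\<lambda>n. ((\<integral>\<omega>. W n \<omega> * cis (t * X n \<omega>) \<partial>P) - (\<integral>\<omega>. cnj (W n \<omega>) * cis (t * X n \<omega>) \<partial>P)) / (2 * \<i>))
      \<longlonglongrightarrow> ((\<integral>\<omega>. W' \<omega> * cis (t * Y \<omega>) \<partial>Q) - (\<integral>\<omega>. cnj (W' \<omega>) * cis (t * Y \<omega>) \<partial>Q)) / (2 * \<i>)"
      by (intro tendsto_intros lim conj_lim) auto
    then show "(\<lambda>n. \<integral>\<omega>. of_real (Im (W n \<omega>)) * cis (t * X n \<omega>) \<partial>P)
      \<longlonglongrightarrow> (\<integral>\<omega>. of_real (Im (W' \<omega>)) * cis (t * Y \<omega>) \<partial>Q)"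
      unfolding Im_eq using int int' cint cint' by simp
  qed (auto intro: order_trans[OF abs_Im_le_cmod] Wb Wb')
  have "integral\<^sup>L P (\<lambda>\<omega>. W n \<omega> * of_real (f (X n \<omega>))) =
      Complex (\<integral>\<omega>. Re (W n \<omega>) * f (X n \<omega>) \<partial>P) (\<integral>\<omega>. Im (W n \<omega>) * f (X n \<omega>) \<partial>P)" for n
    using integral_Re[OF int(2)] integral_Im[OF int(2)] by (simp add: complex_eq_iff)
  moreover have "integral\<^sup>L Q (\<lambda>\<omega>. W' \<omega> * of_real (f (Y \<omega>))) =
      Complex (\<integral>\<omega>. Re (W' \<omega>) * f (Y \<omega>) \<partial>Q) (\<integral>\<omega>. Im (W' \<omega>) * f (Y \<omega>) \<partial>Q)"
    using integral_Re[OF int'(2)] integral_Im[OF int'(2)] by (simp add: complex_eq_iff)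
  ultimately show ?thesis using tendsto_Complex[OF re im] by simp
qed

lemma sum_hat_le_1: "(\<Sum>k\<le>m. hat (s - real k)) \<le> 1"
proof (cases "0 \<le> s")
  case True
  then show ?thesis by (simp add: sum_hat_eq)
next
  case False
  have "(\<Sum>k\<le>m. hat (s - real k)) = (\<Sum>k\<in>{0}. hat (s - real k))"
    using False by (intro sum.mono_neutral_right) (auto simp: hat_def)
  then show ?thesis by simp
qed

text \<open>Multiplying \<open>\<phi>\<close> by the total weight \<open>\<Sum>k\<le>m. hat (s - k)\<close> loses at most the second term of
  the bound; what is left is a sum in which \<open>\<phi>\<close> is compared with \<open>v k\<close> only for nodes \<open>k\<close> at
  distance less than 1 from \<open>s\<close>.\<close>

lemma hat_partition_approx:
  assumes \<phi>: "\<bar>\<phi>\<bar> \<le> C" and \<delta>: "0 \<le> \<delta>"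
    and near: "\<And>k. k \<le> m \<Longrightarrow> \<bar>s - real k\<bar> < 1 \<Longrightarrow> \<bar>\<phi> - v k\<bar> \<le> \<delta>"
  shows "\<bar>\<phi> - (\<Sum>k\<le>m. v k * hat (s - real k))\<bar> \<le> \<delta> + C * (1 - (\<Sum>k\<le>m. hat (s - real k)))"
proof -
  let ?S = "\<Sum>k\<le>m. hat (s - real k)"
  have "\<phi> - (\<Sum>k\<le>m. v k * hat (s - real k)) = (\<Sum>k\<le>m. (\<phi> - v k) * hat (s - real k)) + \<phi> * (1 - ?S)"
    by (simp add: left_diff_distrib sum_subtractf sum_distrib_left algebra_simps)
  also have "\<bar>\<dots>\<bar> \<le> \<bar>\<Sum>k\<le>m. (\<phi> - v k) * hat (s - real k)\<bar> + \<bar>\<phi> * (1 - ?S)\<bar>"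
    by (rule abs_triangle_ineq)
  also have "\<bar>\<phi> * (1 - ?S)\<bar> \<le> C * (1 - ?S)"
    using \<phi> sum_hat_le_1[of s m] by (auto simp: abs_mult intro!: mult_right_mono)
  also have "\<bar>\<Sum>k\<le>m. (\<phi> - v k) * hat (s - real k)\<bar> \<le> (\<Sum>k\<le>m. \<delta> * hat (s - real k))"
  proof (intro order_trans[OF sum_abs] sum_mono)
    fix k assume k: "k \<in> {..m}"
    show "\<bar>(\<phi> - v k) * hat (s - real k)\<bar> \<le> \<delta> * hat (s - real k)"
    proof (cases "\<bar>s - real k\<bar> < 1")
      case True
      then show ?thesis using near[of k] k by (auto simp: abs_mult intro!: mult_right_mono)
    next
      case False
      then show ?thesis by (simp add: hat_def)
    qed
  qed
  also have "\<dots> = \<delta> * ?S" by (simp add: sum_distrib_left)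
  also have "\<dots> \<le> \<delta>" using \<delta> sum_hat_le_1[of s m] by (simp add: mult_left_le)
  finally show ?thesis by simp
qed

lemmas borel_measurable_Lipschitz_real_coordinates =
  borel_measurable_Lipschitz_coordinates[where 'b = real, unfolded real_norm_def]

text \<open>The form in which an approximation of the amplitude \<open>\<psi>\<close>, with an error that is small
  except for a tail term \<open>u\<close>, passes to the Fourier integrals below.\<close>

lemma norm_integral_modulated_diff_le:
  fixes R :: "'c measure" and \<psi> b \<theta> u :: "'c \<Rightarrow> real"
  assumes R: "prob_space R" and [measurable]: "\<psi> \<in> borel_measurable R" "\<theta> \<in> borel_measurable R"
      "b \<in> borel_measurable R" "u \<in> borel_measurable R"
    and \<psi>: "\<And>\<omega>. \<bar>\<psi> \<omega>\<bar> \<le> C" and u: "\<And>\<omega>. 0 \<le> u \<omega>" "\<And>\<omega>. u \<omega> \<le> 1" and C: "0 \<le> C"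
    and close: "\<And>\<omega>. \<bar>\<psi> \<omega> - b \<omega>\<bar> \<le> \<delta> + C * u \<omega>"
  shows "cmod ((\<integral>\<omega>. of_real (\<psi> \<omega>) * cis (\<theta> \<omega>) \<partial>R) - (\<integral>\<omega>. of_real (b \<omega>) * cis (\<theta> \<omega>) \<partial>R)) \<le> \<delta> + C * (\<integral>\<omega>. u \<omega> \<partial>R)"
proof -
  interpret R: prob_space R by fact
  have b: "\<bar>b \<omega>\<bar> \<le> C + (\<delta> + C)" for \<omega>
  proof -
    have "C * u \<omega> \<le> C * 1" using C u by (intro mult_left_mono) auto
    then show ?thesis using \<psi>[of \<omega>] close[of \<omega>] by linarith
  qed
  have int: "integrable R (\<lambda>\<omega>. of_real (\<psi> \<omega>) * cis (\<theta> \<omega>))" "integrable R (\<lambda>\<omega>. of_real (b \<omega>) * cis (\<theta> \<omega>))"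
    subgoal using \<psi> by (intro R.integrable_const_bound[where B=C]) (auto simp: norm_mult)
    subgoal using b by (intro R.integrable_const_bound[where B="C + (\<delta> + C)"]) (auto simp: norm_mult)
    done
  have intu: "integrable R u"
    using u by (intro R.integrable_const_bound[where B=1]) auto
  have "cmod ((\<integral>\<omega>. of_real (\<psi> \<omega>) * cis (\<theta> \<omega>) \<partial>R) - (\<integral>\<omega>. of_real (b \<omega>) * cis (\<theta> \<omega>) \<partial>R)) =
      cmod (\<integral>\<omega>. of_real (\<psi> \<omega>) * cis (\<theta> \<omega>) - of_real (b \<omega>) * cis (\<theta> \<omega>) \<partial>R)"
    by (subst Bochner_Integration.integral_diff[OF int]) (rule refl)
  also have "\<dots> \<le> (\<integral>\<omega>. cmod (of_real (\<psi> \<omega>) * cis (\<theta> \<omega>) - of_real (b \<omega>) * cis (\<theta> \<omega>)) \<partial>R)"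
    by (rule integral_norm_bound)
  also have "\<dots> \<le> (\<integral>\<omega>. \<delta> + C * u \<omega> \<partial>R)"
  proof (rule integral_mono)
    show "integrable R (\<lambda>\<omega>. cmod (of_real (\<psi> \<omega>) * cis (\<theta> \<omega>) - of_real (b \<omega>) * cis (\<theta> \<omega>)))"
      using int by (intro integrable_norm Bochner_Integration.integrable_diff)
    show "integrable R (\<lambda>\<omega>. \<delta> + C * u \<omega>)"
      using intu by (intro Bochner_Integration.integrable_add integrable_mult_right) auto
    fix \<omega>
    have "cmod (of_real (\<psi> \<omega>) * cis (\<theta> \<omega>) - of_real (b \<omega>) * cis (\<theta> \<omega>)) = \<bar>\<psi> \<omega> - b \<omega>\<bar>"
      unfolding left_diff_distrib[symmetric] of_real_diff[symmetric] norm_mult norm_of_real norm_cis by simp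
    then show "cmod (of_real (\<psi> \<omega>) * cis (\<theta> \<omega>) - of_real (b \<omega>) * cis (\<theta> \<omega>)) \<le> \<delta> + C * u \<omega>"
      using close[of \<omega>] by simp
  qed
  also have "\<dots> = \<delta> + C * (\<integral>\<omega>. u \<omega> \<partial>R)"
    using intu by (simp add: R.prob_space)
  finally show ?thesis .
qed

text \<open>The exponentials are traded for \<open>\<Phi>\<close> one coordinate at a time: by induction on \<open>l\<close>, the
  integrals of a bounded Lipschitz function of the first \<open>l\<close> coordinates times an exponential in the
  other ones converge. In the step a function of \<open>l + 1\<close> coordinates is approximated by a finite sum
  of products of a function of the first \<open>l\<close> coordinates with a hat function of coordinate \<open>l\<close>. For
  such a product, \<open>complex_weighted_levy\<close> applies to coordinate \<open>l\<close>, everything else being the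
  weight, whose convergence is the induction hypothesis. The mass that escapes from the range of the
  hat functions is itself the integral of a bounded continuous function of coordinate \<open>l\<close>.\<close>

lemma multivariate_levy:
  fixes P :: "'a measure" and Q :: "'b measure" and X :: "nat \<Rightarrow> nat \<Rightarrow> 'a \<Rightarrow> real" and Y :: "nat \<Rightarrow> 'b \<Rightarrow> real"
    and \<Phi> :: "(nat \<Rightarrow> real) \<Rightarrow> real"
  assumes P: "prob_space P" and Q: "prob_space Q"
    and X[measurable]: "\<And>n j. X n j \<in> borel_measurable P" and Y[measurable]: "\<And>j. Y j \<in> borel_measurable Q"
    and char: "\<And>\<xi>. (\<lambda>n. \<integral>\<omega>. cis (\<Sum>j<d. \<xi> j * X n j \<omega>) \<partial>P) \<longlonglongrightarrow> (\<integral>\<omega>. cis (\<Sum>j<d. \<xi> j * Y j \<omega>) \<partial>Q)"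
    and \<Phi>_bound: "\<And>x. \<bar>\<Phi> x\<bar> \<le> C"
    and \<Phi>_lip: "\<And>x y. \<bar>\<Phi> x - \<Phi> y\<bar> \<le> L * (\<Sum>j<d. \<bar>x j - y j\<bar>)" and L: "0 \<le> L"
  shows "(\<lambda>n. \<integral>\<omega>. \<Phi> (\<lambda>j. X n j \<omega>) \<partial>P) \<longlonglongrightarrow> (\<integral>\<omega>. \<Phi> (\<lambda>j. Y j \<omega>) \<partial>Q)"
proof -
  interpret P: prob_space P by fact
  interpret Q: prob_space Q by fact
  have C: "0 \<le> C" using \<Phi>_bound[of undefined] by linarith
  let ?E = "\<lambda>l \<Psi> \<xi> n. \<integral>\<omega>. of_real (\<Psi> (\<lambda>j. X n j \<omega>)) * cis (\<Sum>j\<in>{l..<d}. \<xi> j * X n j \<omega>) \<partial>P"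
  let ?E' = "\<lambda>l \<Psi> \<xi>. \<integral>\<omega>. of_real (\<Psi> (\<lambda>j. Y j \<omega>)) * cis (\<Sum>j\<in>{l..<d}. \<xi> j * Y j \<omega>) \<partial>Q"
  have mixed: "?E l \<Psi> \<xi> \<longlonglongrightarrow> ?E' l \<Psi> \<xi>"
    if "l \<le> d" "\<And>x. \<bar>\<Psi> x\<bar> \<le> C" "\<And>x y. \<bar>\<Psi> x - \<Psi> y\<bar> \<le> L * (\<Sum>j<l. \<bar>x j - y j\<bar>)" for l \<Psi> \<xi>
    using that
  proof (induction l arbitrary: \<Psi> \<xi>)
    case 0
    obtain c where c: "\<Psi> = (\<lambda>_. c)"
    proof
      show "\<Psi> = (\<lambda>_. \<Psi> undefined)" using 0(3)[of _ undefined] by (intro ext) simp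
    qed
    have "(\<lambda>n. of_real c * (\<integral>\<omega>. cis (\<Sum>j<d. \<xi> j * X n j \<omega>) \<partial>P)) \<longlonglongrightarrow> of_real c * (\<integral>\<omega>. cis (\<Sum>j<d. \<xi> j * Y j \<omega>) \<partial>Q)"
      by (intro tendsto_intros char)
    then show ?case by (simp add: c atLeast0LessThan)
  next
    case (Suc l)
    have ld: "l < d" using Suc.prems(1) by simp
    have \<Psi>_meas: "(\<lambda>\<omega>. \<Psi> (\<lambda>j. X n j \<omega>)) \<in> borel_measurable P" "(\<lambda>\<omega>. \<Psi> (\<lambda>j. Y j \<omega>)) \<in> borel_measurable Q" for n
      by (rule borel_measurable_Lipschitz_real_coordinates[OF Suc.prems(3) X],
          rule borel_measurable_Lipschitz_real_coordinates[OF Suc.prems(3) Y])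
    have marginal: "(\<lambda>n. \<integral>\<omega>. cis (t * X n l \<omega>) \<partial>P) \<longlonglongrightarrow> (\<integral>\<omega>. cis (t * Y l \<omega>) \<partial>Q)" for t
      using char[of "\<lambda>j. if j = l then t else 0"] ld by (simp add: if_distrib[of "\<lambda>x. x * _"] cong: if_cong)
    show ?case
    proof (rule tendsto_by_approximation)
      fix e :: real assume e: "0 < e"
      define h where "h = e / 4 / (L + 1)"
      have h: "0 < h" using e L by (simp add: h_def)
      have Lh: "L * h < e / 3"
      proof -
        have "L * h \<le> (L + 1) * h" using h by (intro mult_right_mono) auto
        also have "\<dots> = e / 4"
        proof -
          have "c * (e / 4 / c) = e / 4" if "c \<noteq> 0" for c :: real using that by simp
          moreover have "L + 1 \<noteq> 0" using L by linarith
          ultimately show ?thesis unfolding h_def by blast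
        qed
        finally show ?thesis using e by linarith
      qed
      \<comment> \<open>The hats have mesh \<open>h\<close> and centres \<open>h * (k - K)\<close>; \<open>S K\<close> is their total weight, equal to 1
        on \<open>[- h * K, h * K]\<close>.\<close>
      define S where "S K x = (\<Sum>k\<le>2 * K. hat (x / h + real K - real k))" for K x
      have S01: "0 \<le> 1 - S K x" "1 - S K x \<le> 1" for K x
        unfolding S_def using sum_hat_le_1 by (auto intro!: sum_nonneg)
      have S_cont: "isCont (\<lambda>x. 1 - S K x) x" for K x
      proof -
        have "continuous_on UNIV (\<lambda>x. 1 - S K x)" unfolding S_def by (intro continuous_intros) (use h in auto)
        then show ?thesis by (simp add: continuous_on_eq_continuous_at)
      qed
      have S_meas[measurable]: "S K \<in> borel_measurable borel" for K
      proof -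
        have "continuous_on UNIV (S K)" unfolding S_def by (intro continuous_intros) (use h in auto)
        then show ?thesis by (rule borel_measurable_continuous_onI)
      qed
      have "(\<lambda>K. \<integral>\<omega>. 1 - S K (Y l \<omega>) \<partial>Q) \<longlonglongrightarrow> (\<integral>\<omega>. 0 \<partial>Q)"
      proof (rule integral_dominated_convergence[where w="\<lambda>_. 1"])
        show "AE \<omega> in Q. (\<lambda>K. 1 - S K (Y l \<omega>)) \<longlonglongrightarrow> 0"
        proof (rule AE_I2)
          fix \<omega>
          obtain K0 where K0: "\<bar>Y l \<omega> / h\<bar> \<le> real K0" using real_arch_simple by blast
          have "1 - S K (Y l \<omega>) = 0" if "K \<ge> K0" for K
          proof -
            have "0 \<le> Y l \<omega> / h + real K" "Y l \<omega> / h + real K \<le> real (2 * K)" using K0 that by linarith+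
            then show ?thesis unfolding S_def by (simp add: sum_hat_eq)
          qed
          then show "(\<lambda>K. 1 - S K (Y l \<omega>)) \<longlonglongrightarrow> 0"
            by (intro tendsto_eventually) (auto simp: eventually_sequentially)
        qed
      qed (use S01 in auto)
      then have "(\<lambda>K. C * (\<integral>\<omega>. 1 - S K (Y l \<omega>) \<partial>Q)) \<longlonglongrightarrow> C * 0" by (intro tendsto_mult_left) simp
      then have "eventually (\<lambda>K. C * (\<integral>\<omega>. 1 - S K (Y l \<omega>) \<partial>Q) < e / 3) sequentially"
        using e by (intro order_tendstoD(2)[where a="e/3" and y=0]) auto
      then obtain K where K: "C * (\<integral>\<omega>. 1 - S K (Y l \<omega>) \<partial>Q) < e / 3"
        by (auto simp: eventually_sequentially)
      have "(\<lambda>n. \<integral>\<omega>. 1 * of_real (1 - S K (X n l \<omega>)) \<partial>P) \<longlonglongrightarrow> (\<integral>\<omega>. 1 * complex_of_real (1 - S K (Y l \<omega>)) \<partial>Q)"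
        using S01 marginal
        by (intro complex_weighted_levy[OF P Q, where C=1 and D=1] S_cont) (auto simp: abs_le_iff)
      then have "(\<lambda>n. Re (\<integral>\<omega>. of_real (1 - S K (X n l \<omega>)) \<partial>P)) \<longlonglongrightarrow> Re (\<integral>\<omega>. complex_of_real (1 - S K (Y l \<omega>)) \<partial>Q)"
        unfolding mult_1_left by (rule tendsto_Re)
      then have tail: "(\<lambda>n. \<integral>\<omega>. 1 - S K (X n l \<omega>) \<partial>P) \<longlonglongrightarrow> (\<integral>\<omega>. 1 - S K (Y l \<omega>) \<partial>Q)"
        unfolding integral_complex_of_real Re_complex_of_real .
      then have "(\<lambda>n. C * (\<integral>\<omega>. 1 - S K (X n l \<omega>) \<partial>P)) \<longlonglongrightarrow> C * (\<integral>\<omega>. 1 - S K (Y l \<omega>) \<partial>Q)"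
        by (rule tendsto_mult_left)
      then have tail_ev: "eventually (\<lambda>n. C * (\<integral>\<omega>. 1 - S K (X n l \<omega>) \<partial>P) < e / 3) sequentially"
        using K by (rule order_tendstoD(2))
      \<comment> \<open>Freezing coordinate \<open>l\<close> at the centre \<open>p k\<close> leaves a function of the first \<open>l\<close>
        coordinates.\<close>
      define p where "p k = h * (real k - real K)" for k
      define \<Psi>k where "\<Psi>k k x = \<Psi> (x(l := p k))" for k x
      define a where "a n \<omega> = (\<Sum>k\<le>2 * K. \<Psi>k k (\<lambda>j. X n j \<omega>) * hat (X n l \<omega> / h + real K - real k))" for n \<omega>
      define a' where "a' \<omega> = (\<Sum>k\<le>2 * K. \<Psi>k k (\<lambda>j. Y j \<omega>) * hat (Y l \<omega> / h + real K - real k))" for \<omega>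
      have \<Psi>k_lip: "\<bar>\<Psi>k k x - \<Psi>k k y\<bar> \<le> L * (\<Sum>j<l. \<bar>x j - y j\<bar>)" for k x y
      proof -
        have "\<bar>\<Psi>k k x - \<Psi>k k y\<bar> \<le> L * (\<Sum>j<Suc l. \<bar>(x(l := p k)) j - (y(l := p k)) j\<bar>)"
          unfolding \<Psi>k_def by (rule Suc.prems(3))
        then show ?thesis by simp
      qed
      have \<Psi>k_bound: "\<bar>\<Psi>k k x\<bar> \<le> C" for k x unfolding \<Psi>k_def by (rule Suc.prems(2))
      have \<Psi>k_meas[measurable]: "(\<lambda>\<omega>. \<Psi>k k (\<lambda>j. X n j \<omega>)) \<in> borel_measurable P"
          "(\<lambda>\<omega>. \<Psi>k k (\<lambda>j. Y j \<omega>)) \<in> borel_measurable Q" for n k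
        by (rule borel_measurable_Lipschitz_real_coordinates[OF \<Psi>k_lip X],
            rule borel_measurable_Lipschitz_real_coordinates[OF \<Psi>k_lip Y])
      have hat_meas[measurable]: "hat \<in> borel_measurable borel"
        by (intro borel_measurable_continuous_onI continuous_intros)
      have near: "\<bar>\<Psi> x - (\<Sum>k\<le>2 * K. \<Psi>k k x * hat (x l / h + real K - real k))\<bar> \<le> L * h + C * (1 - S K (x l))" for x
        unfolding S_def
      proof (rule hat_partition_approx)
        fix k assume "\<bar>x l / h + real K - real k\<bar> < 1"
        then have "h * \<bar>x l / h + real K - real k\<bar> \<le> h * 1" using h by (intro mult_left_mono) auto
        also have "h * \<bar>x l / h + real K - real k\<bar> = \<bar>x l - p k\<bar>"
          using h by (simp add: p_def abs_mult_pos' flip: abs_mult) (simp add: algebra_simps abs_mult_pos)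
        finally have "L * \<bar>x l - p k\<bar> \<le> L * h" using L by (intro mult_left_mono) auto
        moreover have "\<bar>\<Psi> x - \<Psi>k k x\<bar> \<le> L * (\<Sum>j<Suc l. \<bar>x j - (x(l := p k)) j\<bar>)"
          unfolding \<Psi>k_def by (rule Suc.prems(3))
        ultimately show "\<bar>\<Psi> x - \<Psi>k k x\<bar> \<le> L * h" by simp
      qed (use L h Suc.prems(2) in auto)
      have a_meas[measurable]: "a n \<in> borel_measurable P" "a' \<in> borel_measurable Q" for n
        unfolding a_def a'_def by measurable
      let ?\<theta> = "\<lambda>n \<omega>. \<Sum>j\<in>{Suc l..<d}. \<xi> j * X n j \<omega>"
      let ?\<theta>' = "\<lambda>\<omega>. \<Sum>j\<in>{Suc l..<d}. \<xi> j * Y j \<omega>"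
      let ?A = "\<lambda>n. \<integral>\<omega>. of_real (a n \<omega>) * cis (?\<theta> n \<omega>) \<partial>P" and ?A' = "\<integral>\<omega>. of_real (a' \<omega>) * cis (?\<theta>' \<omega>) \<partial>Q"
      have "?A \<longlonglongrightarrow> ?A'"
      proof -
        have lim_k: "(\<lambda>n. \<integral>\<omega>. (of_real (\<Psi>k k (\<lambda>j. X n j \<omega>)) * cis (?\<theta> n \<omega>)) * of_real (hat (X n l \<omega> / h + real K
            - real k)) \<partial>P)
            \<longlonglongrightarrow> (\<integral>\<omega>. (of_real (\<Psi>k k (\<lambda>j. Y j \<omega>)) * cis (?\<theta>' \<omega>)) * of_real (hat (Y l \<omega> / h + real K
                - real k)) \<partial>Q)" for k
        proof (rule complex_weighted_levy[OF P Q _ _ _ _ _ _ marginal, where C=C and D=1])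
          fix t
          have split: "{l..<d} = insert l {Suc l..<d}" using ld by auto
          have "?E l (\<Psi>k k) (\<xi>(l := t)) \<longlonglongrightarrow> ?E' l (\<Psi>k k) (\<xi>(l := t))"
            using ld \<Psi>k_bound \<Psi>k_lip by (intro Suc.IH) auto
          moreover have "cis (\<Sum>j\<in>{l..<d}. (\<xi>(l := t)) j * x j)
              = cis (\<Sum>j\<in>{Suc l..<d}. \<xi> j * x j) * cis (t * x l)" for x
          proof -
            have "(\<Sum>j\<in>{l..<d}. (\<xi>(l := t)) j * x j) = t * x l + (\<Sum>j\<in>{Suc l..<d}. (\<xi>(l := t)) j * x j)"
              unfolding split by simp
            also have "(\<Sum>j\<in>{Suc l..<d}. (\<xi>(l := t)) j * x j) = (\<Sum>j\<in>{Suc l..<d}. \<xi> j * x j)"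
              by (intro sum.cong) auto
            finally show ?thesis by (simp add: cis_mult add.commute)
          qed
          ultimately show "(\<lambda>n. \<integral>\<omega>. (of_real (\<Psi>k k (\<lambda>j. X n j \<omega>)) * cis (?\<theta> n \<omega>)) * cis (t * X n l \<omega>) \<partial>P)
            \<longlonglongrightarrow> (\<integral>\<omega>. (of_real (\<Psi>k k (\<lambda>j. Y j \<omega>)) * cis (?\<theta>' \<omega>)) * cis (t * Y l \<omega>) \<partial>Q)"
            by (simp only: mult.assoc)
        next
          fix x
          have "continuous_on UNIV (\<lambda>x. hat (x / h + real K - real k))" by (intro continuous_intros) (use h in auto)
          then show "isCont (\<lambda>x. hat (x / h + real K - real k)) x" by (simp add: continuous_on_eq_continuous_at)
        qed (auto simp: norm_mult \<Psi>k_bound)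
        have ints: "integrable P (\<lambda>\<omega>. (of_real (\<Psi>k k (\<lambda>j. X n j \<omega>)) * cis (?\<theta> n \<omega>)) * of_real (hat (X n l \<omega> / h
            + real K - real k)))"
          "integrable Q (\<lambda>\<omega>. (of_real (\<Psi>k k (\<lambda>j. Y j \<omega>)) * cis (?\<theta>' \<omega>)) * complex_of_real (hat (Y l \<omega> / h + real K
              - real k)))" for n k
          subgoal by (intro P.integrable_const_bound[where B="C
              * 1"]) (auto simp: norm_mult \<Psi>k_bound intro!: mult_le_cancel_left1[THEN iffD2] order_trans[OF
              mult_mono[OF \<Psi>k_bound hat_le_1]] C)
          subgoal by (intro Q.integrable_const_bound[where B="C
              * 1"]) (auto simp: norm_mult \<Psi>k_bound intro!: order_trans[OF mult_mono[OF \<Psi>k_bound hat_le_1]] C)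
          done
        have "?A n = (\<Sum>k\<le>2 * K. \<integral>\<omega>. (of_real (\<Psi>k k (\<lambda>j. X n j \<omega>)) * cis (?\<theta> n \<omega>)) * of_real (hat (X n l \<omega> / h
            + real K - real k)) \<partial>P)" for n
          unfolding a_def by (subst Bochner_Integration.integral_sum[symmetric, OF ints(1)])
            (simp add: sum_distrib_right sum_distrib_left mult_ac)
        moreover have "?A' = (\<Sum>k\<le>2 * K. \<integral>\<omega>. (of_real (\<Psi>k k (\<lambda>j. Y j \<omega>)) * cis (?\<theta>' \<omega>)) * of_real (hat (Y l \<omega> / h
            + real K - real k)) \<partial>Q)"
          unfolding a'_def by (subst Bochner_Integration.integral_sum[symmetric, OF ints(2)])
            (simp add: sum_distrib_right sum_distrib_left mult_ac)
        ultimately show ?thesis by (simp only:) (intro tendsto_sum lim_k)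
      qed
      moreover have "eventually (\<lambda>n. norm (?E (Suc l) \<Psi> \<xi> n - ?A n) < e) sequentially"
        using tail_ev
      proof eventually_elim
        case (elim n)
        have "norm (?E (Suc l) \<Psi> \<xi> n - ?A n) \<le> L * h + C * (\<integral>\<omega>. 1 - S K (X n l \<omega>) \<partial>P)"
        proof (rule norm_integral_modulated_diff_le)
          show "\<bar>\<Psi> (\<lambda>j. X n j \<omega>) - a n \<omega>\<bar> \<le> L * h + C * (1 - S K (X n l \<omega>))" for \<omega>
            using near[of "\<lambda>j. X n j \<omega>"] by (simp only: a_def)
        qed (use \<Psi>_meas Suc.prems(2) S01 C P in auto)
        then show ?case using elim Lh e by linarith
      qed
      moreover have "norm (?E' (Suc l) \<Psi> \<xi> - ?A') < e"
      proof -
        have "norm (?E' (Suc l) \<Psi> \<xi> - ?A') \<le> L * h + C * (\<integral>\<omega>. 1 - S K (Y l \<omega>) \<partial>Q)"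
        proof (rule norm_integral_modulated_diff_le)
          show "\<bar>\<Psi> (\<lambda>j. Y j \<omega>) - a' \<omega>\<bar> \<le> L * h + C * (1 - S K (Y l \<omega>))" for \<omega>
            using near[of "\<lambda>j. Y j \<omega>"] by (simp only: a'_def)
        qed (use \<Psi>_meas Suc.prems(2) S01 C Q in auto)
        then show ?thesis using K Lh e by linarith
      qed
      ultimately show "\<exists>a L. a \<longlonglongrightarrow> L \<and> eventually (\<lambda>n. norm (?E (Suc l) \<Psi> \<xi> n - a n) < e) sequentially \<and>
          norm (?E' (Suc l) \<Psi> \<xi> - L) < e" by blast
    qed
  qed
  have "(\<lambda>n. Re (?E d \<Phi> (\<lambda>_. 0) n)) \<longlonglongrightarrow> Re (?E' d \<Phi> (\<lambda>_. 0))"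
    by (intro tendsto_Re mixed) (use \<Phi>_bound \<Phi>_lip in auto)
  then show ?thesis by simp
qed

lemma sum_even_odd:
  fixes f :: "nat \<Rightarrow> 'b::comm_monoid_add"
  shows "(\<Sum>j<2 * m. f j) = (\<Sum>l<m. f (2 * l) + f (2 * l + 1))"
  by (induction m) (simp_all add: algebra_simps)

text \<open>Complex vectors of length \<open>m\<close> as real vectors of length \<open>2 * m\<close>, real parts at even and
  imaginary parts at odd places.\<close>

definition coord :: "(nat \<Rightarrow> complex) \<Rightarrow> nat \<Rightarrow> real" where
  "coord z j = (if even j then Re (z (j div 2)) else Im (z (j div 2)))"

definition of_coord :: "(nat \<Rightarrow> real) \<Rightarrow> nat \<Rightarrow> complex" where
  "of_coord x l = Complex (x (2 * l)) (x (2 * l + 1))"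

lemma of_coord_coord [simp]: "of_coord (coord z) = z"
  by (simp add: of_coord_def coord_def fun_eq_iff complex_eq_iff)

corollary multivariate_levy_complex:
  fixes P :: "'a measure" and Q :: "'b measure" and X :: "nat \<Rightarrow> nat \<Rightarrow> 'a \<Rightarrow> complex" and Y :: "nat \<Rightarrow> 'b \<Rightarrow> complex"
    and \<Phi> :: "(nat \<Rightarrow> complex) \<Rightarrow> real"
  assumes P: "prob_space P" and Q: "prob_space Q"
    and X[measurable]: "\<And>n l. X n l \<in> borel_measurable P" and Y[measurable]: "\<And>l. Y l \<in> borel_measurable Q"
    and char: "\<And>\<eta>. (\<lambda>n. \<integral>\<omega>. cis (\<Sum>l<m. Re (\<eta> l * X n l \<omega>)) \<partial>P) \<longlonglongrightarrow> (\<integral>\<omega>. cis (\<Sum>l<m. Re (\<eta> l * Y l \<omega>)) \<partial>Q)"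
    and \<Phi>_bound: "\<And>x. \<bar>\<Phi> x\<bar> \<le> C"
    and \<Phi>_lip: "\<And>x y. \<bar>\<Phi> x - \<Phi> y\<bar> \<le> L * (\<Sum>l<m. cmod (x l - y l))" and L: "0 \<le> L"
  shows "(\<lambda>n. \<integral>\<omega>. \<Phi> (\<lambda>l. X n l \<omega>) \<partial>P) \<longlonglongrightarrow> (\<integral>\<omega>. \<Phi> (\<lambda>l. Y l \<omega>) \<partial>Q)"
proof -
  have inner: "(\<Sum>j<2 * m. \<xi> j * coord z j) = (\<Sum>l<m. Re (Complex (\<xi> (2 * l)) (- \<xi> (2 * l + 1)) * z l))" for \<xi> z
    by (simp add: sum_even_odd coord_def)
  have "(\<lambda>n. \<integral>\<omega>. \<Phi> (of_coord (\<lambda>j. coord (\<lambda>l. X n l \<omega>) j)) \<partial>P) \<longlonglongrightarrow> (\<integral>\<omega>. \<Phi> (of_coord (\<lambda>j. coord (\<lambda>l. Y l \<omega>) j)) \<partial>Q)"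
  proof (rule multivariate_levy[OF P Q, where d="2 * m" and C=C and L=L and \<Phi>="\<lambda>x. \<Phi> (of_coord x)"])
    show "(\<lambda>\<omega>. coord (\<lambda>l. X n l \<omega>) j) \<in> borel_measurable P" for n j
      unfolding coord_def by (cases "even j") simp_all
    show "(\<lambda>\<omega>. coord (\<lambda>l. Y l \<omega>) j) \<in> borel_measurable Q" for j
      unfolding coord_def by (cases "even j") simp_all
    show "(\<lambda>n. \<integral>\<omega>. cis (\<Sum>j<2 * m. \<xi> j * coord (\<lambda>l. X n l \<omega>) j) \<partial>P)
        \<longlonglongrightarrow> (\<integral>\<omega>. cis (\<Sum>j<2 * m. \<xi> j * coord (\<lambda>l. Y l \<omega>) j) \<partial>Q)" for \<xi>
      unfolding inner by (rule char)
    fix x y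
    have "\<bar>\<Phi> (of_coord x) - \<Phi> (of_coord y)\<bar> \<le> L * (\<Sum>l<m. cmod (of_coord x l - of_coord y l))"
      by (rule \<Phi>_lip)
    also have "\<dots> \<le> L * (\<Sum>j<2 * m. \<bar>x j - y j\<bar>)"
      unfolding sum_even_odd
    proof (intro mult_left_mono sum_mono L)
      fix l
      show "cmod (of_coord x l - of_coord y l) \<le> \<bar>x (2 * l) - y (2 * l)\<bar> + \<bar>x (2 * l + 1) - y (2 * l + 1)\<bar>"
        using cmod_le[of "of_coord x l - of_coord y l"] by (simp add: of_coord_def)
    qed
    finally show "\<bar>\<Phi> (of_coord x) - \<Phi> (of_coord y)\<bar> \<le> L * (\<Sum>j<2 * m. \<bar>x j - y j\<bar>)" .
  qed (use \<Phi>_bound L in auto)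
  then show ?thesis by simp
qed

section \<open>Characteristic functions of Brownian increments\<close>

lemma lborel_complex_eq_distr: "(lborel :: complex measure)
    = distr (lborel \<Otimes>\<^sub>M lborel) borel (\<lambda>(x, y). Complex x y)"
proof (rule lborel_eqI)
  have [measurable]: "(\<lambda>(x, y). Complex x y) \<in> borel_measurable (lborel \<Otimes>\<^sub>M lborel)"
    by (subst borel_measurable_complex_iff) (simp add: split_beta')
  fix l u :: complex
  assume le: "\<And>b. b \<in> Basis \<Longrightarrow> l \<bullet> b \<le> u \<bullet> b"
  then have le': "Re l \<le> Re u" "Im l \<le> Im u" using le[of 1] le[of \<i>] by (simp_all add: Basis_complex_def)
  have "emeasure (distr (lborel \<Otimes>\<^sub>M lborel) borel (\<lambda>(x, y). Complex x y)) (box l u) =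
      emeasure (lborel \<Otimes>\<^sub>M lborel) ({Re l<..<Re u} \<times> {Im l<..<Im u})"
    by (subst emeasure_distr) (auto intro!: arg_cong2[where f=emeasure] simp: mem_box Basis_complex_def
        space_pair_measure)
  also have "\<dots> = emeasure lborel {Re l<..<Re u} * emeasure lborel {Im l<..<Im u}"
    by (intro lborel.emeasure_pair_measure_Times) auto
  also have "\<dots> = ennreal ((Re u - Re l) * (Im u - Im l))"
    using le' by (simp add: ennreal_mult)
  also have "\<dots> = ennreal (\<Prod>b\<in>Basis. (u - l) \<bullet> b)"
    by (simp add: Basis_complex_def)
  finally show "emeasure (distr (lborel \<Otimes>\<^sub>M lborel) borel (\<lambda>(x, y). Complex x y)) (box l u)
      = (\<Prod>b\<in>Basis. (u - l) \<bullet> b)" .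
qed simp

lemma integral_cis_normal_density:
  assumes s: "0 < s"
  shows "(\<integral>x. cis (a * x) \<partial>density lborel (normal_density 0 s)) = of_real (exp (- (s\<^sup>2 * a\<^sup>2 / 2)))"
proof -
  interpret S: real_distribution std_normal_distribution by (rule real_dist_normal_dist)
  have "distributed std_normal_distribution lborel (\<lambda>x. x) std_normal_density"
    by (auto simp: distributed_def distr_id2)
  then have "distributed std_normal_distribution lborel (\<lambda>x. 0 + s * x) (normal_density (0 + s * 0) (\<bar>s\<bar> * 1))"
    using s by (intro S.normal_density_affine) auto
  then have "density lborel (normal_density 0 s) = distr std_normal_distribution lborel (\<lambda>x. s * x)"
    using s by (simp add: distributed_def)
  then have "(\<integral>x. cis (a * x) \<partial>density lborel (normal_density 0 s))
      = (\<integral>x. cis (a * (s * x)) \<partial>std_normal_distribution)"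
    by (simp add: integral_distr)
  also have "\<dots> = char std_normal_distribution (a * s)"
    by (simp add: char_def cis_conv_exp mult_ac)
  also have "\<dots> = of_real (exp (- (s\<^sup>2 * a\<^sup>2 / 2)))"
    by (simp add: char_std_normal_distribution power_mult_distrib mult.commute)
  finally show ?thesis .
qed

text \<open>The density is a product over the two coordinates, so the law of \<open>Z\<close> is the image of the
  product of two normal laws.\<close>

lemma expectation_cis_gaussian:
  fixes Z :: "'b \<Rightarrow> complex"
  assumes s: "0 < s"
    and Z: "distributed N lborel Z (\<lambda>z. ennreal (normal_density 0 s (Re z) * normal_density 0 s (Im z)))"
  shows "(\<integral>\<omega>. cis (Re (\<eta> * Z \<omega>)) \<partial>N) = of_real (exp (- (s\<^sup>2 * (cmod \<eta>)\<^sup>2 / 2)))"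
proof -
  let ?g = "\<lambda>z. ennreal (normal_density 0 s (Re z) * normal_density 0 s (Im z))"
  define \<mu> where "\<mu> = density lborel (\<lambda>x. ennreal (normal_density 0 s x))"
  interpret \<mu>: prob_space \<mu> unfolding \<mu>_def by (rule prob_space_normal_density[OF s])
  interpret \<mu>\<mu>: pair_prob_space \<mu> \<mu> ..
  let ?C = "\<lambda>(x, y). Complex x y"
  have sets_\<mu>[measurable_cong]: "sets \<mu> = sets borel" by (simp add: \<mu>_def)
  have C[measurable]: "?C \<in> borel_measurable (lborel \<Otimes>\<^sub>M lborel)"
    by (subst borel_measurable_complex_iff) (simp add: split_beta')
  have C': "?C \<in> borel_measurable (\<mu> \<Otimes>\<^sub>M \<mu>)"
    by (subst borel_measurable_complex_iff) (simp add: split_beta')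
  have Zm: "Z \<in> borel_measurable N" using Z by (simp add: distributed_def)
  have "distr N lborel Z = density lborel ?g" using Z by (simp add: distributed_def)
  also have "\<dots> = density (distr (lborel \<Otimes>\<^sub>M lborel) borel ?C) ?g" by (subst lborel_complex_eq_distr) (rule refl)
  also have "\<dots> = distr (density (lborel \<Otimes>\<^sub>M lborel) (\<lambda>p. ?g (?C p))) borel ?C"
    by (rule density_distr) measurable
  also have "(\<lambda>p. ?g (?C p)) = (\<lambda>(x, y). ennreal (normal_density 0 s x) * ennreal (normal_density 0 s y))"
    by (auto simp: fun_eq_iff ennreal_mult)
  also have "density (lborel \<Otimes>\<^sub>M lborel) (\<lambda>(x, y). ennreal (normal_density 0 s x)
      * ennreal (normal_density 0 s y)) = \<mu> \<Otimes>\<^sub>M \<mu>"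
    unfolding \<mu>_def
    by (rule pair_measure_density[symmetric])
       (auto intro!: lborel.sigma_finite_measure_axioms \<mu>.sigma_finite_measure_axioms[unfolded \<mu>_def])
  finally have law: "distr N lborel Z = distr (\<mu> \<Otimes>\<^sub>M \<mu>) borel ?C" .
  have cis_m: "(\<lambda>z. cis (Re (\<eta> * z))) \<in> borel_measurable borel" by measurable
  have "(\<integral>\<omega>. cis (Re (\<eta> * Z \<omega>)) \<partial>N) = (\<integral>z. cis (Re (\<eta> * z)) \<partial>distr N lborel Z)"
    using Zm cis_m by (subst integral_distr) auto
  also have "\<dots> = (\<integral>p. cis (Re (\<eta> * ?C p)) \<partial>(\<mu> \<Otimes>\<^sub>M \<mu>))"
    unfolding law using C' cis_m by (rule integral_distr)
  also have "\<dots> = (\<integral>(x, y). cis (Re \<eta> * x) * cis (- Im \<eta> * y) \<partial>(\<mu> \<Otimes>\<^sub>M \<mu>))"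
    by (intro Bochner_Integration.integral_cong refl) (auto simp: cis_mult)
  also have "\<dots> = (\<integral>x. (\<integral>y. cis (Re \<eta> * x) * cis (- Im \<eta> * y) \<partial>\<mu>) \<partial>\<mu>)"
    by (rule \<mu>\<mu>.integral_fst[symmetric])
       (auto intro!: \<mu>\<mu>.integrable_const_bound[where B=1] simp: split_beta' norm_mult)
  also have "\<dots> = (\<integral>x. cis (Re \<eta> * x) \<partial>\<mu>) * (\<integral>y. cis (- Im \<eta> * y) \<partial>\<mu>)" by simp
  also have "\<dots> = of_real (exp (- (s\<^sup>2 * (Re \<eta>)\<^sup>2 / 2))) * of_real (exp (- (s\<^sup>2 * (- Im \<eta>)\<^sup>2 / 2)))"
    unfolding \<mu>_def by (simp only: integral_cis_normal_density[OF s])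
  also have "\<dots> = of_real (exp (- (s\<^sup>2 * (cmod \<eta>)\<^sup>2 / 2)))"
    unfolding of_real_mult[symmetric] exp_add[symmetric] cmod_power2 by (simp add: algebra_simps add_divide_distrib)
  finally show ?thesis .
qed

lemma (in brownian_motion_2d) expectation_cis_increments:
  assumes m: "0 < m"
  shows "expectation (\<lambda>\<omega>. cis (\<Sum>l<m. Re (\<eta> l * (of_real \<sigma> * (B (real (Suc l) / real m) \<omega>
      - B (real l / real m) \<omega>))))) =
    of_real (exp (- (\<sigma>\<^sup>2 / (2 * real m) * (\<Sum>l<m. (cmod (\<eta> l))\<^sup>2))))"
proof -
  define t where "t l = real l / real m" for l
  define D where "D l \<omega> = B (t (Suc l)) \<omega> - B (t l) \<omega>" for l \<omega>
  have t_less: "t l < t (Suc l)" for l using m by (simp add: t_def divide_strict_right_mono)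
  have t_diff: "t (Suc l) - t l = 1 / real m" for l by (simp add: t_def diff_divide_distrib[symmetric])
  have ind: "indep_vars (\<lambda>_. borel) D {..<m}"
    unfolding D_def by (rule independent_increments) (auto simp: t_less, simp add: t_def)
  have gauss: "distributed N lborel (D l) (\<lambda>z. ennreal (normal_density 0 (sqrt (1 / real m)) (Re z)
      * normal_density 0 (sqrt (1 / real m)) (Im z)))" for l
    using gaussian_increments[OF _ t_less[of l]] unfolding D_def t_diff by (simp add: t_def)
  have D_meas: "D l \<in> borel_measurable N" for l using gauss[of l] by (simp add: distributed_def)
  let ?f = "\<lambda>l z. cis (Re (\<eta> l * of_real \<sigma> * z))"
  have ind': "indep_vars (\<lambda>_. borel) (\<lambda>l \<omega>. ?f l (D l \<omega>)) {..<m}"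
    by (rule indep_vars_compose2[OF ind]) measurable
  have "expectation (\<lambda>\<omega>. \<Prod>l<m. ?f l (D l \<omega>)) = (\<Prod>l<m. expectation (\<lambda>\<omega>. ?f l (D l \<omega>)))"
    using D_meas by (intro indep_vars_lebesgue_integral ind') (auto intro!: integrable_const_bound[where B=1])
  also have "\<dots> = (\<Prod>l<m. of_real (exp (- (\<sigma>\<^sup>2 / (2 * real m) * (cmod (\<eta> l))\<^sup>2))))"
  proof (intro prod.cong refl)
    fix l
    have "expectation (\<lambda>\<omega>. ?f l (D l \<omega>)) = of_real (exp (- ((sqrt (1 / real m))\<^sup>2 * (cmod (\<eta> l
        * of_real \<sigma>))\<^sup>2 / 2)))"
      using m by (intro expectation_cis_gaussian[OF _ gauss]) auto
    then show "expectation (\<lambda>\<omega>. ?f l (D l \<omega>)) = of_real (exp (- (\<sigma>\<^sup>2 / (2 * real m) * (cmod (\<eta> l))\<^sup>2)))"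
      by (simp add: norm_mult power_mult_distrib mult_ac)
  qed
  also have "\<dots> = of_real (exp (- (\<sigma>\<^sup>2 / (2 * real m) * (\<Sum>l<m. (cmod (\<eta> l))\<^sup>2))))"
    by (simp add: exp_sum sum_distrib_left sum_negf[symmetric])
  also have "(\<lambda>\<omega>. \<Prod>l<m. ?f l (D l \<omega>)) = (\<lambda>\<omega>. cis (\<Sum>l<m. Re (\<eta> l * (of_real \<sigma> * (B (t (Suc l)) \<omega> - B (t l) \<omega>)))))"
  proof -
    have "(\<Prod>l\<in>A. cis (g l)) = cis (\<Sum>l\<in>A. g l)" if "finite A" for A :: "nat set" and g
      using that by (induction A) (simp_all add: cis_mult)
    then show ?thesis by (simp only: finite_lessThan D_def mult.assoc)
  qed
  finally show ?thesis by (simp only: t_def)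
qed

section \<open>Products of independent unit complex numbers\<close>

text \<open>\<open>V 0\<close> is the initial direction of a walk with unit steps and \<open>V (Suc j)\<close> its \<open>j\<close>-th turn.
  The limit theorem sees the law of the turns through their first two moments \<open>r\<close> and \<open>s\<close>, which are
  real when the turning angle is symmetric.\<close>

locale unit_steps = prob_space M for M :: "'a measure" +
  fixes V :: "nat \<Rightarrow> 'a \<Rightarrow> complex" and r s :: real
  assumes indep: "indep_vars (\<lambda>_. borel) V UNIV"
    and norm_V [simp]: "\<And>j \<omega>. \<omega> \<in> space M \<Longrightarrow> cmod (V j \<omega>) = 1"
    and mean_V: "\<And>j. expectation (V (Suc j)) = of_real r"
    and mean_V2: "\<And>j. expectation (\<lambda>\<omega>. (V (Suc j) \<omega>)\<^sup>2) = of_real s"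
    and abs_r: "\<bar>r\<bar> < 1" and abs_s: "\<bar>s\<bar> < 1"
begin

definition U :: "nat \<Rightarrow> 'a \<Rightarrow> complex" where
  "U k \<omega> = (\<Prod>j\<le>k. V j \<omega>)"

definition past :: "nat \<Rightarrow> 'a measure" where
  "past k = sigma (space M) (\<Union>j\<le>k. {V j -` A \<inter> space M |A. A \<in> sets borel})"

lemma measurable_V [measurable]: "V j \<in> borel_measurable M"
  using indep unfolding indep_vars_def by auto

lemma space_past [simp]: "space (past k) = space M"
  unfolding past_def by (intro space_measure_of) auto

lemma sets_past: "sets (past k) = sigma_sets (space M) (\<Union>j\<le>k. {V j -` A \<inter> space M |A. A \<in> sets borel})"
  unfolding past_def by (intro sets_measure_of) auto

lemma sets_past_subset: "sets (past k) \<subseteq> sets M"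
  unfolding sets_past by (intro sets.sigma_sets_subset) auto

lemma borel_measurable_past_mono:
  assumes "f \<in> borel_measurable (past k)" "k \<le> l" shows "f \<in> borel_measurable (past l)"
proof -
  have "sets (past k) \<subseteq> sets (past l)"
    unfolding sets_past by (intro sigma_sets_mono') (use assms(2) in \<open>auto dest: order_trans\<close>)
  then show ?thesis using assms(1) by (auto simp: measurable_def)
qed

lemma borel_measurable_past_imp: "f \<in> borel_measurable (past k) \<Longrightarrow> f \<in> borel_measurable M"
  using sets_past_subset[of k] by (auto simp: measurable_def)

lemma V_past: "j \<le> k \<Longrightarrow> V j \<in> borel_measurable (past k)"
  by (auto simp: measurable_def sets_past intro!: sigma_sets.Basic)

lemma U_past: "j \<le> k \<Longrightarrow> U j \<in> borel_measurable (past k)"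
  unfolding U_def by (intro borel_measurable_prod V_past) auto

lemma norm_U [simp]: "\<omega> \<in> space M \<Longrightarrow> cmod (U k \<omega>) = 1"
  by (simp add: U_def prod_norm[symmetric])

lemma U_Suc: "U (Suc k) \<omega> = U k \<omega> * V (Suc k) \<omega>"
  by (simp add: U_def)

lemma measurable_U [measurable]: "U j \<in> borel_measurable M"
  unfolding U_def by measurable

lemma integrable_bounded:
  fixes f :: "'a \<Rightarrow> 'b::{banach,second_countable_topology}"
  assumes "f \<in> borel_measurable M" "\<And>\<omega>. \<omega> \<in> space M \<Longrightarrow> norm (f \<omega>) \<le> B"
  shows "integrable M f"
  using assms by (intro integrable_const_bound[where B=B]) (auto intro!: AE_I2)

lemma norm_expectation_le:
  fixes f :: "'a \<Rightarrow> 'b::{banach,second_countable_topology}"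
  assumes "f \<in> borel_measurable M" "\<And>\<omega>. \<omega> \<in> space M \<Longrightarrow> norm (f \<omega>) \<le> B"
  shows "norm (expectation f) \<le> B"
proof -
  have "norm (expectation f) \<le> expectation (\<lambda>\<omega>. norm (f \<omega>))" by (rule integral_norm_bound)
  also have "\<dots> \<le> expectation (\<lambda>_. B)"
    using integrable_bounded[OF assms] assms(2) by (intro integral_mono) auto
  finally show ?thesis by (simp add: prob_space)
qed

lemma indep_past_next:
  fixes W :: "'a \<Rightarrow> complex" and g :: "complex \<Rightarrow> complex"
  assumes W: "W \<in> borel_measurable (past k)" and g: "g \<in> borel_measurable borel"
  shows "indep_var borel W borel (\<lambda>\<omega>. g (V (Suc k) \<omega>))"
proof -
  let ?E = "\<lambda>j. {V j -` A \<inter> space M |A. A \<in> sets borel}"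
  let ?I = "\<lambda>b. if b then {..k} else {Suc k}"
  have "indep_sets (\<lambda>b. sigma_sets (space M) (\<Union>j\<in>?I b. ?E j)) UNIV"
  proof (rule indep_sets_collect_sigma)
    have "indep_sets ?E UNIV"
      using indep unfolding indep_vars_def2 by simp
    then show "indep_sets ?E (\<Union>b\<in>UNIV. ?I b)"
      by (rule indep_sets_mono_index[rotated]) auto
    show "Int_stable (?E j)" for j
    proof (rule Int_stableI)
      fix a b assume "a \<in> ?E j" "b \<in> ?E j"
      then obtain A B where "a = V j -` A \<inter> space M" "b = V j -` B \<inter> space M" "A \<in> sets borel" "B \<in> sets borel"
        by blast
      then have "a \<inter> b = V j -` (A \<inter> B) \<inter> space M" "A \<inter> B \<in> sets borel" by auto
      then show "a \<inter> b \<in> ?E j" by blast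
    qed
    show "disjoint_family_on ?I UNIV" by (auto simp: disjoint_family_on_def)
  qed
  then have *: "indep_sets (\<lambda>b. if b then sets (past k) else sigma_sets (space M) (?E (Suc k))) UNIV"
    by (rule indep_sets_mono_sets) (auto simp: sets_past)
  have "indep_set (sigma_sets (space M) {W -` A \<inter> space M |A. A \<in> sets borel})
      (sigma_sets (space M) {(\<lambda>\<omega>. g (V (Suc k) \<omega>)) -` A \<inter> space M |A. A \<in> sets borel})"
    unfolding indep_set_def
  proof (rule indep_sets_mono_sets[OF *])
    have 1: "sigma_sets (space M) {W -` A \<inter> space M |A. A \<in> sets borel} \<subseteq> sets (past k)"
    proof -
      have "{W -` A \<inter> space M |A. A \<in> sets borel} \<subseteq> sets (past k)"
        using measurable_sets[OF W] by auto
      from sets.sigma_sets_subset[OF this] show ?thesis by simp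
    qed
    have 2: "sigma_sets (space M) {(\<lambda>\<omega>. g (V (Suc k) \<omega>)) -` A \<inter> space M |A. A \<in> sets borel}
        \<subseteq> sigma_sets (space M) (?E (Suc k))"
    proof (intro sigma_sets_mono' subsetI)
      fix a assume "a \<in> {(\<lambda>\<omega>. g (V (Suc k) \<omega>)) -` A \<inter> space M |A. A \<in> sets borel}"
      then obtain A where A: "A \<in> sets borel" "a = (\<lambda>\<omega>. g (V (Suc k) \<omega>)) -` A \<inter> space M" by blast
      then have "a = V (Suc k) -` (g -` A) \<inter> space M" "g -` A \<in> sets borel"
        using measurable_sets[OF g A(1)] by auto
      then show "a \<in> ?E (Suc k)" by blast
    qed
    show "case_bool (sigma_sets (space M) {W -` A \<inter> space M |A. A \<in> sets borel})
        (sigma_sets (space M) {(\<lambda>\<omega>. g (V (Suc k) \<omega>)) -` A \<inter> space M |A. A \<in> sets borel}) b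
        \<subseteq> (if b then sets (past k) else sigma_sets (space M) (?E (Suc k)))" for b
      using 1 2 by (cases b) simp_all
  qed
  then show ?thesis
    unfolding indep_var_eq using borel_measurable_past_imp[OF W] g by auto
qed

lemma expectation_past_times_next:
  fixes W :: "'a \<Rightarrow> complex" and g :: "complex \<Rightarrow> complex"
  assumes W: "W \<in> borel_measurable (past k)" and Wb: "\<And>\<omega>. \<omega> \<in> space M \<Longrightarrow> cmod (W \<omega>) \<le> B"
    and g: "g \<in> borel_measurable borel" and gb: "\<And>z. cmod z = 1 \<Longrightarrow> cmod (g z) \<le> B'"
  shows "expectation (\<lambda>\<omega>. W \<omega> * g (V (Suc k) \<omega>)) = expectation W * expectation (\<lambda>\<omega>. g (V (Suc k) \<omega>))"
proof (rule indep_var_lebesgue_integral)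
  note g[measurable]
  show "indep_var borel W borel (\<lambda>\<omega>. g (V (Suc k) \<omega>))" by (rule indep_past_next[OF W g])
  show "integrable M W" using borel_measurable_past_imp[OF W] Wb by (rule integrable_bounded)
  show "integrable M (\<lambda>\<omega>. g (V (Suc k) \<omega>))" by (rule integrable_bounded[where B=B']) (auto intro!: gb)
qed

lemma integrable_V [simp]: "integrable M (V j)" "integrable M (\<lambda>\<omega>. (V j \<omega>)\<^sup>2)"
  by (auto intro!: integrable_bounded[where B=1] simp: norm_power)

lemma mean_increment: "expectation (\<lambda>\<omega>. V (Suc k) \<omega> - of_real r) = 0"
  using mean_V[of k] by (simp add: prob_space)

lemma mean_increment_sq: "expectation (\<lambda>\<omega>. (V (Suc k) \<omega> - of_real r)\<^sup>2) = of_real (s - r\<^sup>2)"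
proof -
  have "expectation (\<lambda>\<omega>. (V (Suc k) \<omega> - of_real r)\<^sup>2) =
      expectation (\<lambda>\<omega>. (V (Suc k) \<omega>)\<^sup>2 - 2 * of_real r * V (Suc k) \<omega> + (of_real r)\<^sup>2)"
    by (simp add: power2_diff algebra_simps)
  also have "\<dots> = of_real s - 2 * of_real r * of_real r + (of_real r)\<^sup>2"
    by (simp add: prob_space mean_V mean_V2)
  finally show ?thesis by (simp add: power2_eq_square)
qed

lemma mean_increment_abs_sq:
  "expectation (\<lambda>\<omega>. (V (Suc k) \<omega> - of_real r) * cnj (V (Suc k) \<omega> - of_real r)) = of_real (1 - r\<^sup>2)"
proof -
  have cnjV: "expectation (\<lambda>\<omega>. cnj (V (Suc k) \<omega>)) = of_real r"
    using mean_V[of k] by (simp add: integral_cnj)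
  have int: "integrable M (\<lambda>\<omega>. cnj (V (Suc k) \<omega>))" by simp
  have "expectation (\<lambda>\<omega>. (V (Suc k) \<omega> - of_real r) * cnj (V (Suc k) \<omega> - of_real r)) =
      expectation (\<lambda>\<omega>. 1 - of_real r * V (Suc k) \<omega> - of_real r * cnj (V (Suc k) \<omega>) + (of_real r)\<^sup>2)"
  proof (rule Bochner_Integration.integral_cong[OF refl])
    fix \<omega> assume "\<omega> \<in> space M"
    then have "V (Suc k) \<omega> * cnj (V (Suc k) \<omega>) = 1"
      by (simp add: complex_norm_square[symmetric])
    then show "(V (Suc k) \<omega> - of_real r) * cnj (V (Suc k) \<omega> - of_real r) =
        1 - of_real r * V (Suc k) \<omega> - of_real r * cnj (V (Suc k) \<omega>) + (of_real r)\<^sup>2"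
      by (simp add: algebra_simps power2_eq_square)
  qed
  also have "\<dots> = 1 - of_real r * of_real r - of_real r * of_real r + (of_real r)\<^sup>2"
    using int by (simp add: prob_space mean_V cnjV)
  finally show ?thesis by (simp add: power2_eq_square)
qed

text \<open>The martingale property: since \<open>V (Suc k)\<close> is independent of the past, the factor with
  mean zero splits off.\<close>

lemma expectation_past_times_increment:
  fixes W :: "'a \<Rightarrow> complex"
  assumes W: "W \<in> borel_measurable (past k)" and Wb: "\<And>\<omega>. \<omega> \<in> space M \<Longrightarrow> cmod (W \<omega>) \<le> B"
  shows "expectation (\<lambda>\<omega>. W \<omega> * (V (Suc k) \<omega> - of_real r)) = 0"
proof -
  have "cmod (z - of_real r) \<le> 1 + \<bar>r\<bar>" if "cmod z = 1" for z
    using norm_triangle_ineq4[of z "of_real r"] that by simp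
  then have "expectation (\<lambda>\<omega>. W \<omega> * (V (Suc k) \<omega> - of_real r)) =
      expectation W * expectation (\<lambda>\<omega>. V (Suc k) \<omega> - of_real r)"
    by (intro expectation_past_times_next[OF W Wb, where g="\<lambda>z. z - of_real r"]) auto
  then show ?thesis by (simp only: mean_increment mult_zero_right)
qed

lemma norm_increment_le: "\<omega> \<in> space M \<Longrightarrow> cmod (V j \<omega> - of_real r) \<le> 2"
  using norm_triangle_ineq4[of "V j \<omega>" "of_real r"] abs_r by simp

end

section \<open>Fourth moments and the maximal inequality\<close>

lemma Re_of_real_mult: "Re (of_real x * z) = x * Re z"
  by simp

lemma cmod_add_sq: "(cmod (q + x))\<^sup>2 = (cmod q)\<^sup>2 + 2 * Re (cnj q * x) + (cmod x)\<^sup>2"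
  unfolding cmod_power2 by (simp add: power2_eq_square algebra_simps)

text \<open>One step of the fourth moment recursion. The term that is linear in \<open>x\<close> is kept exactly
  because its expectation vanishes; all other terms are estimated by means of \<open>cmod x \<le> 2\<close>.\<close>

lemma cmod_add_pow4_le:
  assumes "cmod x \<le> 2"
  shows "(cmod (q + x)) ^ 4 \<le> (cmod q) ^ 4 + 4 * (cmod q)\<^sup>2 * Re (cnj q * x) + 32 * (cmod q)\<^sup>2 + 48"
proof -
  define p t y where "p = cmod q" and "t = Re (cnj q * x)" and "y = cmod x"
  have p: "0 \<le> p" and y: "0 \<le> y" "y \<le> 2" using assms by (auto simp: p_def y_def)
  have t: "\<bar>t\<bar> \<le> p * y"
    using abs_Re_le_cmod[of "cnj q * x"] by (simp add: t_def p_def y_def norm_mult)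
  have y2: "y\<^sup>2 \<le> 4" using power_mono[OF y(2,1), of 2] by simp
  have t2: "t\<^sup>2 \<le> 4 * p\<^sup>2"
  proof -
    have "t\<^sup>2 \<le> (p * y)\<^sup>2" using t by (metis abs_ge_zero power2_abs power_mono)
    also have "\<dots> \<le> p\<^sup>2 * 4" unfolding power_mult_distrib using y2 by (intro mult_left_mono) auto
    finally show ?thesis by simp
  qed
  have ty: "t * y\<^sup>2 \<le> 8 * p"
  proof -
    have "t * y\<^sup>2 \<le> (p * 2) * 4"
    proof (intro mult_mono)
      have "p * y \<le> p * 2" using p y by (intro mult_left_mono) auto
      then show "t \<le> p * 2" using t by linarith
    qed (use y2 p in auto)
    then show ?thesis by simp
  qed
  have py: "p\<^sup>2 * y\<^sup>2 \<le> p\<^sup>2 * 4" using y2 by (intro mult_left_mono) auto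
  have y4: "(y\<^sup>2)\<^sup>2 \<le> 16" using power_mono[OF y2, of 2] by simp
  have pp: "32 * p \<le> 8 * p\<^sup>2 + 32" using zero_le_power2[of "p - 2"] by (simp add: power2_diff algebra_simps)
  have "(cmod (q + x)) ^ 4 = ((cmod (q + x))\<^sup>2)\<^sup>2" by simp
  also have "\<dots> = (p\<^sup>2 + 2 * t + y\<^sup>2)\<^sup>2" by (simp only: cmod_add_sq p_def t_def y_def)
  also have "\<dots> = p ^ 4 + 4 * t\<^sup>2 + (y\<^sup>2)\<^sup>2 + 4 * p\<^sup>2 * t + 2 * (p\<^sup>2 * y\<^sup>2) + 4 * (t * y\<^sup>2)"
    by (simp add: power2_eq_square power4_eq_xxxx algebra_simps)
  also have "\<dots> \<le> p ^ 4 + 4 * p\<^sup>2 * t + 32 * p\<^sup>2 + 48"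
    using t2 ty py y4 pp by linarith
  finally show ?thesis by (simp only: p_def t_def)
qed

context unit_steps
begin

lemma expectation_affine:
  fixes f g :: "'a \<Rightarrow> real"
  assumes "integrable M f" "integrable M g"
  shows "expectation (\<lambda>\<omega>. f \<omega> + b * g \<omega> + d) = expectation f + b * expectation g + d"
  using assms by (simp add: prob_space)

lemma expectation_Re_past_times_increment:
  assumes "W \<in> borel_measurable (past k)" and "\<And>\<omega>. \<omega> \<in> space M \<Longrightarrow> cmod (W \<omega>) \<le> B"
  shows "expectation (\<lambda>\<omega>. Re (W \<omega> * (V (Suc k) \<omega> - of_real r))) = 0"
proof -
  have B: "0 \<le> B"
  proof -
    obtain \<omega> where "\<omega> \<in> space M" using not_empty by blast
    then show ?thesis using assms(2) norm_ge_zero order_trans by blast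
  qed
  have "integrable M (\<lambda>\<omega>. W \<omega> * (V (Suc k) \<omega> - of_real r))"
    using borel_measurable_past_imp[OF assms(1)]
    by (intro integrable_bounded[where B="B * 2"])
       (auto simp: norm_mult intro!: mult_mono assms(2) norm_increment_le B)
  then show ?thesis
    by (simp only: integral_Re expectation_past_times_increment[OF assms] zero_complex.sel)
qed

context
  fixes G :: "nat \<Rightarrow> 'a \<Rightarrow> complex" and a :: nat
begin

text \<open>The martingale transform with the predictable multipliers \<open>G\<close>, started at time \<open>a\<close>.
  Besides the martingale itself (\<open>G = U\<close>) it comprises the martingale stopped at a random time, to
  which the moment bounds below apply as well.\<close>

definition transform :: "nat \<Rightarrow> 'a \<Rightarrow> complex" where
  "transform k \<omega> = (\<Sum>j\<in>{a..<a + k}. G j \<omega> * (V (Suc j) \<omega> - of_real r))"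

lemma transform_Suc:
  "transform (Suc k) \<omega> = transform k \<omega> + G (a + k) \<omega> * (V (Suc (a + k)) \<omega> - of_real r)"
  by (simp add: transform_def)

context
  assumes G_past: "\<And>j. G j \<in> borel_measurable (past j)"
    and G_le: "\<And>j \<omega>. \<omega> \<in> space M \<Longrightarrow> cmod (G j \<omega>) \<le> 1"
begin

lemma transform_past: "transform k \<in> borel_measurable (past (a + k))"
  unfolding transform_def
  by (intro borel_measurable_sum borel_measurable_times borel_measurable_diff borel_measurable_const
      V_past borel_measurable_past_mono[OF G_past]) auto

lemma norm_G_increment_le: "\<omega> \<in> space M \<Longrightarrow> cmod (G j \<omega> * (V (Suc j) \<omega> - of_real r)) \<le> 2"
  using mult_mono[OF G_le[of \<omega> j] norm_increment_le[of \<omega> "Suc j"]] by (simp add: norm_mult)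

lemma norm_transform_le: "\<omega> \<in> space M \<Longrightarrow> cmod (transform k \<omega>) \<le> 2 * real k"
  unfolding transform_def
  by (rule order_trans[OF sum_norm_bound[where K=2]]) (auto intro!: norm_G_increment_le)

lemma norm_transform_pow_le: "\<omega> \<in> space M \<Longrightarrow> (cmod (transform k \<omega>)) ^ p \<le> (2 * real k) ^ p"
  by (intro power_mono norm_transform_le) auto

lemma measurable_transform [measurable]: "transform k \<in> borel_measurable M"
  using transform_past by (rule borel_measurable_past_imp)

lemma integrable_transform_pow [simp]: "integrable M (\<lambda>\<omega>. (cmod (transform k \<omega>)) ^ p)"
  using norm_transform_pow_le by (intro integrable_bounded[where B="(2 * real k) ^ p"]) auto

lemma transform_cross_term:
  shows "expectation (\<lambda>\<omega>. (cmod (transform k \<omega>)) ^ p *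
      Re (cnj (transform k \<omega>) * (G (a + k) \<omega> * (V (Suc (a + k)) \<omega> - of_real r)))) = 0"
    and "integrable M (\<lambda>\<omega>. (cmod (transform k \<omega>)) ^ p *
      Re (cnj (transform k \<omega>) * (G (a + k) \<omega> * (V (Suc (a + k)) \<omega> - of_real r))))"
proof -
  let ?W = "\<lambda>\<omega>. of_real ((cmod (transform k \<omega>)) ^ p) * cnj (transform k \<omega>) * G (a + k) \<omega>"
  have cnj_m: "(\<lambda>\<omega>. cnj (transform k \<omega>)) \<in> borel_measurable (past (a + k))"
    using transform_past by (rule borel_measurable_continuous_on[rotated]) (intro continuous_intros)
  have W: "?W \<in> borel_measurable (past (a + k))"
    using G_past[of "a + k"] cnj_m transform_past[of k] by simp
  have Wb: "cmod (?W \<omega>) \<le> (2 * real k) ^ p * (2 * real k) * 1" if "\<omega> \<in> space M" for \<omega>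
  proof -
    have "cmod (of_real ((cmod (transform k \<omega>)) ^ p)) \<le> (2 * real k) ^ p"
      unfolding norm_of_real abs_of_nonneg[OF zero_le_power[OF norm_ge_zero]]
      by (rule norm_transform_pow_le[OF that])
    then show ?thesis
      unfolding norm_mult complex_mod_cnj
      by (intro mult_mono norm_transform_le G_le that) auto
  qed
  have eq: "Re (?W \<omega> * (V (Suc (a + k)) \<omega> - of_real r)) = (cmod (transform k \<omega>)) ^ p *
      Re (cnj (transform k \<omega>) * (G (a + k) \<omega> * (V (Suc (a + k)) \<omega> - of_real r)))" for \<omega>
  proof -
    have "?W \<omega> * (V (Suc (a + k)) \<omega> - of_real r) = of_real ((cmod (transform k \<omega>)) ^ p) *
        (cnj (transform k \<omega>) * (G (a + k) \<omega> * (V (Suc (a + k)) \<omega> - of_real r)))"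
      by (simp add: mult_ac)
    then show ?thesis by (simp only: Re_of_real_mult)
  qed
  from expectation_Re_past_times_increment[OF W Wb]
  show "expectation (\<lambda>\<omega>. (cmod (transform k \<omega>)) ^ p *
      Re (cnj (transform k \<omega>) * (G (a + k) \<omega> * (V (Suc (a + k)) \<omega> - of_real r)))) = 0"
    unfolding eq by simp
  show "integrable M (\<lambda>\<omega>. (cmod (transform k \<omega>)) ^ p *
      Re (cnj (transform k \<omega>) * (G (a + k) \<omega> * (V (Suc (a + k)) \<omega> - of_real r))))"
    unfolding eq[symmetric]
  proof (rule integrable_bounded)
    have "(\<lambda>\<omega>. V (Suc (a + k)) \<omega> - of_real r) \<in> borel_measurable M" by measurable
    with borel_measurable_past_imp[OF W]
    have "(\<lambda>\<omega>. ?W \<omega> * (V (Suc (a + k)) \<omega> - of_real r)) \<in> borel_measurable M"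
      by (rule borel_measurable_times)
    then show "(\<lambda>\<omega>. Re (?W \<omega> * (V (Suc (a + k)) \<omega> - of_real r))) \<in> borel_measurable M"
      by (simp only: borel_measurable_complex_iff)
    fix \<omega> assume \<omega>: "\<omega> \<in> space M"
    have "norm (Re (?W \<omega> * (V (Suc (a + k)) \<omega> - of_real r))) \<le> cmod (?W \<omega> * (V (Suc (a + k)) \<omega> - of_real r))"
      by (simp only: real_norm_def abs_Re_le_cmod)
    also have "\<dots> = cmod (?W \<omega>) * cmod (V (Suc (a + k)) \<omega> - of_real r)" by (rule norm_mult)
    also have "\<dots> \<le> ((2 * real k) ^ p * (2 * real k) * 1) * 2"
      using Wb[OF \<omega>] norm_increment_le[OF \<omega>] by (intro mult_mono) auto
    finally show "norm (Re (?W \<omega> * (V (Suc (a + k)) \<omega> - of_real r))) \<le> ((2 * real k) ^ p * (2 * real k) * 1) * 2" .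
  qed
qed

lemma transform_second_moment: "expectation (\<lambda>\<omega>. (cmod (transform k \<omega>))\<^sup>2) \<le> 4 * real k"
proof (induction k)
  case 0
  show ?case by (simp add: transform_def)
next
  case (Suc k)
  let ?x = "\<lambda>\<omega>. G (a + k) \<omega> * (V (Suc (a + k)) \<omega> - of_real r)"
  have cross: "expectation (\<lambda>\<omega>. Re (cnj (transform k \<omega>) * ?x \<omega>)) = 0"
    "integrable M (\<lambda>\<omega>. Re (cnj (transform k \<omega>) * ?x \<omega>))"
    using transform_cross_term[of k 0] by simp_all
  have "expectation (\<lambda>\<omega>. (cmod (transform (Suc k) \<omega>))\<^sup>2) \<le>
      expectation (\<lambda>\<omega>. (cmod (transform k \<omega>))\<^sup>2 + 2 * Re (cnj (transform k \<omega>) * ?x \<omega>) + 4)"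
  proof (rule integral_mono)
    fix \<omega> assume \<omega>: "\<omega> \<in> space M"
    have "(cmod (?x \<omega>))\<^sup>2 \<le> 4" using power_mono[OF norm_G_increment_le[OF \<omega>] norm_ge_zero, of "a + k" 2] by simp
    then show "(cmod (transform (Suc k) \<omega>))\<^sup>2 \<le>
        (cmod (transform k \<omega>))\<^sup>2 + 2 * Re (cnj (transform k \<omega>) * ?x \<omega>) + 4"
      unfolding transform_Suc cmod_add_sq by linarith
  qed (intro Bochner_Integration.integrable_add integrable_mult_right cross(2) integrable_transform_pow
      integrable_const)+
  also have "\<dots> = expectation (\<lambda>\<omega>. (cmod (transform k \<omega>))\<^sup>2) + 2 * expectation (\<lambda>\<omega>. Re (cnj (transform k \<omega>)
      * ?x \<omega>)) + 4"
    by (rule expectation_affine[OF integrable_transform_pow cross(2)])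
  also have "\<dots> \<le> 4 * real (Suc k)" using Suc cross(1) by simp
  finally show ?case .
qed

text \<open>The recursion adds at most \<open>32 * (4 * k) + 48\<close> in step \<open>k\<close>, by the bound on the second
  moment, and \<open>64 * k\<^sup>2\<close> grows by \<open>128 * k + 64\<close>.\<close>

lemma transform_fourth_moment: "expectation (\<lambda>\<omega>. (cmod (transform k \<omega>)) ^ 4) \<le> 64 * (real k)\<^sup>2"
proof (induction k)
  case 0
  show ?case by (simp add: transform_def)
next
  case (Suc k)
  let ?x = "\<lambda>\<omega>. G (a + k) \<omega> * (V (Suc (a + k)) \<omega> - of_real r)"
  let ?c = "\<lambda>\<omega>. (cmod (transform k \<omega>))\<^sup>2 * Re (cnj (transform k \<omega>) * ?x \<omega>)"
  have cross: "expectation ?c = 0" "integrable M ?c"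
    using transform_cross_term[of k 2] by simp_all
  have "expectation (\<lambda>\<omega>. (cmod (transform (Suc k) \<omega>)) ^ 4) \<le>
      expectation (\<lambda>\<omega>. (cmod (transform k \<omega>)) ^ 4 + 4 * ?c \<omega> + 32 * (cmod (transform k \<omega>))\<^sup>2 + 48)"
  proof (rule integral_mono)
    fix \<omega> assume \<omega>: "\<omega> \<in> space M"
    show "(cmod (transform (Suc k) \<omega>)) ^ 4 \<le>
        (cmod (transform k \<omega>)) ^ 4 + 4 * ?c \<omega> + 32 * (cmod (transform k \<omega>))\<^sup>2 + 48"
      using cmod_add_pow4_le[OF norm_G_increment_le[OF \<omega>, of "a + k"], of "transform k \<omega>"]
      by (simp only: transform_Suc mult.assoc)
  qed (use cross(2) in auto)
  also have "\<dots> = expectation (\<lambda>\<omega>. (cmod (transform k \<omega>)) ^ 4) + 4 * expectation ?c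
      + 32 * expectation (\<lambda>\<omega>. (cmod (transform k \<omega>))\<^sup>2) + 48"
  proof -
    have "expectation (\<lambda>\<omega>. 4 * ?c \<omega>) = 4 * expectation ?c"
      by (rule integral_mult_right_zero)
    moreover have "integrable M (\<lambda>\<omega>. 4 * ?c \<omega>)" using cross(2) by (rule integrable_mult_right)
    ultimately show ?thesis by (simp add: prob_space)
  qed
  also have "\<dots> \<le> 64 * (real k)\<^sup>2 + 32 * (4 * real k) + 48"
    using Suc cross(1) transform_second_moment[of k] by linarith
  also have "\<dots> \<le> 64 * (real (Suc k))\<^sup>2" by (simp add: power2_eq_square algebra_simps)
  finally show ?case .
qed

end

end

definition mart :: "nat \<Rightarrow> 'a \<Rightarrow> complex" where
  "mart k \<omega> = (\<Sum>j<k. U j \<omega> * (V (Suc j) \<omega> - of_real r))"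

lemma mart_Suc: "mart (Suc k) \<omega> = mart k \<omega> + U k \<omega> * (V (Suc k) \<omega> - of_real r)"
  by (simp add: mart_def)

lemma mart_past: "k \<le> l \<Longrightarrow> mart k \<in> borel_measurable (past l)"
  unfolding mart_def
  by (intro borel_measurable_sum borel_measurable_times borel_measurable_diff borel_measurable_const
      V_past U_past) auto

lemma measurable_mart [measurable]: "mart k \<in> borel_measurable M"
  unfolding mart_def by measurable

text \<open>The increments of \<open>mart\<close> are \<open>U (Suc j) - r * U j\<close>, so the sum of the directions is
  \<open>mart / (1 - r)\<close> up to two boundary terms of modulus at most \<open>1 / (1 - r)\<close>.\<close>

lemma partial_sum_eq_mart: "(1 - of_real r) * (\<Sum>j<k. U j \<omega>) = mart k \<omega> + U 0 \<omega> - U k \<omega>"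
proof (induction k)
  case 0
  show ?case by (simp add: mart_def)
next
  case (Suc k)
  then show ?case
    by (simp only: sum.lessThan_Suc distrib_left mart_Suc U_Suc) (simp add: algebra_simps)
qed

lemma sets_oscillation [measurable]:
  "{\<omega> \<in> space M. \<exists>k\<in>{a..b}. c \<le> cmod (mart k \<omega> - mart a \<omega>)} \<in> sets M"
proof -
  have "{\<omega> \<in> space M. c \<le> cmod (mart k \<omega> - mart a \<omega>)} \<in> sets M" for k
    by measurable
  then have "(\<Union>k\<in>{a..b}. {\<omega> \<in> space M. c \<le> cmod (mart k \<omega> - mart a \<omega>)}) \<in> sets M"
    by (intro sets.finite_UN) auto
  also have "(\<Union>k\<in>{a..b}. {\<omega> \<in> space M. c \<le> cmod (mart k \<omega> - mart a \<omega>)}) =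
      {\<omega> \<in> space M. \<exists>k\<in>{a..b}. c \<le> cmod (mart k \<omega> - mart a \<omega>)}" by blast
  finally show ?thesis .
qed

text \<open>Stop the martingale when it has first moved by \<open>c\<close> from its value at time \<open>a\<close>. On the
  event in question the increment of the stopped martingale from \<open>a\<close> to \<open>b\<close> has modulus at least
  \<open>c\<close>. Being a transform with multipliers of modulus at most 1, it has fourth moment at most
  \<open>64 * (b - a)\<^sup>2\<close>, so that Markov's inequality gives the bound.\<close>

lemma mart_maximal_inequality:
  assumes ab: "a \<le> b" and c: "0 < c"
  shows "prob {\<omega> \<in> space M. \<exists>k\<in>{a..b}. c \<le> cmod (mart k \<omega> - mart a \<omega>)} \<le> 64 * (real (b - a))\<^sup>2 / c ^ 4"
proof -
  let ?low = "\<lambda>j \<omega>. \<forall>i\<in>{a..j}. cmod (mart i \<omega> - mart a \<omega>) < c"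
  define G where "G j \<omega> = (if a \<le> j \<and> ?low j \<omega> then U j \<omega> else 0)" for j \<omega>
  have G_past: "G j \<in> borel_measurable (past j)" for j
  proof (cases "a \<le> j")
    case True
    have "{\<omega> \<in> space (past j). ?low j \<omega>} \<in> sets (past j)"
    proof (intro sets.sets_Collect_finite_All)
      fix i assume "i \<in> {a..j}"
      then have "(\<lambda>\<omega>. mart i \<omega> - mart a \<omega>) \<in> borel_measurable (past j)"
        by (intro borel_measurable_diff mart_past) auto
      then have "(\<lambda>\<omega>. cmod (mart i \<omega> - mart a \<omega>)) \<in> borel_measurable (past j)"
        by (rule measurable_compose) (rule borel_measurable_norm)
      then show "{\<omega> \<in> space (past j). cmod (mart i \<omega> - mart a \<omega>) < c} \<in> sets (past j)"
        by (rule borel_measurable_less) (rule borel_measurable_const)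
    qed auto
    then have "(\<lambda>\<omega>. if ?low j \<omega> then U j \<omega> else 0) \<in> borel_measurable (past j)"
      by (rule measurable_If[OF U_past[OF order_refl] borel_measurable_const])
    moreover have "G j = (\<lambda>\<omega>. if ?low j \<omega> then U j \<omega> else 0)"
      using True by (simp add: G_def fun_eq_iff)
    ultimately show ?thesis by (simp only:)
  next
    case False
    then show ?thesis by (simp add: G_def[abs_def])
  qed
  have G_le: "cmod (G j \<omega>) \<le> 1" if "\<omega> \<in> space M" for j \<omega>
    using that by (simp add: G_def)
  define Q where "Q = transform G a"
  have Q_Suc: "Q (Suc k) \<omega> = Q k \<omega> + G (a + k) \<omega> * (V (Suc (a + k)) \<omega> - of_real r)" for k \<omega>
    by (simp add: Q_def transform_def)
  have stopped: "(?low (a + k) \<omega> \<longrightarrow> Q k \<omega> = mart (a + k) \<omega> - mart a \<omega>) \<and>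
      (\<not> ?low (a + k) \<omega> \<longrightarrow> c \<le> cmod (Q k \<omega>))" for k \<omega>
  proof (induction k)
    case 0
    show ?case using c by (auto simp: Q_def transform_def)
  next
    case (Suc k)
    show ?case
    proof (cases "?low (a + k) \<omega>")
      case True
      then have G: "G (a + k) \<omega> = U (a + k) \<omega>" by (simp add: G_def)
      have "Q k \<omega> = mart (a + k) \<omega> - mart a \<omega>" using Suc True by blast
      then have eq: "Q (Suc k) \<omega> = mart (a + Suc k) \<omega> - mart a \<omega>"
        by (simp add: Q_Suc G mart_Suc)
      have "?low (a + Suc k) \<omega> \<longleftrightarrow> cmod (mart (a + Suc k) \<omega> - mart a \<omega>) < c"
        using True by (force simp: le_Suc_eq)
      then show ?thesis using eq by (metis not_less)
    next
      case False
      then have "G (a + k) \<omega> = 0" unfolding G_def by (simp only: if_False simp_thms)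
      then have eq: "Q (Suc k) \<omega> = Q k \<omega>" by (simp add: Q_Suc)
      have "\<not> ?low (a + Suc k) \<omega>" 
      proof
        assume "?low (a + Suc k) \<omega>"
        then have "?low (a + k) \<omega>" by auto
        with False show False by blast
      qed
      then show ?thesis using Suc False unfolding eq by blast
    qed
  qed
  let ?A = "{\<omega> \<in> space M. \<exists>k\<in>{a..b}. c \<le> cmod (mart k \<omega> - mart a \<omega>)}"
  have A: "?A \<in> sets M" by (rule sets_oscillation)
  have int: "integrable M (\<lambda>\<omega>. (cmod (Q (b - a) \<omega>)) ^ 4)"
    unfolding Q_def by (rule integrable_transform_pow[OF G_past G_le])
  have "c ^ 4 * prob ?A = expectation (\<lambda>\<omega>. c ^ 4 * indicator ?A \<omega>)"
    using A by simp
  also have "\<dots> \<le> expectation (\<lambda>\<omega>. (cmod (Q (b - a) \<omega>)) ^ 4)"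
  proof (rule integral_mono[OF _ int])
    show "integrable M (\<lambda>\<omega>. c ^ 4 * indicator ?A \<omega>)"
      using A by (intro integrable_mult_right integrable_real_indicator) (auto simp: emeasure_eq_measure)
    fix \<omega>
    show "c ^ 4 * indicator ?A \<omega> \<le> (cmod (Q (b - a) \<omega>)) ^ 4"
    proof (cases "\<omega> \<in> ?A")
      case True
      then obtain i where i: "i \<in> {a..b}" "\<not> cmod (mart i \<omega> - mart a \<omega>) < c" by (auto simp: not_less)
      have "\<not> ?low (a + (b - a)) \<omega>"
      proof
        assume low: "?low (a + (b - a)) \<omega>"
        have "i \<in> {a..a + (b - a)}" using i(1) ab by simp
        then show False using low i(2) by blast
      qed
      then have "c \<le> cmod (Q (b - a) \<omega>)" using stopped by blast
      then show ?thesis using True c by (auto intro!: power_mono)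
    qed simp
  qed
  also have "\<dots> \<le> 64 * (real (b - a))\<^sup>2"
    unfolding Q_def by (rule transform_fourth_moment[OF G_past G_le])
  finally show ?thesis using c by (simp add: pos_le_divide_eq mult.commute)
qed

end

section \<open>Characteristic functions of the martingale\<close>

lemma cmod_cis_minus_1_le: "cmod (cis y - 1) \<le> \<bar>y\<bar>"
  using iexp_approx1[of y 0] by (simp add: cis_conv_exp)

lemma cmod_cis_taylor2_le: "cmod (cis y - (1 + \<i> * of_real y - (of_real y)\<^sup>2 / 2)) \<le> \<bar>y\<bar> ^ 3 / 6"
proof -
  have "(\<Sum>k\<le>2. (\<i> * of_real y) ^ k / fact k) = 1 + \<i> * of_real y - (of_real y)\<^sup>2 / 2"
    by (simp add: numeral_2_eq_2 power_mult_distrib)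
  moreover have "(fact (Suc 2) :: real) = 6" by (simp add: numeral_2_eq_2)
  moreover have "\<bar>y\<bar> ^ Suc 2 = \<bar>y\<bar> ^ 3" by simp
  ultimately show ?thesis
    using iexp_approx1[of y 2] unfolding cis_conv_exp by (simp only:)
qed

text \<open>The two identities below expand the second order Taylor polynomial at \<open>y = Re z\<close>, with
  \<open>b = z\<close> and \<open>c = cnj z\<close>, and sort it by the factors that are independent of each other.\<close>

lemma taylor2_conjugates:
  fixes w b c j :: complex
  shows "w * (1 + j * ((b + c) / 2) - ((b + c) / 2)\<^sup>2 / 2) =
   w * (1 + j / 2 * b + j / 2 * c - (b\<^sup>2 + c\<^sup>2 + 2 * (b * c)) / 8)"
  by (simp add: power2_eq_square add_divide_distrib algebra_simps)

lemma taylor2_expand: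
  fixes w a a' u u' x x' m j :: complex
  shows
  "w * (1 + j / 2 * (a * (u * x)) + j / 2 * (a' * (u' * x')) - ((a * (u * x))\<^sup>2 + (a' * (u' * x'))\<^sup>2 + 2 * (m * (x
      * x'))) / 8) =
   w + j / 2 * a * (w * u * x) + j / 2 * a' * (w * u' * x') - a\<^sup>2 / 8 * (w * u\<^sup>2 * x\<^sup>2) - a'\<^sup>2 / 8 * (w
       * u'\<^sup>2 * x'\<^sup>2)
      - m / 4 * (w * 1 * (x * x'))"
  by (simp add: power2_eq_square add_divide_distrib diff_divide_distrib algebra_simps)

context unit_steps
begin

context
  fixes \<mu> :: "nat \<Rightarrow> complex"
begin

definition phase :: "nat \<Rightarrow> 'a \<Rightarrow> real" where
  "phase j \<omega> = Re (\<mu> j * (U j \<omega> * (V (Suc j) \<omega> - of_real r)))"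

definition wave :: "nat \<Rightarrow> 'a \<Rightarrow> complex" where
  "wave k \<omega> = cis (\<Sum>j<k. phase j \<omega>)"

text \<open>Half the conditional variance of \<open>phase j\<close> given the past, without the part that rotates
  with \<open>(U j)\<^sup>2\<close>.\<close>

definition var :: "nat \<Rightarrow> real" where
  "var j = (cmod (\<mu> j))\<^sup>2 * (1 - r\<^sup>2) / 4"

text \<open>The rotating parts of the conditional variance contribute through the correlations of
  \<open>wave k\<close> with \<open>(U k)\<^sup>2\<close> and with its conjugate; they are treated together by taking for \<open>h\<close> the
  identity or \<^const>\<open>cnj\<close>.\<close>

definition resonance :: "(complex \<Rightarrow> complex) \<Rightarrow> nat \<Rightarrow> real" where
  "resonance h k = cmod (expectation (\<lambda>\<omega>. wave k \<omega> * (h (U k \<omega>))\<^sup>2))"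

context
  fixes \<epsilon> :: real
  assumes mu_le: "\<And>j. cmod (\<mu> j) \<le> \<epsilon>" and eps_le: "\<epsilon> \<le> 1"
begin

lemma eps_nonneg: "0 \<le> \<epsilon>"
  using mu_le[of 0] norm_ge_zero order_trans by blast

lemma wave_Suc: "wave (Suc k) \<omega> = wave k \<omega> * cis (phase k \<omega>)"
  by (simp add: wave_def cis_mult)

lemma norm_wave [simp]: "cmod (wave k \<omega>) = 1"
  by (simp add: wave_def)

lemma phase_past: "j < k \<Longrightarrow> phase j \<in> borel_measurable (past k)"
proof -
  assume "j < k"
  then have "(\<lambda>\<omega>. \<mu> j * (U j \<omega> * (V (Suc j) \<omega> - of_real r))) \<in> borel_measurable (past k)"
    by (intro borel_measurable_times borel_measurable_diff borel_measurable_const U_past V_past) auto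
  then show ?thesis unfolding phase_def[abs_def] by (simp only: borel_measurable_complex_iff)
qed

lemma wave_past: "wave k \<in> borel_measurable (past k)"
proof -
  have "(\<lambda>\<omega>. \<Sum>j<k. phase j \<omega>) \<in> borel_measurable (past k)"
    by (intro borel_measurable_sum phase_past) auto
  then show ?thesis unfolding wave_def[abs_def]
    by (rule borel_measurable_continuous_on[rotated]) (intro continuous_intros)
qed

lemma measurable_phase [measurable]: "phase k \<in> borel_measurable M"
  using phase_past[of k "Suc k"] by (intro borel_measurable_past_imp) auto

lemma measurable_wave [measurable]: "wave k \<in> borel_measurable M"
  using wave_past by (rule borel_measurable_past_imp)

lemma abs_phase_le: "\<omega> \<in> space M \<Longrightarrow> \<bar>phase j \<omega>\<bar> \<le> 2 * \<epsilon>"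
proof -
  assume \<omega>: "\<omega> \<in> space M"
  have "\<bar>phase j \<omega>\<bar> \<le> cmod (\<mu> j) * (cmod (U j \<omega>) * cmod (V (Suc j) \<omega> - of_real r))"
    unfolding phase_def norm_mult[symmetric] by (rule abs_Re_le_cmod)
  also have "\<dots> \<le> \<epsilon> * (1 * 2)"
    using \<omega> eps_nonneg by (intro mult_mono mu_le norm_increment_le) auto
  finally show ?thesis by simp
qed

lemma resonance_nonneg [simp]: "0 \<le> resonance h k"
  by (simp add: resonance_def)

text \<open>A new turn multiplies \<open>(U k)\<^sup>2\<close> by an independent factor with mean \<open>s\<close>, so the
  correlation contracts by \<open>\<bar>s\<bar>\<close>. The change of the wave itself is bounded by the size \<open>2 * \<epsilon>\<close> of
  the new phase.\<close>

lemma resonance_Suc_le: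
  assumes h: "h = (\<lambda>z. z) \<or> h = cnj"
  shows "resonance h (Suc k) \<le> \<bar>s\<bar> * resonance h k + 2 * \<epsilon>"
proof -
  have h_mult: "h (z * w) = h z * h w" and h_norm: "cmod (h z) = cmod z" for z w
    using h by auto
  have h_cont: "continuous_on UNIV h" using h by (auto intro: continuous_intros)
  have h_m[measurable]: "h \<in> borel_measurable borel"
    using h_cont by (rule borel_measurable_continuous_onI)
  have h_V: "expectation (\<lambda>\<omega>. (h (V (Suc k) \<omega>))\<^sup>2) = of_real s"
    using h mean_V2[of k] by (auto simp: integral_cnj simp flip: complex_cnj_power)
  have W: "(\<lambda>\<omega>. wave k \<omega> * (h (U k \<omega>))\<^sup>2) \<in> borel_measurable (past k)"
  proof -
    have "(\<lambda>\<omega>. h (U k \<omega>)) \<in> borel_measurable (past k)"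
      using U_past[OF order_refl] h_m by (rule measurable_compose)
    then show ?thesis by (intro borel_measurable_times wave_past borel_measurable_power)
  qed
  let ?main = "\<lambda>\<omega>. wave k \<omega> * (h (U k \<omega>))\<^sup>2 * (h (V (Suc k) \<omega>))\<^sup>2"
  let ?err = "\<lambda>\<omega>. (wave (Suc k) \<omega> - wave k \<omega>) * (h (U (Suc k) \<omega>))\<^sup>2"
  have int: "integrable M ?main"
    by (rule integrable_bounded[where B=1]) (auto simp: norm_mult norm_power h_norm)
  have err_le: "cmod (?err \<omega>) \<le> 2 * \<epsilon>" if "\<omega> \<in> space M" for \<omega>
  proof -
    have diff: "wave (Suc k) \<omega> - wave k \<omega> = wave k \<omega> * (cis (phase k \<omega>) - 1)"
      by (simp add: wave_Suc algebra_simps)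
    have "cmod (?err \<omega>) = cmod (cis (phase k \<omega>) - 1)"
      unfolding diff using that by (simp add: norm_mult norm_power h_norm)
    also have "\<dots> \<le> \<bar>phase k \<omega>\<bar>" by (rule cmod_cis_minus_1_le)
    also have "\<dots> \<le> 2 * \<epsilon>" using that by (rule abs_phase_le)
    finally show ?thesis .
  qed
  have err_m: "?err \<in> borel_measurable M" by measurable
  then have int_err: "integrable M ?err" using err_le by (rule integrable_bounded)
  have "expectation (\<lambda>\<omega>. wave (Suc k) \<omega> * (h (U (Suc k) \<omega>))\<^sup>2) = expectation (\<lambda>\<omega>. ?main \<omega> + ?err \<omega>)"
    by (simp add: U_Suc h_mult power_mult_distrib algebra_simps)
  also have "\<dots> = expectation ?main + expectation ?err"
    using int int_err by (rule Bochner_Integration.integral_add)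
  also have "expectation ?main = expectation (\<lambda>\<omega>. wave k \<omega> * (h (U k \<omega>))\<^sup>2) * of_real s"
    using expectation_past_times_next[OF W, of 1 "\<lambda>z. (h z)\<^sup>2" 1] h_V
    by (simp add: norm_mult norm_power h_norm)
  finally have "resonance h (Suc k) \<le>
      cmod (expectation (\<lambda>\<omega>. wave k \<omega> * (h (U k \<omega>))\<^sup>2) * of_real s) + cmod (expectation ?err)"
    unfolding resonance_def by (simp only: norm_triangle_ineq)
  also have "cmod (expectation ?err) \<le> 2 * \<epsilon>"
    using err_m err_le by (rule norm_expectation_le)
  finally show ?thesis
    by (simp add: resonance_def norm_mult prob_space mult.commute)
qed

text \<open>Second order expansion of the factor \<open>cis (phase k)\<close>, where \<open>phase k = Re z\<close> for an
  increment \<open>z\<close>. Its first order term has mean zero. In second order the mixed term \<open>z * cnj z\<close>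
  gives \<open>var k\<close> and the squares \<open>z\<^sup>2\<close> and \<open>(cnj z)\<^sup>2\<close> give the resonances; the third order remainder
  is at most \<open>(2 * \<epsilon>) ^ 3 / 6\<close>.\<close>

lemma expectation_wave_step:
  "cmod (expectation (wave (Suc k)) - (1 - of_real (var k)) * expectation (wave k)) \<le>
    \<epsilon>\<^sup>2 / 4 * (resonance (\<lambda>z. z) k + resonance cnj k) + 2 * \<epsilon> ^ 3"
proof -
  define X where "X \<omega> = V (Suc k) \<omega> - of_real r" for \<omega>
  define a where "a = \<mu> k"
  let ?y = "phase k"
  let ?T = "\<lambda>\<omega>. wave k \<omega> * (1 + \<i> * of_real (?y \<omega>) - (of_real (?y \<omega>))\<^sup>2 / 2)"
  have X_m[measurable]: "X \<in> borel_measurable M" unfolding X_def by measurable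
  have X_le: "cmod (X \<omega>) \<le> 2" if "\<omega> \<in> space M" for \<omega>
    unfolding X_def using that by (rule norm_increment_le)
  have gen: "expectation (\<lambda>\<omega>. wave k \<omega> * f (U k \<omega>) * g (X \<omega>)) =
      expectation (\<lambda>\<omega>. wave k \<omega> * f (U k \<omega>)) * expectation (\<lambda>\<omega>. g (X \<omega>))"
    and gen_int: "integrable M (\<lambda>\<omega>. wave k \<omega> * f (U k \<omega>) * g (X \<omega>))"
    if f: "continuous_on UNIV f" "\<And>z. cmod z = 1 \<Longrightarrow> cmod (f z) \<le> 1"
      and g: "continuous_on UNIV g" "\<And>z. cmod z \<le> 2 \<Longrightarrow> cmod (g z) \<le> 4" for f g :: "complex \<Rightarrow> complex"
  proof -
    have fm: "f \<in> borel_measurable borel" and gm[measurable]: "g \<in> borel_measurable borel"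
      using f g by (auto intro: borel_measurable_continuous_onI)
    have "(\<lambda>\<omega>. f (U k \<omega>)) \<in> borel_measurable (past k)"
      using U_past[OF order_refl] fm by (rule measurable_compose)
    then have W: "(\<lambda>\<omega>. wave k \<omega> * f (U k \<omega>)) \<in> borel_measurable (past k)"
      by (intro borel_measurable_times wave_past)
    have Wb: "cmod (wave k \<omega> * f (U k \<omega>)) \<le> 1" if "\<omega> \<in> space M" for \<omega>
      using that f by (simp add: norm_mult)
    have "cmod (z - of_real r) \<le> 2" if "cmod z = 1" for z
      using norm_triangle_ineq4[of z "of_real r"] that abs_r by simp
    then show "expectation (\<lambda>\<omega>. wave k \<omega> * f (U k \<omega>) * g (X \<omega>)) =
        expectation (\<lambda>\<omega>. wave k \<omega> * f (U k \<omega>)) * expectation (\<lambda>\<omega>. g (X \<omega>))"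
      unfolding X_def using g
      by (intro expectation_past_times_next[OF W Wb, where g="\<lambda>z. g (z - of_real r)" and B'=4]) auto
    show "integrable M (\<lambda>\<omega>. wave k \<omega> * f (U k \<omega>) * g (X \<omega>))"
    proof (rule integrable_bounded[where B="1 * 4"])
      show "(\<lambda>\<omega>. wave k \<omega> * f (U k \<omega>) * g (X \<omega>)) \<in> borel_measurable M"
        by (intro borel_measurable_times borel_measurable_past_imp[OF W]) measurable
      show "cmod (wave k \<omega> * f (U k \<omega>) * g (X \<omega>)) \<le> 1 * 4" if "\<omega> \<in> space M" for \<omega>
        unfolding norm_mult[of _ "g (X \<omega>)"] using Wb[OF that] X_le[OF that] g(2)
        by (intro mult_mono) auto
    qed
  qed
  have EX: "expectation X = 0" "expectation (\<lambda>\<omega>. cnj (X \<omega>)) = 0"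
    using mean_increment[of k] unfolding X_def by (simp_all add: integral_cnj del: complex_cnj_diff)
  have EX2: "expectation (\<lambda>\<omega>. (X \<omega>)\<^sup>2) = of_real (s - r\<^sup>2)"
    unfolding X_def by (rule mean_increment_sq)
  have EX2': "expectation (\<lambda>\<omega>. (cnj (X \<omega>))\<^sup>2) = of_real (s - r\<^sup>2)"
    by (simp only: complex_cnj_power[symmetric] Bochner_Integration.integral_cnj EX2 complex_cnj_complex_of_real)
  have EXX: "expectation (\<lambda>\<omega>. X \<omega> * cnj (X \<omega>)) = of_real (1 - r\<^sup>2)"
    unfolding X_def by (rule mean_increment_abs_sq)
  have le4: "cmod (z\<^sup>2) \<le> 4" "cmod ((cnj z)\<^sup>2) \<le> 4" "cmod (z * cnj z) \<le> 4" if "cmod z \<le> 2" for z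
  proof -
    have "cmod z * cmod z \<le> 4" using mult_mono[of "cmod z" 2 "cmod z" 2] that by simp
    then show "cmod (z\<^sup>2) \<le> 4" "cmod ((cnj z)\<^sup>2) \<le> 4" "cmod (z * cnj z) \<le> 4"
      by (simp_all only: power2_eq_square norm_mult complex_mod_cnj)
  qed
  define t1 where "t1 \<omega> = wave k \<omega> * U k \<omega> * X \<omega>" for \<omega>
  define t2 where "t2 \<omega> = wave k \<omega> * cnj (U k \<omega>) * cnj (X \<omega>)" for \<omega>
  define t3 where "t3 \<omega> = wave k \<omega> * (U k \<omega>)\<^sup>2 * (X \<omega>)\<^sup>2" for \<omega>
  define t4 where "t4 \<omega> = wave k \<omega> * (cnj (U k \<omega>))\<^sup>2 * (cnj (X \<omega>))\<^sup>2" for \<omega>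
  define t5 where "t5 \<omega> = wave k \<omega> * 1 * (X \<omega> * cnj (X \<omega>))" for \<omega>
  have ints: "integrable M t1" "integrable M t2" "integrable M t3" "integrable M t4" "integrable M t5"
    unfolding t1_def[abs_def] t2_def[abs_def] t3_def[abs_def] t4_def[abs_def] t5_def[abs_def]
    subgoal by (rule gen_int[of "\<lambda>z. z" "\<lambda>z. z"]) (auto intro!: continuous_intros)
    subgoal by (rule gen_int[of cnj cnj]) (auto intro!: continuous_intros)
    subgoal by (rule gen_int[of "\<lambda>z. z\<^sup>2"
        "\<lambda>z. z\<^sup>2"]) (intro continuous_intros, simp add: norm_power, intro continuous_intros, rule le4(1))
    subgoal by (rule gen_int[of "\<lambda>z. (cnj z)\<^sup>2"
        "\<lambda>z. (cnj z)\<^sup>2"]) (intro continuous_intros, simp add: norm_power, intro continuous_intros, rule le4(2))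
    subgoal by (rule gen_int[of "\<lambda>_. 1" "\<lambda>z. z
        * cnj z"]) (intro continuous_intros, simp, intro continuous_intros, rule le4(3))
    done
  have E1: "expectation t1 = 0"
    unfolding t1_def[abs_def]
    by (subst gen[of "\<lambda>z. z" "\<lambda>z. z"]) (auto simp: EX intro!: continuous_intros)
  have E2: "expectation t2 = 0"
    unfolding t2_def[abs_def]
    by (subst gen[of cnj cnj]) (auto simp: EX intro!: continuous_intros)
  have E3: "expectation t3 = expectation (\<lambda>\<omega>. wave k \<omega> * (U k \<omega>)\<^sup>2) * of_real (s - r\<^sup>2)"
    unfolding t3_def[abs_def] EX2[symmetric]
    by (rule gen[of "\<lambda>z. z\<^sup>2" "\<lambda>z. z\<^sup>2"]) (intro continuous_intros, simp add: norm_power, intro continuous_intros,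
        rule le4(1))
  have E4: "expectation t4 = expectation (\<lambda>\<omega>. wave k \<omega> * (cnj (U k \<omega>))\<^sup>2) * of_real (s - r\<^sup>2)"
    unfolding t4_def[abs_def] EX2'[symmetric]
    by (rule gen[of "\<lambda>z. (cnj z)\<^sup>2" "\<lambda>z. (cnj z)\<^sup>2"]) (intro continuous_intros, simp add: norm_power, intro
        continuous_intros, rule le4(2))
  have E5: "expectation t5 = expectation (\<lambda>\<omega>. wave k \<omega> * 1) * of_real (1 - r\<^sup>2)"
    unfolding t5_def[abs_def] EXX[symmetric]
    by (rule gen[of "\<lambda>_. 1" "\<lambda>z. z * cnj z"]) (intro continuous_intros, simp, intro continuous_intros, rule le4(3))
  have wave_int: "integrable M (wave k)" "integrable M (wave (Suc k))"
    by (auto intro!: integrable_bounded[where B=1])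
  have T_eq: "?T \<omega> = wave k \<omega> + \<i> / 2 * a * t1 \<omega> + \<i> / 2 * cnj a * t2 \<omega> - a\<^sup>2 / 8 * t3 \<omega> - (cnj a)\<^sup>2 / 8 * t4 \<omega>
      - of_real ((cmod a)\<^sup>2) / 4 * t5 \<omega>" if "\<omega> \<in> space M" for \<omega>
  proof -
    define b where "b = a * (U k \<omega> * X \<omega>)"
    have UU: "U k \<omega> * cnj (U k \<omega>) = 1"
      using that by (simp add: complex_norm_square[symmetric])
    have y: "of_real (?y \<omega>) = (b + cnj b) / 2"
    proof -
      have "?y \<omega> = Re b" by (simp only: phase_def b_def X_def a_def)
      then show ?thesis by (simp only: complex_add_cnj) simp
    qed
    have bb: "b * cnj b = of_real ((cmod a)\<^sup>2) * (X \<omega> * cnj (X \<omega>))"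
    proof -
      have "b * cnj b = (a * cnj a) * (U k \<omega> * cnj (U k \<omega>)) * (X \<omega> * cnj (X \<omega>))"
        by (simp add: b_def mult_ac)
      then show ?thesis by (simp only: UU complex_norm_square mult_1_right)
    qed
    have "?T \<omega> = wave k \<omega> * (1 + \<i> / 2 * b + \<i> / 2 * cnj b - (b\<^sup>2 + (cnj b)\<^sup>2 + 2 * (b * cnj b)) / 8)"
      unfolding y by (rule taylor2_conjugates)
    also have "\<dots> = wave k \<omega> + \<i> / 2 * a * t1 \<omega> + \<i> / 2 * cnj a * t2 \<omega> - a\<^sup>2 / 8 * t3 \<omega> - (cnj a)\<^sup>2 / 8 * t4 \<omega>
      - of_real ((cmod a)\<^sup>2) / 4 * t5 \<omega>"
      unfolding bb t1_def t2_def t3_def t4_def t5_def unfolding b_def complex_cnj_mult by (rule taylor2_expand)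
    finally show ?thesis .
  qed
  have T_int: "integrable M ?T"
    by (subst Bochner_Integration.integrable_cong[OF refl T_eq])
       (auto intro!: Bochner_Integration.integrable_add Bochner_Integration.integrable_diff integrable_mult_right
           ints wave_int)
  have "expectation ?T = expectation (wave k) - a\<^sup>2 / 8 * expectation t3 - (cnj a)\<^sup>2 / 8 * expectation t4
      - of_real ((cmod a)\<^sup>2) / 4 * expectation t5"
    by (subst Bochner_Integration.integral_cong[OF refl T_eq]) (simp_all add: ints wave_int E1 E2)
  then have ET: "expectation ?T - (1 - of_real (var k)) * expectation (wave k) =
      - (a\<^sup>2 / 8 * expectation t3 + (cnj a)\<^sup>2 / 8 * expectation t4)"
  proof -
    have v: "of_real (var k) = of_real ((cmod a)\<^sup>2) / 4 * (of_real (1 - r\<^sup>2) :: complex)"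
      by (simp add: var_def a_def)
    have alg: "eT - (1 - m * q) * e0 = - (x + y)" if "eT = e0 - x - y - m * (e0 * q)"
      for eT e0 x y m q :: complex
      using that by (simp add: algebra_simps)
    assume "expectation ?T = expectation (wave k) - a\<^sup>2 / 8 * expectation t3 - (cnj a)\<^sup>2 / 8 * expectation t4
      - of_real ((cmod a)\<^sup>2) / 4 * expectation t5"
    from alg[OF this[unfolded E5 mult_1_right]] show ?thesis unfolding v .
  qed
  have sr: "\<bar>s - r\<^sup>2\<bar> \<le> 2"
  proof -
    have "r\<^sup>2 \<le> 1" using abs_r by (simp add: abs_square_le_1)
    then show ?thesis using abs_s zero_le_power2[of r] by linarith
  qed
  have a2: "(cmod a)\<^sup>2 \<le> \<epsilon>\<^sup>2" unfolding a_def using mu_le by (intro power_mono) auto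
  have part: "cmod (z\<^sup>2 / 8 * (e * of_real (s - r\<^sup>2))) \<le> \<epsilon>\<^sup>2 / 4 * cmod e" if "cmod z = cmod a" for z e
  proof -
    have "cmod (z\<^sup>2 / 8 * (e * of_real (s - r\<^sup>2))) = ((cmod a)\<^sup>2 * \<bar>s - r\<^sup>2\<bar>) * (cmod e / 8)"
      using that by (simp add: norm_mult norm_divide norm_power del: of_real_diff)
    also have "\<dots> \<le> (\<epsilon>\<^sup>2 * 2) * (cmod e / 8)"
      using a2 sr by (intro mult_right_mono mult_mono) auto
    also have "\<dots> = \<epsilon>\<^sup>2 / 4 * cmod e" by simp
    finally show ?thesis .
  qed
  have "cmod (expectation ?T - (1 - of_real (var k)) * expectation (wave k)) \<le>
      cmod (a\<^sup>2 / 8 * expectation t3) + cmod ((cnj a)\<^sup>2 / 8 * expectation t4)"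
    unfolding ET norm_minus_cancel by (rule norm_triangle_ineq)
  also have "\<dots> \<le> \<epsilon>\<^sup>2 / 4 * resonance (\<lambda>z. z) k + \<epsilon>\<^sup>2 / 4 * resonance cnj k"
    unfolding E3 E4 resonance_def by (intro add_mono part) simp_all
  finally have main: "cmod (expectation ?T - (1 - of_real (var k)) * expectation (wave k)) \<le>
      \<epsilon>\<^sup>2 / 4 * (resonance (\<lambda>z. z) k + resonance cnj k)"
    by (simp add: distrib_left)
  have "cmod (expectation (wave (Suc k)) - expectation ?T) = cmod (expectation (\<lambda>\<omega>. wave (Suc k) \<omega> - ?T \<omega>))"
    using wave_int T_int by simp
  also have "\<dots> \<le> 2 * \<epsilon> ^ 3"
  proof (rule norm_expectation_le)
    show "(\<lambda>\<omega>. wave (Suc k) \<omega> - ?T \<omega>) \<in> borel_measurable M" by measurable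
    fix \<omega> assume \<omega>: "\<omega> \<in> space M"
    have "wave (Suc k) \<omega> - ?T \<omega> = wave k \<omega> * (cis (?y \<omega>) - (1 + \<i> * of_real (?y \<omega>) - (of_real (?y \<omega>))\<^sup>2 / 2))"
      by (simp add: wave_Suc algebra_simps)
    then have "cmod (wave (Suc k) \<omega> - ?T \<omega>) = cmod (cis (?y \<omega>) - (1 + \<i> * of_real (?y \<omega>) - (of_real (?y \<omega>))\<^sup>2 / 2))"
      by (simp only: norm_mult norm_wave mult_1_left)
    also have "\<dots> \<le> \<bar>?y \<omega>\<bar> ^ 3 / 6" by (rule cmod_cis_taylor2_le)
    also have "\<dots> \<le> (2 * \<epsilon>) ^ 3 / 6"
      using abs_phase_le[OF \<omega>, of k] by (intro divide_right_mono power_mono) auto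
    also have "\<dots> \<le> 2 * \<epsilon> ^ 3" using eps_nonneg by (simp add: power_mult_distrib)
    finally show "cmod (wave (Suc k) \<omega> - ?T \<omega>) \<le> 2 * \<epsilon> ^ 3" .
  qed
  finally have err: "cmod (expectation (wave (Suc k)) - expectation ?T) \<le> 2 * \<epsilon> ^ 3" .
  have "expectation (wave (Suc k)) - (1 - of_real (var k)) * expectation (wave k) =
      (expectation (wave (Suc k)) - expectation ?T) + (expectation ?T - (1 - of_real (var k))
          * expectation (wave k))"
    by (rule add_diff_eq[THEN trans, symmetric]) (simp only: diff_add_cancel)
  then have "cmod (expectation (wave (Suc k)) - (1 - of_real (var k)) * expectation (wave k)) \<le>
      cmod (expectation (wave (Suc k)) - expectation ?T) + cmod (expectation ?T - (1 - of_real (var k))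
          * expectation (wave k))"
    by (simp only: norm_triangle_ineq)
  also have "\<dots> \<le> 2 * \<epsilon> ^ 3 + \<epsilon>\<^sup>2 / 4 * (resonance (\<lambda>z. z) k + resonance cnj k)"
    using err main by (rule add_mono)
  finally show ?thesis by (simp only: add.commute)
qed

lemma var_bounds: "0 \<le> var j" "var j \<le> \<epsilon>\<^sup>2"
proof -
  have r2: "0 \<le> 1 - r\<^sup>2" "1 - r\<^sup>2 \<le> 1" using abs_r by (simp_all add: abs_square_le_1)
  then show "0 \<le> var j" by (simp add: var_def)
  have "(cmod (\<mu> j))\<^sup>2 * (1 - r\<^sup>2) \<le> \<epsilon>\<^sup>2 * 1"
    using r2 mu_le by (intro mult_mono power_mono) auto
  then show "var j \<le> \<epsilon>\<^sup>2" using zero_le_power2[of \<epsilon>] unfolding var_def by linarith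
qed

lemma exp_minus_var_le: "\<bar>exp (- var j) - (1 - var j)\<bar> \<le> \<epsilon> ^ 3"
proof -
  have v: "0 \<le> var j" "var j \<le> \<epsilon>\<^sup>2" by (rule var_bounds)+
  have lower: "1 - var j \<le> exp (- var j)" using exp_ge_add_one_self[of "- var j"] by simp
  have "exp (- var j) * (1 + var j) \<le> exp (- var j) * exp (var j)"
    using exp_ge_add_one_self[of "var j"] by (intro mult_left_mono) auto
  also have "\<dots> = 1" by (simp flip: exp_add)
  finally have "exp (- var j) \<le> 1 / (1 + var j)" using v by (simp add: pos_le_divide_eq)
  also have "\<dots> \<le> 1 - var j + (var j)\<^sup>2"
  proof -
    have "1 \<le> (1 - var j + (var j)\<^sup>2) * (1 + var j)"
      using v by (simp add: power2_eq_square algebra_simps)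
    then show ?thesis using v by (simp add: pos_divide_le_eq)
  qed
  finally have "\<bar>exp (- var j) - (1 - var j)\<bar> \<le> (var j)\<^sup>2" using lower by linarith
  also have "\<dots> \<le> (\<epsilon>\<^sup>2)\<^sup>2" using v by (intro power_mono)
  also have "\<dots> = \<epsilon> ^ 4" by simp
  also have "\<dots> \<le> \<epsilon> ^ 3" using eps_nonneg eps_le by (intro power_decreasing) auto
  finally show ?thesis .
qed

lemma norm_expectation_wave_le: "cmod (expectation (wave k)) \<le> 1"
  by (rule norm_expectation_le) auto

lemma resonance_le_1:
  assumes h: "h = (\<lambda>z. z) \<or> h = cnj" shows "resonance h 0 \<le> 1"
  unfolding resonance_def
proof (rule norm_expectation_le)
  have "continuous_on UNIV h" using h by (auto intro: continuous_intros)
  then have [measurable]: "h \<in> borel_measurable borel"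
    by (rule borel_measurable_continuous_onI)
  show "(\<lambda>\<omega>. wave 0 \<omega> * (h (U 0 \<omega>))\<^sup>2) \<in> borel_measurable M" by measurable
qed (use h in \<open>auto simp: norm_mult norm_power\<close>)

text \<open>Let \<open>e k\<close> be the error on the left and \<open>\<rho> k\<close> the sum of the two resonances. By the
  preceding lemmas \<open>e\<close> grows in one step by at most \<open>\<epsilon>\<^sup>2 / 4 * \<rho> k + O(\<epsilon> ^ 3)\<close>, while \<open>\<rho>\<close> is
  multiplied by \<open>\<bar>s\<bar> < 1\<close> up to \<open>O(\<epsilon>)\<close>. Hence \<open>e k + A * \<rho> k\<close> grows by only \<open>O(\<epsilon> ^ 3)\<close> per step if
  \<open>A\<close> is chosen such that \<open>\<epsilon>\<^sup>2 / 4 + A * \<bar>s\<bar> = A\<close>; its initial value is \<open>O(\<epsilon>\<^sup>2)\<close>.\<close>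

lemma char_error_le:
  "cmod (expectation (wave k) - of_real (exp (- (\<Sum>j<k. var j)))) \<le>
    (\<epsilon>\<^sup>2 + real k * \<epsilon> ^ 3) * (3 + 1 / (1 - \<bar>s\<bar>))"
proof -
  define A where "A = \<epsilon>\<^sup>2 / 4 / (1 - \<bar>s\<bar>)"
  have s1: "0 < 1 - \<bar>s\<bar>" using abs_s by simp
  have A: "0 \<le> A" using s1 by (simp add: A_def)
  have A_eq: "\<epsilon>\<^sup>2 / 4 + A * \<bar>s\<bar> = A" using s1 by (simp add: A_def field_simps)
  define e where "e k = cmod (expectation (wave k) - of_real (exp (- (\<Sum>j<k. var j))))" for k
  define \<rho> where "\<rho> k = resonance (\<lambda>z. z) k + resonance cnj k" for k
  have e_Suc: "e (Suc k) \<le> e k + \<epsilon>\<^sup>2 / 4 * \<rho> k + 3 * \<epsilon> ^ 3" for k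
  proof -
    let ?E = "expectation (wave k)" and ?p = "exp (- (\<Sum>j<k. var j))" and ?q = "exp (- var k)"
    have "expectation (wave (Suc k)) - of_real (exp (- (\<Sum>j<Suc k. var j))) =
        (expectation (wave (Suc k)) - (1 - of_real (var k)) * ?E)
        + (of_real (1 - var k - ?q) * ?E + of_real ?q * (?E - of_real ?p))"
      by (simp add: algebra_simps exp_diff exp_minus divide_inverse)
    then have "e (Suc k) \<le> cmod (expectation (wave (Suc k)) - (1 - of_real (var k)) * ?E)
        + (cmod (of_real (1 - var k - ?q) * ?E) + cmod (of_real ?q * (?E - of_real ?p)))"
      unfolding e_def by (simp only: order_trans[OF norm_triangle_ineq add_left_mono[OF norm_triangle_ineq]])
    moreover have "cmod (of_real (1 - var k - ?q) * ?E) \<le> \<epsilon> ^ 3 * 1"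
      unfolding norm_mult norm_of_real
      using exp_minus_var_le[of k] eps_nonneg
          by (intro mult_mono norm_expectation_wave_le) (auto simp: abs_minus_commute)
    moreover have "cmod (of_real ?q * (?E - of_real ?p)) \<le> 1 * e k"
      unfolding norm_mult norm_of_real e_def using var_bounds[of k] by (intro mult_right_mono) auto
    ultimately show ?thesis using expectation_wave_step[of k] unfolding \<rho>_def by linarith
  qed
  have \<rho>_Suc: "\<rho> (Suc k) \<le> \<bar>s\<bar> * \<rho> k + 4 * \<epsilon>" for k
    using resonance_Suc_le[OF disjI1[OF refl], of k] resonance_Suc_le[OF disjI2[OF refl], of k]
        unfolding \<rho>_def distrib_left by linarith
  have potential: "e k + A * \<rho> k \<le> 2 * A + real k * (3 * \<epsilon> ^ 3 + 4 * \<epsilon> * A)" for k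
  proof (induction k)
    case 0
    have "\<rho> 0 \<le> 2" using resonance_le_1[OF disjI1[OF refl]] resonance_le_1[OF disjI2[OF refl]]
        unfolding \<rho>_def by linarith
    then have "A * \<rho> 0 \<le> A * 2" using A by (rule mult_left_mono)
    moreover have "wave 0 = (\<lambda>_. 1)" by (simp add: wave_def fun_eq_iff)
    ultimately show ?case by (simp add: e_def prob_space)
  next
    case (Suc k)
    have "A * \<rho> (Suc k) \<le> A * (\<bar>s\<bar> * \<rho> k + 4 * \<epsilon>)" using \<rho>_Suc A by (rule mult_left_mono)
    also have "\<dots> = A * \<bar>s\<bar> * \<rho> k + 4 * \<epsilon> * A" by (simp add: algebra_simps)
    finally have "e (Suc k) + A * \<rho> (Suc k) \<le> e k + (\<epsilon>\<^sup>2 / 4 + A * \<bar>s\<bar>) * \<rho> k + 3 * \<epsilon> ^ 3 + 4 * \<epsilon> * A"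
      using e_Suc[of k] by (simp add: distrib_right)
    then have "e (Suc k) + A * \<rho> (Suc k) \<le> e k + A * \<rho> k + 3 * \<epsilon> ^ 3 + 4 * \<epsilon> * A" unfolding A_eq .
    then show ?case using Suc by (simp add: algebra_simps)
  qed
  have "0 \<le> \<rho> k" unfolding \<rho>_def using resonance_nonneg by (intro add_nonneg_nonneg)
  then have "0 \<le> A * \<rho> k" using A by simp
  then have "e k \<le> 2 * A + real k * (3 * \<epsilon> ^ 3 + 4 * \<epsilon> * A)" using potential[of k] by linarith
  also have "4 * \<epsilon> * A = \<epsilon> ^ 3 * (1 / (1 - \<bar>s\<bar>))"
    using s1 by (simp add: A_def power3_eq_cube power2_eq_square field_simps)
  also have "2 * A \<le> \<epsilon>\<^sup>2 * (3 + 1 / (1 - \<bar>s\<bar>))"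
  proof -
    have "2 * A \<le> 4 * A" using A by simp
    also have "\<dots> = \<epsilon>\<^sup>2 * (1 / (1 - \<bar>s\<bar>))" using s1 by (simp add: A_def field_simps)
    also have "\<dots> \<le> \<epsilon>\<^sup>2 * (3 + 1 / (1 - \<bar>s\<bar>))" by (intro mult_left_mono) auto
    finally show ?thesis .
  qed
  finally show ?thesis by (simp add: e_def algebra_simps)
qed

end

end

end

section \<open>Increments of the rescaled martingale over blocks of times\<close>

lemma sum_blocks:
  fixes f :: "nat \<Rightarrow> 'b::comm_monoid_add"
  assumes "mono a" "a 0 = 0"
  shows "(\<Sum>j<a m. f j) = (\<Sum>l<m. \<Sum>j\<in>{a l..<a (Suc l)}. f j)"
proof (induction m)
  case 0
  then show ?case using assms by simp
next
  case (Suc m)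
  have "{..<a (Suc m)} = {..<a m} \<union> {a m..<a (Suc m)}"
    using monoD[OF assms(1), of m "Suc m"] by auto
  then have "(\<Sum>j<a (Suc m). f j) = (\<Sum>j<a m. f j) + (\<Sum>j\<in>{a m..<a (Suc m)}. f j)"
    by (simp add: sum.union_disjoint ivl_disj_int)
  then show ?case using Suc by simp
qed

lemma real_div_minus_div_le_1: "real k / real m - real (k div m) \<le> 1"
proof -
  have "real_of_int \<lfloor>real k / real m\<rfloor> = real (k div m)"
    by (simp only: floor_divide_of_nat_eq of_int_of_nat_eq)
  then show ?thesis by linarith
qed

lemma floor_ratio_tendsto:
  assumes "0 < m" shows "(\<lambda>n. real ((n * l) div m) / real n) \<longlonglongrightarrow> real l / real m"
proof (rule tendsto_sandwich)
  show "eventually (\<lambda>n. real l / real m - 1 / real n \<le> real ((n * l) div m) / real n) sequentially"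
    using eventually_gt_at_top[of 0]
  proof eventually_elim
    case (elim n)
    have "real (n * l) / real m - real ((n * l) div m) \<le> 1"
      by (rule real_div_minus_div_le_1)
    then have "(real (n * l) / real m - 1) / real n \<le> real ((n * l) div m) / real n"
      by (intro divide_right_mono) auto
    also have "(real (n * l) / real m - 1) / real n = real l / real m - 1 / real n"
      using elim by (simp add: diff_divide_distrib)
    finally show ?case .
  qed
  show "eventually (\<lambda>n. real ((n * l) div m) / real n \<le> real l / real m) sequentially"
    using eventually_gt_at_top[of 0]
  proof eventually_elim
    case (elim n)
    have "real ((n * l) div m) / real n \<le> (real (n * l) / real m) / real n"
      by (intro divide_right_mono of_nat_div_le_of_nat) auto
    then show ?case using elim by simp
  qed
  show "(\<lambda>n. real l / real m - 1 / real n) \<longlonglongrightarrow> real l / real m"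
    using tendsto_diff[OF tendsto_const lim_inverse_n', of "real l / real m"] by simp
qed simp

lemma one_over_sqrt_tendsto: "(\<lambda>n. 1 / sqrt (real n)) \<longlonglongrightarrow> 0"
  using tendsto_real_sqrt[OF lim_inverse_n'] by (simp add: real_sqrt_divide)

lemma mono_block_ends: "mono (\<lambda>l. (n * l) div m :: nat)"
  by (intro monoI div_le_mono mult_le_mono2)

context unit_steps
begin

definition scaled_mart :: "nat \<Rightarrow> nat \<Rightarrow> 'a \<Rightarrow> complex" where
  "scaled_mart n k \<omega> = mart k \<omega> * of_real (1 / ((1 - r) * sqrt (real n)))"

lemma measurable_scaled_mart [measurable]: "scaled_mart n k \<in> borel_measurable M"
  unfolding scaled_mart_def by measurable

lemma one_minus_r_pos: "0 < 1 - r"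
  using abs_r by simp

lemma mart_diff: "a \<le> b \<Longrightarrow> mart b \<omega> - mart a \<omega> = (\<Sum>j\<in>{a..<b}. U j \<omega> * (V (Suc j) \<omega> - of_real r))"
  unfolding mart_def by (simp add: sum_diff_nat_ivl lessThan_atLeast0)

text \<open>A linear combination of the block increments is \<open>\<Sum>j<n. Re (\<mu> n j * d j)\<close>, where \<open>d j\<close> are
  the increments of \<open>mart\<close> and the coefficients \<open>\<mu> n\<close> are constant on each block and of order
  \<open>1 / sqrt n\<close>. So the error in \<open>char_error_le\<close> tends to 0, and the exponent there is a sum over
  blocks weighted by their relative lengths, which tend to \<open>1 / m\<close>.\<close>

lemma char_block_increments_tendsto:
  assumes m: "0 < m"
  shows "(\<lambda>n. expectation (\<lambda>\<omega>. cis (\<Sum>l<m. Re (\<eta> l * (scaled_mart n ((n * Suc l) div m) \<omega> - scaled_mart n ((n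
      * l) div m) \<omega>)))))
    \<longlonglongrightarrow> of_real (exp (- ((1 + r) / (4 * (1 - r)) * (\<Sum>l<m. (cmod (\<eta> l))\<^sup>2) / real m)))"
proof -
  define a where "a n l = (n * l) div m" for n l
  have a_mono: "mono (a n)" for n unfolding a_def by (rule mono_block_ends)
  have a0: "a n 0 = 0" and am: "a n m = n" for n using m by (auto simp: a_def)
  have a_le: "a n l \<le> a n (Suc l)" for n l using monoD[OF a_mono] by simp
  define c where "c n = 1 / ((1 - r) * sqrt (real n))" for n
  have c: "0 \<le> c n" for n using one_minus_r_pos by (simp add: c_def)
  define \<mu> where "\<mu> n j = (\<Sum>l<m. if a n l \<le> j \<and> j < a n (Suc l) then \<eta> l * of_real (c n) else 0)" for n j
  have \<mu>_block: "\<mu> n j = \<eta> l * of_real (c n)" if l: "l < m" and j: "j \<in> {a n l..<a n (Suc l)}" for n j l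
  proof -
    have "l' = l" if "a n l' \<le> j" "j < a n (Suc l')" for l'
    proof (rule ccontr)
      assume "l' \<noteq> l"
      then consider "Suc l' \<le> l" | "Suc l \<le> l'" by linarith
      then show False using monoD[OF a_mono, of "Suc l'" l n] monoD[OF a_mono, of "Suc l" l' n] that j
        by cases auto
    qed
    then have "\<mu> n j = (\<Sum>l'<m. if l' = l then \<eta> l * of_real (c n) else 0)"
      unfolding \<mu>_def using j by (intro sum.cong refl) auto
    then show ?thesis using l by simp
  qed
  define \<Lambda> where "\<Lambda> = (\<Sum>l<m. cmod (\<eta> l))"
  define \<epsilon> where "\<epsilon> n = \<Lambda> * c n" for n
  have \<mu>_le: "cmod (\<mu> n j) \<le> \<epsilon> n" for n j
  proof -
    have "cmod (\<mu> n j) \<le> (\<Sum>l<m. cmod (\<eta> l) * c n)"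
      unfolding \<mu>_def using c by (intro sum_norm_le) (auto simp: norm_mult)
    then show ?thesis by (simp add: \<epsilon>_def \<Lambda>_def sum_distrib_right)
  qed
  define K where "K = \<Lambda> / (1 - r)"
  have \<epsilon>_eq: "\<epsilon> n = K * (1 / sqrt (real n))" for n by (simp add: \<epsilon>_def c_def K_def)
  have \<epsilon>_lim: "\<epsilon> \<longlonglongrightarrow> 0"
    unfolding \<epsilon>_eq using tendsto_mult[OF tendsto_const one_over_sqrt_tendsto, of K] by simp
  have n\<epsilon>: "real n * \<epsilon> n ^ 3 = K ^ 3 * (1 / sqrt (real n))" for n
  proof (cases "n = 0")
    case False
    have "real n = sqrt (real n) * sqrt (real n)" by simp
    then have "real n * (1 / sqrt (real n)) ^ 3 = 1 / sqrt (real n)"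
      using False by (simp add: power3_eq_cube field_simps)
    then have "K ^ 3 * (real n * (1 / sqrt (real n)) ^ 3) = K ^ 3 * (1 / sqrt (real n))" by (simp only:)
    then show ?thesis by (simp only: \<epsilon>_eq power_mult_distrib mult_ac)
  qed simp
  have err_lim: "(\<lambda>n. ((\<epsilon> n)\<^sup>2 + real n * \<epsilon> n ^ 3) * (3 + 1 / (1 - \<bar>s\<bar>))) \<longlonglongrightarrow> 0"
  proof -
    have "(\<lambda>n. ((\<epsilon> n)\<^sup>2 + K ^ 3 * (1 / sqrt (real n))) * (3 + 1 / (1 - \<bar>s\<bar>)))
        \<longlonglongrightarrow> (0\<^sup>2 + K ^ 3 * 0) * (3 + 1 / (1 - \<bar>s\<bar>))"
      by (intro tendsto_intros \<epsilon>_lim one_over_sqrt_tendsto)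
    then show ?thesis unfolding n\<epsilon> by simp
  qed
  have wave_eq: "wave (\<mu> n) n \<omega> = cis (\<Sum>l<m. Re (\<eta> l * (scaled_mart n (a n (Suc l)) \<omega>
      - scaled_mart n (a n l) \<omega>)))" for n \<omega>
  proof -
    let ?d = "\<lambda>j. U j \<omega> * (V (Suc j) \<omega> - of_real r)"
    have "(\<Sum>j<n. Re (\<mu> n j * ?d j)) = (\<Sum>l<m. \<Sum>j\<in>{a n l..<a n (Suc l)}. Re (\<mu> n j * ?d j))"
      using sum_blocks[OF a_mono a0, of "\<lambda>j. Re (\<mu> n j * ?d j)" n m] by (simp only: am)
    also have "\<dots> = (\<Sum>l<m. \<Sum>j\<in>{a n l..<a n (Suc l)}. Re (\<eta> l * of_real (c n) * ?d j))"
    proof (intro sum.cong refl)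
      fix l j assume "l \<in> {..<m}" "j \<in> {a n l..<a n (Suc l)}"
      then show "Re (\<mu> n j * ?d j) = Re (\<eta> l * of_real (c n) * ?d j)" using \<mu>_block[of l j n]
          by (simp only: lessThan_iff)
    qed
    also have "\<dots> = (\<Sum>l<m. Re (\<eta> l * (scaled_mart n (a n (Suc l)) \<omega> - scaled_mart n (a n l) \<omega>)))"
    proof (intro sum.cong refl)
      fix l
      have "scaled_mart n (a n (Suc l)) \<omega> - scaled_mart n (a n l) \<omega>
          = (\<Sum>j\<in>{a n l..<a n (Suc l)}. ?d j) * of_real (c n)"
        unfolding scaled_mart_def c_def[symmetric] left_diff_distrib[symmetric] mart_diff[OF a_le] ..
      then have "\<eta> l * (scaled_mart n (a n (Suc l)) \<omega> - scaled_mart n (a n l) \<omega>) =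
          (\<Sum>j\<in>{a n l..<a n (Suc l)}. \<eta> l * of_real (c n) * ?d j)"
        by (simp only: sum_distrib_left sum_distrib_right mult_ac)
      then show "(\<Sum>j\<in>{a n l..<a n (Suc l)}. Re (\<eta> l * of_real (c n) * ?d j)) =
          Re (\<eta> l * (scaled_mart n (a n (Suc l)) \<omega> - scaled_mart n (a n l) \<omega>))"
        by (simp only: Re_sum)
    qed
    finally show ?thesis by (simp only: wave_def phase_def)
  qed
  define W where "W n = (\<Sum>j<n. var (\<mu> n) j)" for n
  have W_eq: "W n = (1 + r) / (4 * (1 - r)) * (\<Sum>l<m. (cmod (\<eta> l))\<^sup>2 * (real (a n (Suc l)) / real n
      - real (a n l) / real n))" for n
  proof -
    have "W n = (\<Sum>l<m. \<Sum>j\<in>{a n l..<a n (Suc l)}. var (\<mu> n) j)"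
      unfolding W_def using sum_blocks[OF a_mono a0, of "\<lambda>j. var (\<mu> n) j" n m] by (simp only: am)
    also have "\<dots> = (\<Sum>l<m. \<Sum>j\<in>{a n l..<a n (Suc l)}. (cmod (\<eta> l) * c n)\<^sup>2 * (1 - r\<^sup>2) / 4)"
    proof (intro sum.cong refl)
      fix l j assume "l \<in> {..<m}" "j \<in> {a n l..<a n (Suc l)}"
      then show "var (\<mu> n) j = (cmod (\<eta> l) * c n)\<^sup>2 * (1 - r\<^sup>2) / 4"
        using \<mu>_block[of l j n] c[of n] by (simp add: var_def norm_mult)
    qed
    also have "\<dots> = (\<Sum>l<m. (1 + r) / (4 * (1 - r)) * ((cmod (\<eta> l))\<^sup>2 * (real (a n (Suc l)) / real n
        - real (a n l) / real n)))"
    proof (intro sum.cong refl)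
      fix l
      have q: "(c n)\<^sup>2 * (1 - r\<^sup>2) / 4 = (1 + r) / (4 * (1 - r)) / real n"
      proof (cases "n = 0")
        case True
        then show ?thesis by (simp add: c_def)
      next
        case False
        have "1 - r\<^sup>2 = (1 - r) * (1 + r)" by (simp add: power2_eq_square algebra_simps)
        then show ?thesis using False one_minus_r_pos
          by (simp add: c_def power_divide power_mult_distrib) (simp add: power2_eq_square)
      qed
      have "(cmod (\<eta> l) * c n)\<^sup>2 * (1 - r\<^sup>2) / 4 = (cmod (\<eta> l))\<^sup>2 * ((c n)\<^sup>2 * (1 - r\<^sup>2) / 4)"
        by (simp add: power_mult_distrib)
      then have term_eq: "(cmod (\<eta> l) * c n)\<^sup>2 * (1 - r\<^sup>2) / 4
          = (cmod (\<eta> l))\<^sup>2 * ((1 + r) / (4 * (1 - r)) / real n)"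
        by (simp only: q)
      have len: "real (a n (Suc l)) / real n - real (a n l) / real n = real (a n (Suc l) - a n l) / real n"
        using a_le[of n l] by (simp add: of_nat_diff diff_divide_distrib)
      have alg: "k * (x * (q / y)) = q * (x * (k / y))" for k x q y :: real by simp
      show "(\<Sum>j\<in>{a n l..<a n (Suc l)}. (cmod (\<eta> l) * c n)\<^sup>2 * (1 - r\<^sup>2) / 4) =
          (1 + r) / (4 * (1 - r)) * ((cmod (\<eta> l))\<^sup>2 * (real (a n (Suc l)) / real n - real (a n l) / real n))"
        unfolding term_eq len sum_constant card_atLeastLessThan by (rule alg)
    qed
    finally show ?thesis by (simp only: sum_distrib_left)
  qed
  have W_lim: "W \<longlonglongrightarrow> (1 + r) / (4 * (1 - r)) * (\<Sum>l<m. (cmod (\<eta> l))\<^sup>2) / real m"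
  proof -
    have "W \<longlonglongrightarrow> (1 + r) / (4 * (1 - r)) * (\<Sum>l<m. (cmod (\<eta> l))\<^sup>2 * (real (Suc l) / real m - real l / real m))"
      unfolding W_eq[abs_def] a_def by (intro tendsto_intros floor_ratio_tendsto m)
    also have "(\<Sum>l<m. (cmod (\<eta> l))\<^sup>2 * (real (Suc l) / real m - real l / real m)) = (\<Sum>l<m. (cmod (\<eta> l))\<^sup>2) / real m"
      by (simp add: sum_divide_distrib diff_divide_distrib[symmetric])
    finally show ?thesis by simp
  qed
  have "(\<lambda>n. expectation (wave (\<mu> n) n)) \<longlonglongrightarrow> of_real (exp (- ((1 + r) / (4 * (1 - r))
      * (\<Sum>l<m. (cmod (\<eta> l))\<^sup>2) / real m)))"
  proof (rule Lim_transform)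
    show "(\<lambda>n. complex_of_real (exp (- W n)))
        \<longlonglongrightarrow> of_real (exp (- ((1 + r) / (4 * (1 - r)) * (\<Sum>l<m. (cmod (\<eta> l))\<^sup>2) / real m)))"
      by (intro tendsto_intros W_lim)
    show "(\<lambda>n. expectation (wave (\<mu> n) n) - of_real (exp (- W n))) \<longlonglongrightarrow> 0"
    proof (rule Lim_null_comparison[OF _ err_lim])
      have "eventually (\<lambda>n. \<epsilon> n < 1) sequentially" using \<epsilon>_lim by (rule order_tendstoD) simp
      then show "eventually (\<lambda>n. norm (expectation (wave (\<mu> n) n) - of_real (exp (- W n))) \<le>
          ((\<epsilon> n)\<^sup>2 + real n * \<epsilon> n ^ 3) * (3 + 1 / (1 - \<bar>s\<bar>))) sequentially"
      proof eventually_elim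
        case (elim n)
        then show ?case
          using char_error_le[of "\<mu> n" "\<epsilon> n" n, OF \<mu>_le] by (simp add: W_def)
      qed
    qed
  qed
  moreover have "wave (\<mu> n) n = (\<lambda>\<omega>. cis (\<Sum>l<m. Re (\<eta> l * (scaled_mart n (a n (Suc l)) \<omega>
      - scaled_mart n (a n l) \<omega>))))" for n
    by (rule ext) (rule wave_eq)
  ultimately show ?thesis unfolding a_def by (simp only:)
qed

end

section \<open>Comparison of the walk with its interpolation\<close>

text \<open>The linearly interpolated partial sums of a sequence numbered from 0, as a function of
  time.\<close>

definition polygon :: "(nat \<Rightarrow> complex) \<Rightarrow> real \<Rightarrow> complex" where
  "polygon u x = (\<Sum>j<nat \<lfloor>x\<rfloor>. u j) + complex_of_real (x - of_int \<lfloor>x\<rfloor>) * u (nat \<lfloor>x\<rfloor>)"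

lemma continuous_on_polygon: "continuous_on {0..real n} (polygon u)"
proof -
  \<comment> \<open>The fraction of step \<open>j\<close> that is completed by time \<open>x\<close>.\<close>
  define ramp where "ramp j x = max 0 (min 1 (x - real j))" for j and x :: real
  have eq: "polygon u x = (\<Sum>j\<le>n. complex_of_real (ramp j x) * u j)" if x: "x \<in> {0..real n}" for x
  proof -
    let ?k = "nat \<lfloor>x\<rfloor>"
    have fl: "of_int \<lfloor>x\<rfloor> = real ?k" using x by (simp add: of_nat_nat)
    have k: "real ?k \<le> x" "x < real ?k + 1" unfolding fl[symmetric] by linarith+
    have "real ?k \<le> real n" using k(1) x by simp
    then have kn: "?k \<le> n" by (simp only: of_nat_le_iff)
    have "(\<Sum>j\<le>n. complex_of_real (ramp j x) * u j) = (\<Sum>j\<in>{..<Suc ?k}. complex_of_real (ramp j x) * u j)"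
    proof (rule sum.mono_neutral_right)
      show "\<forall>j\<in>{..n} - {..<Suc ?k}. complex_of_real (ramp j x) * u j = 0"
      proof
        fix j assume "j \<in> {..n} - {..<Suc ?k}"
        then have "Suc ?k \<le> j" by simp
        then have "real (Suc ?k) \<le> real j" by (simp only: of_nat_le_iff)
        then have "x - real j \<le> 0" using k by linarith
        then show "complex_of_real (ramp j x) * u j = 0" by (simp add: ramp_def)
      qed
    qed (use kn in auto)
    also have "\<dots> = (\<Sum>j<?k. complex_of_real (ramp j x) * u j) + complex_of_real (x - real ?k) * u ?k"
    proof -
      have "ramp ?k x = x - real ?k" unfolding ramp_def using k by linarith
      then show ?thesis by (simp only: sum.lessThan_Suc)
    qed
    also have "(\<Sum>j<?k. complex_of_real (ramp j x) * u j) = (\<Sum>j<?k. u j)"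
    proof (intro sum.cong refl)
      fix j assume "j \<in> {..<?k}"
      then have "Suc j \<le> ?k" by simp
      then have "real (Suc j) \<le> real ?k" by (simp only: of_nat_le_iff)
      then have "1 \<le> x - real j" using k by linarith
      then show "complex_of_real (ramp j x) * u j = u j" by (simp add: ramp_def)
    qed
    finally show ?thesis unfolding polygon_def fl by simp
  qed
  have "continuous_on {0..real n} (\<lambda>x. \<Sum>j\<le>n. complex_of_real (ramp j x) * u j)"
    unfolding ramp_def by (intro continuous_intros)
  then show ?thesis by (subst continuous_on_cong[OF refl eq]) auto
qed

lemma continuous_on_polygon_scaled: "continuous_on {0..1} (\<lambda>t. c *\<^sub>R polygon u (real n * t))"
  by (intro continuous_intros continuous_on_compose2[OF continuous_on_polygon[of n u]]) (auto simp: mult_left_le)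

context unit_steps
begin

definition walk_path :: "nat \<Rightarrow> real \<Rightarrow> 'a \<Rightarrow> complex" where
  "walk_path n t \<omega> = (1 / sqrt (real n)) *\<^sub>R polygon (\<lambda>j. U j \<omega>) (real n * t)"

text \<open>Before scaling, the boundary terms of \<open>partial_sum_eq_mart\<close> contribute at most
  \<open>2 / (1 - r)\<close>, the step in progress at most 1.\<close>

lemma walk_path_near_scaled_mart:
  assumes \<omega>: "\<omega> \<in> space M"
  shows "cmod (walk_path n t \<omega> - scaled_mart n (nat \<lfloor>real n * t\<rfloor>) \<omega>) \<le> (2 / (1 - r) + 1) * (1 / sqrt (real n))"
proof -
  let ?k = "nat \<lfloor>real n * t\<rfloor>" and ?f = "real n * t - of_int \<lfloor>real n * t\<rfloor>"
  have r1: "complex_of_real (1 - r) \<noteq> 0" using one_minus_r_pos by simp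
  have S: "(\<Sum>j<?k. U j \<omega>) = (mart ?k \<omega> + U 0 \<omega> - U ?k \<omega>) / of_real (1 - r)"
    using partial_sum_eq_mart[where k="?k" and \<omega>=\<omega>] r1 by (simp add: eq_divide_eq mult.commute)
  have c: "complex_of_real (1 / ((1 - r) * sqrt (real n))) = of_real (1 / sqrt (real n)) / of_real (1 - r)"
    by simp
  have eq: "walk_path n t \<omega> - scaled_mart n ?k \<omega> =
      of_real (1 / sqrt (real n)) * ((U 0 \<omega> - U ?k \<omega>) / of_real (1 - r) + of_real ?f * U ?k \<omega>)"
    unfolding walk_path_def polygon_def scaled_mart_def S c scaleR_conv_of_real
    by (simp add: add_divide_distrib diff_divide_distrib distrib_left right_diff_distrib mult.commute[of
        "mart _ _"] del: of_real_diff of_real_divide)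
  have "cmod ((U 0 \<omega> - U ?k \<omega>) / of_real (1 - r)) \<le> 2 / (1 - r)"
    using norm_triangle_ineq4[of "U 0 \<omega>" "U ?k \<omega>"] \<omega> one_minus_r_pos
    by (simp add: norm_divide del: of_real_diff) (simp add: divide_right_mono)
  moreover have "cmod (of_real ?f * U ?k \<omega>) \<le> 1"
    using \<omega> by (simp add: norm_mult del: of_real_diff) linarith
  ultimately have "cmod ((U 0 \<omega> - U ?k \<omega>) / of_real (1 - r) + of_real ?f * U ?k \<omega>) \<le> 2 / (1 - r) + 1"
    by (intro order_trans[OF norm_triangle_ineq] add_mono)
  then have "(1 / sqrt (real n)) * cmod ((U 0 \<omega> - U ?k \<omega>) / of_real (1 - r) + of_real ?f * U ?k \<omega>)
      \<le> (1 / sqrt (real n)) * (2 / (1 - r) + 1)"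
    by (intro mult_left_mono) auto
  then show ?thesis unfolding eq norm_mult norm_of_real by (simp add: mult.commute)
qed

text \<open>The interpolation at \<open>t\<close> averages over the ends of the block that contains \<open>t\<close>. Both ends
  differ from the martingale at time \<open>n * t\<close> by at most twice the oscillation in that block.\<close>

lemma walk_path_near_hat_interp:
  assumes \<omega>: "\<omega> \<in> space M" and m: "0 < m" and n: "0 < n" and t: "t \<in> {0..1}"
    and osc: "\<And>l k. l < m \<Longrightarrow> k \<in> {(n * l) div m..(n * Suc l) div m} \<Longrightarrow>
        cmod (mart k \<omega> - mart ((n * l) div m) \<omega>) < \<delta> * sqrt (real n)"
  shows "cmod (walk_path n t \<omega> - hat_interp m (\<lambda>l. scaled_mart n ((n * l) div m) \<omega>) t) \<le>
      (2 / (1 - r) + 1) * (1 / sqrt (real n)) + 2 * \<delta> / (1 - r)"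
proof -
  define a where "a l = (n * l) div m" for l
  let ?k = "nat \<lfloor>real n * t\<rfloor>"
  have nt: "0 \<le> real n * t" "real n * t \<le> real n" using t by (auto intro: mult_left_le)
  have k_le: "real ?k \<le> real n * t" using nt by (simp add: of_nat_nat)
  have a_le_k: "a l \<le> ?k" if "real l \<le> real m * t" for l
  proof -
    have "real (a l) \<le> real (n * l) / real m" unfolding a_def by (rule of_nat_div_le_of_nat)
    also have "\<dots> \<le> real n * t"
      using mult_left_mono[OF that, of "real n"] m by (simp add: pos_divide_le_eq mult_ac)
    finally show ?thesis by (rule le_nat_floor)
  qed
  have k_le_a: "?k \<le> a l" if "real m * t \<le> real l" for l
  proof -
    have "real (?k * m) \<le> real n * t * real m"
      unfolding of_nat_mult using k_le by (rule mult_right_mono) simp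
    also have "\<dots> \<le> real (n * l)" using mult_left_mono[OF that, of "real n"] by (simp add: mult_ac)
    finally have "?k * m \<le> n * l" by (simp only: of_nat_le_iff)
    then show ?thesis using m by (simp add: a_def less_eq_div_iff_mult_less_eq)
  qed
  have a_mono: "a l \<le> a (Suc l)" for l using monoD[OF mono_block_ends[of n m], of l "Suc l"] by (simp add: a_def)
  have \<delta>: "0 < \<delta> * sqrt (real n)" using osc[of 0 "a 0"] m a_mono[of 0] by (simp add: a_def)
  have near: "cmod (mart (a l) \<omega> - mart ?k \<omega>) \<le> 2 * (\<delta> * sqrt (real n))"
    if l: "l \<le> m" "\<bar>real m * t - real l\<bar> < 1" for l
  proof (cases "real l \<le> real m * t")
    case True
    show ?thesis
    proof (cases "l < m")
      case True
      have "?k \<in> {a l..a (Suc l)}"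
        using a_le_k[OF \<open>real l \<le> real m * t\<close>] k_le_a[of "Suc l"] l(2) by auto
      then have "cmod (mart ?k \<omega> - mart (a l) \<omega>) < \<delta> * sqrt (real n)"
        using osc[OF True] by (simp add: a_def)
      then show ?thesis using \<delta> by (simp add: norm_minus_commute)
    next
      case False
      have "t = 1"
      proof (rule antisym)
        show "1 \<le> t" using False l(1) True m by simp
      qed (use t in simp)
      then have "a l = ?k" using False l(1) m by (simp add: a_def)
      then show ?thesis using \<delta> by simp
    qed
  next
    case False
    then obtain l' where l': "l = Suc l'" using t by (cases l) auto
    have "real l' \<le> real m * t" using l(2) l' by simp
    then have "?k \<in> {a l'..a (Suc l')}" using a_le_k[of l'] k_le_a[of l] False l' by auto
    moreover have "a (Suc l') \<in> {a l'..a (Suc l')}" using a_mono by simp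
    ultimately have "cmod (mart ?k \<omega> - mart (a l') \<omega>) < \<delta> * sqrt (real n)"
        "cmod (mart (a l) \<omega> - mart (a l') \<omega>) < \<delta> * sqrt (real n)"
      using osc[of l'] l(1) l' by (auto simp: a_def)
    then show ?thesis
      using norm_triangle_ineq4[of "mart (a l) \<omega> - mart (a l') \<omega>" "mart ?k \<omega> - mart (a l') \<omega>"] by simp
  qed
  have "cmod (hat_interp m (\<lambda>l. scaled_mart n (a l) \<omega>) t - walk_path n t \<omega>) \<le>
      (2 / (1 - r) + 1) * (1 / sqrt (real n)) + 2 * \<delta> / (1 - r)"
    unfolding hat_interp_def
  proof (rule norm_hat_average_le)
    show "0 \<le> real m * t" "real m * t \<le> real m" using t by (auto intro: mult_left_le)
    fix l assume l: "l \<le> m" "\<bar>real m * t - real l\<bar> < 1"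
    have "cmod (scaled_mart n (a l) \<omega> - scaled_mart n ?k \<omega>)
        = cmod (mart (a l) \<omega> - mart ?k \<omega>) * (1 / ((1 - r) * sqrt (real n)))"
      unfolding scaled_mart_def left_diff_distrib[symmetric] norm_mult norm_of_real
      using one_minus_r_pos by simp
    also have "\<dots> \<le> 2 * (\<delta> * sqrt (real n)) * (1 / ((1 - r) * sqrt (real n)))"
      using near[OF l] one_minus_r_pos by (intro mult_right_mono) auto
    also have "\<dots> = 2 * \<delta> / (1 - r)" using n one_minus_r_pos by (simp add: field_simps)
    finally have "cmod (scaled_mart n (a l) \<omega> - scaled_mart n ?k \<omega>) \<le> 2 * \<delta> / (1 - r)" .
    moreover have "cmod (scaled_mart n ?k \<omega> - walk_path n t \<omega>) \<le> (2 / (1 - r) + 1) * (1 / sqrt (real n))"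
      using walk_path_near_scaled_mart[OF \<omega>, of n t] by (simp only: norm_minus_commute)
    moreover have "cmod (scaled_mart n (a l) \<omega> - walk_path n t \<omega>) \<le>
        cmod (scaled_mart n (a l) \<omega> - scaled_mart n ?k \<omega>) + cmod (scaled_mart n ?k \<omega> - walk_path n t \<omega>)"
      by (rule order_trans[OF _ norm_triangle_ineq]) simp
    ultimately show "cmod (scaled_mart n (a l) \<omega> - walk_path n t \<omega>) \<le>
        (2 / (1 - r) + 1) * (1 / sqrt (real n)) + 2 * \<delta> / (1 - r)" by linarith
  qed
  then show ?thesis by (simp only: a_def norm_minus_commute)
qed

definition oscillation_event :: "nat \<Rightarrow> nat \<Rightarrow> real \<Rightarrow> 'a set" where
  "oscillation_event n m \<delta> = (\<Union>l<m. {\<omega> \<in> space M. \<exists>k\<in>{(n * l) div m..(n * Suc l) div m}.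
      \<delta> * sqrt (real n) \<le> cmod (mart k \<omega> - mart ((n * l) div m) \<omega>)})"

lemma sets_oscillation_event: "oscillation_event n m \<delta> \<in> sets M"
  unfolding oscillation_event_def by (intro sets.finite_UN sets_oscillation) simp

text \<open>A block has length at most \<open>2 * n / m\<close>, so the maximal inequality bounds its contribution
  by \<open>64 * (2 * n / m)\<^sup>2 / (\<delta> ^ 4 * n\<^sup>2)\<close>, a multiple of \<open>1 / m\<^sup>2\<close>; there are \<open>m\<close> blocks. The power
  \<open>m\<^sup>2\<close>, due to fourth moments, is what makes the sum over the blocks small.\<close>

lemma prob_oscillation_event_le:
  assumes m: "0 < m" and n: "m \<le> n" and \<delta>: "0 < \<delta>"
  shows "prob (oscillation_event n m \<delta>) \<le> 256 / (real m * \<delta> ^ 4)"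
proof -
  have n0: "0 < real n" using m n by simp
  have "prob (oscillation_event n m \<delta>) \<le> (\<Sum>l<m. prob {\<omega> \<in> space M. \<exists>k\<in>{(n * l) div m..(n * Suc l) div m}.
      \<delta> * sqrt (real n) \<le> cmod (mart k \<omega> - mart ((n * l) div m) \<omega>)})"
    unfolding oscillation_event_def by (intro finite_measure_subadditive_finite) (auto intro: sets_oscillation)
  also have "\<dots> \<le> (\<Sum>l<m. 256 / ((real m)\<^sup>2 * \<delta> ^ 4))"
  proof (rule sum_mono)
    fix l
    let ?a = "(n * l) div m" and ?b = "(n * Suc l) div m"
    have ab: "?a \<le> ?b" using monoD[OF mono_block_ends[of n m], of l "Suc l"] by simp
    have "real (?b - ?a) \<le> real (n * Suc l) / real m - (real (n * l) / real m - 1)"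
      using real_div_minus_div_le_1[of "n * l" m] of_nat_div_le_of_nat[of "n * Suc l" m, where 'a=real] ab
      by (simp only: of_nat_diff)
    also have "\<dots> = real n / real m + 1" by (simp add: add_divide_distrib[symmetric] diff_divide_distrib[symmetric]
        algebra_simps)
    also have "\<dots> \<le> 2 * (real n / real m)"
    proof -
      have "1 \<le> real n / real m" using m n by simp
      then show ?thesis by linarith
    qed
    finally have len: "real (?b - ?a) \<le> 2 * (real n / real m)" .
    have "prob {\<omega> \<in> space M. \<exists>k\<in>{?a..?b}. \<delta> * sqrt (real n) \<le> cmod (mart k \<omega> - mart ?a \<omega>)}
        \<le> 64 * (real (?b - ?a))\<^sup>2 / (\<delta> * sqrt (real n)) ^ 4"
      using ab \<delta> n0 by (intro mart_maximal_inequality) auto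
    also have "\<dots> \<le> 64 * (2 * (real n / real m))\<^sup>2 / (\<delta> * sqrt (real n)) ^ 4"
      using len by (intro divide_right_mono mult_left_mono power_mono) auto
    also have "(\<delta> * sqrt (real n)) ^ 4 = \<delta> ^ 4 * (real n)\<^sup>2"
    proof -
      have "sqrt (real n) ^ 4 = (sqrt (real n) * sqrt (real n)) * (sqrt (real n) * sqrt (real n))"
        by (simp only: power4_eq_xxxx mult.assoc)
      also have "\<dots> = (real n)\<^sup>2" by (simp add: power2_eq_square)
      finally show ?thesis by (simp only: power_mult_distrib)
    qed
    also have "64 * (2 * (real n / real m))\<^sup>2 / (\<delta> ^ 4 * (real n)\<^sup>2) = 256 / ((real m)\<^sup>2 * \<delta> ^ 4)"
      using n0 m \<delta> by (simp add: power_mult_distrib power_divide field_simps)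
    finally show "prob {\<omega> \<in> space M. \<exists>k\<in>{?a..?b}. \<delta> * sqrt (real n) \<le> cmod (mart k \<omega> - mart ?a \<omega>)}
        \<le> 256 / ((real m)\<^sup>2 * \<delta> ^ 4)" .
  qed
  also have "\<dots> = 256 / (real m * \<delta> ^ 4)" using m by (simp add: power2_eq_square)
  finally show ?thesis .
qed

lemma continuous_on_walk_path: "continuous_on {0..1} (\<lambda>t. walk_path n t \<omega>)"
  unfolding walk_path_def by (rule continuous_on_polygon_scaled)

lemma measurable_walk_path [measurable]: "walk_path n t \<in> borel_measurable M"
  unfolding walk_path_def polygon_def by measurable

text \<open>Off the oscillation event the two paths are uniformly close and the Lipschitz bound
  applies; on it, the functional changes by at most \<open>2 * C\<close>.\<close>

lemma path_functional_error_le: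
  assumes F: "path_functional C L F" and m: "0 < m" and n: "m \<le> n" and \<delta>: "0 < \<delta>"
  shows "\<bar>expectation (\<lambda>\<omega>. F (\<lambda>t. walk_path n t \<omega>)) -
      expectation (\<lambda>\<omega>. F (hat_interp m (\<lambda>l. scaled_mart n ((n * l) div m) \<omega>)))\<bar> \<le>
    L * ((2 / (1 - r) + 1) * (1 / sqrt (real n)) + 2 * \<delta> / (1 - r)) + 2 * C * (256 / (real m * \<delta> ^ 4))"
proof -
  let ?e = "(2 / (1 - r) + 1) * (1 / sqrt (real n)) + 2 * \<delta> / (1 - r)"
  let ?A = "oscillation_event n m \<delta>"
  let ?f = "\<lambda>\<omega>. F (\<lambda>t. walk_path n t \<omega>)" and ?g = "\<lambda>\<omega>. F (hat_interp m (\<lambda>l. scaled_mart n ((n * l) div m) \<omega>))"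
  have L: "0 \<le> L" and C: "0 \<le> C" using path_functionalD[OF F] by auto
  have e: "0 \<le> ?e" using one_minus_r_pos \<delta> by (intro add_nonneg_nonneg mult_nonneg_nonneg divide_nonneg_nonneg) auto
  have A[measurable]: "?A \<in> sets M" by (rule sets_oscillation_event)
  have f_meas: "?f \<in> borel_measurable M"
    by (rule borel_measurable_path_functional[OF F continuous_on_walk_path measurable_walk_path])
  have g_meas: "?g \<in> borel_measurable M"
    by (rule borel_measurable_Lipschitz_coordinates[OF path_functional_hat_interp_Lipschitz[OF F]]) measurable
  have f_le: "\<bar>?f \<omega>\<bar> \<le> C" and g_le: "\<bar>?g \<omega>\<bar> \<le> C" for \<omega>
    using path_functionalD(3)[OF F] continuous_on_walk_path continuous_on_hat_interp by blast+
  have f_int: "integrable M ?f" and g_int: "integrable M ?g"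
    using f_le g_le by (auto intro!: integrable_bounded f_meas g_meas)
  have pointwise: "\<bar>?f \<omega> - ?g \<omega>\<bar> \<le> L * ?e + 2 * C * indicator ?A \<omega>" if \<omega>: "\<omega> \<in> space M" for \<omega>
  proof (cases "\<omega> \<in> ?A")
    case True
    have "0 \<le> L * ?e" using L e by simp
    then show ?thesis using f_le[of \<omega>] g_le[of \<omega>] True by simp
  next
    case False
    have "\<bar>?f \<omega> - ?g \<omega>\<bar> \<le> L * ?e"
    proof (rule path_functionalD(4)[OF F continuous_on_walk_path continuous_on_hat_interp])
      fix t :: real assume t: "t \<in> {0..1}"
      show "cmod (walk_path n t \<omega> - hat_interp m (\<lambda>l. scaled_mart n ((n * l) div m) \<omega>) t) \<le> ?e"
      proof (rule walk_path_near_hat_interp[OF \<omega> m _ t])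
        fix l k assume l: "l < m" and k: "k \<in> {(n * l) div m..(n * Suc l) div m}"
        show "cmod (mart k \<omega> - mart ((n * l) div m) \<omega>) < \<delta> * sqrt (real n)"
        proof (rule ccontr)
          assume "\<not> cmod (mart k \<omega> - mart ((n * l) div m) \<omega>) < \<delta> * sqrt (real n)"
          then have "\<omega> \<in> {\<omega> \<in> space M. \<exists>k\<in>{(n * l) div m..(n * Suc l) div m}.
              \<delta> * sqrt (real n) \<le> cmod (mart k \<omega> - mart ((n * l) div m) \<omega>)}"
            using k \<omega> unfolding not_less by blast
          then have "\<omega> \<in> oscillation_event n m \<delta>" unfolding oscillation_event_def using l by blast
          then show False using False by contradiction
        qed
      qed (use m n in simp)
    qed
    then show ?thesis using False by simp
  qed
  have "\<bar>expectation ?f - expectation ?g\<bar> = \<bar>expectation (\<lambda>\<omega>. ?f \<omega> - ?g \<omega>)\<bar>"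
    using f_int g_int by simp
  also have "\<dots> \<le> expectation (\<lambda>\<omega>. \<bar>?f \<omega> - ?g \<omega>\<bar>)"
    using integral_norm_bound[of M "\<lambda>\<omega>. ?f \<omega> - ?g \<omega>"] by simp
  also have "\<dots> \<le> expectation (\<lambda>\<omega>. L * ?e + 2 * C * indicator ?A \<omega>)"
  proof (rule integral_mono)
    show "integrable M (\<lambda>\<omega>. \<bar>?f \<omega> - ?g \<omega>\<bar>)" using f_int g_int
        by (intro integrable_abs Bochner_Integration.integrable_diff)
    show "integrable M (\<lambda>\<omega>. L * ?e + 2 * C * indicator ?A \<omega>)"
      by (intro Bochner_Integration.integrable_add integrable_mult_right integrable_real_indicator A
          integrable_const)
         (simp add: emeasure_eq_measure)
  qed (rule pointwise)
  also have "\<dots> = L * ?e + 2 * C * prob ?A"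
    by (subst Bochner_Integration.integral_add)
       (auto simp: prob_space emeasure_eq_measure intro!: integrable_mult_right integrable_real_indicator)
  also have "\<dots> \<le> L * ?e + 2 * C * (256 / (real m * \<delta> ^ 4))"
    using C prob_oscillation_event_le[OF m n \<delta>] by (intro add_left_mono mult_left_mono) auto
  finally show ?thesis .
qed

end

context unit_steps
begin

section \<open>The functional central limit theorem\<close>

text \<open>Fix \<open>e\<close> and choose in this order: \<open>\<delta>\<close> for the Lipschitz error within blocks, then the
  number \<open>m\<close> of blocks for the probability of large oscillations and for the interpolation of
  Brownian motion, then \<open>n\<close> large. For this \<open>m\<close> the functional of the interpolated path is a bounded
  Lipschitz function of the block increments, so that \<open>multivariate_levy_complex\<close> applies.\<close>

lemma functional_limit:
  fixes N :: "'b measure" and B :: "real \<Rightarrow> 'b \<Rightarrow> complex"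
  assumes BM: "brownian_motion_2d N B" and \<sigma>: "\<sigma>\<^sup>2 = 1 / 2 * ((1 + r) / (1 - r))"
    and F: "path_functional C L F"
  shows "(\<lambda>n. expectation (\<lambda>\<omega>. F (\<lambda>t. walk_path n t \<omega>))) \<longlonglongrightarrow> (\<integral>\<omega>. F (\<lambda>t. \<sigma> *\<^sub>R B t \<omega>) \<partial>N)"
proof -
  interpret N: brownian_motion_2d N B by fact
  have L: "0 \<le> L" and C: "0 \<le> C" using path_functionalD[OF F] by auto
  have Z_cont: "continuous_on {0..1} (\<lambda>t. \<sigma> *\<^sub>R B t \<omega>)" if "\<omega> \<in> space N" for \<omega>
    using N.continuous_paths[OF that] by (intro continuous_intros) (rule continuous_on_subset, auto)
  have B_meas: "B (real l / real m) \<in> borel_measurable N" for l m by (rule N.measurable) simp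
  have F_hat_le: "\<bar>F (hat_interp m x)\<bar> \<le> C" for m x
    by (rule path_functionalD(3)[OF F continuous_on_hat_interp])
  have Z_hat_meas: "(\<lambda>\<omega>. F (hat_interp m (\<lambda>l. \<sigma> *\<^sub>R B (real l / real m) \<omega>))) \<in> borel_measurable N" for m
    by (rule borel_measurable_Lipschitz_coordinates[OF path_functional_hat_interp_Lipschitz[OF F]])
       (intro borel_measurable_scaleR borel_measurable_const B_meas)
  have Z_meas: "(\<lambda>\<omega>. F (\<lambda>t. \<sigma> *\<^sub>R B t \<omega>)) \<in> borel_measurable N"
    by (rule borel_measurable_path_functional[OF F Z_cont])
       (auto intro!: borel_measurable_scaleR N.measurable)
  have Z_lim: "(\<lambda>m. \<integral>\<omega>. F (hat_interp m (\<lambda>l. \<sigma> *\<^sub>R B (real l / real m) \<omega>)) \<partial>N) \<longlonglongrightarrow> (\<integral>\<omega>. F (\<lambda>t. \<sigma> *\<^sub>R B t \<omega>) \<partial>N)"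
  proof (rule integral_dominated_convergence[where w="\<lambda>_. C"])
    show "AE \<omega> in N. (\<lambda>m. F (hat_interp m (\<lambda>l. \<sigma> *\<^sub>R B (real l / real m) \<omega>))) \<longlonglongrightarrow> F (\<lambda>t. \<sigma> *\<^sub>R B t \<omega>)"
      using path_functional_hat_interp_tendsto[OF F Z_cont] by (intro AE_I2)
    show "AE \<omega> in N. norm (F (hat_interp m (\<lambda>l. \<sigma> *\<^sub>R B (real l / real m) \<omega>))) \<le> C" for m
      using F_hat_le by (intro AE_I2) simp
  qed (use Z_meas Z_hat_meas in simp_all)
  show ?thesis
  proof (rule tendsto_by_approximation)
    fix e :: real assume e: "0 < e"
    define \<delta> where "\<delta> = e / 8 / (L + 1) * (1 - r)"
    have L1: "0 < L + 1" using L by linarith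
    have \<delta>: "0 < \<delta>" unfolding \<delta>_def using e L1 one_minus_r_pos by (intro mult_pos_pos divide_pos_pos) auto
    have L\<delta>: "L * (2 * \<delta> / (1 - r)) \<le> e / 4"
    proof -
      have alg: "2 * (e / 8 / y * z) / z = e / 4 / y" if "z \<noteq> 0" for y z :: real using that by simp
      have "1 - r \<noteq> 0" using one_minus_r_pos by linarith
      then have "2 * \<delta> / (1 - r) = e / 4 / (L + 1)" unfolding \<delta>_def by (rule alg)
      then have "L * (2 * \<delta> / (1 - r)) = L * (e / 4 / (L + 1))" by (simp only:)
      also have "\<dots> \<le> (L + 1) * (e / 4 / (L + 1))" using e L1 by (intro mult_right_mono divide_nonneg_nonneg) auto
      also have "\<dots> = e / 4"
      proof -
        have alg: "y * (e / 4 / y) = e / 4" if "y \<noteq> 0" for y :: real using that by simp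
        have "L + 1 \<noteq> 0" using L1 by linarith
        then show ?thesis by (rule alg)
      qed
      finally show ?thesis .
    qed
    have "(\<lambda>m. 2 * C * (256 / \<delta> ^ 4 * (1 / real m))) \<longlonglongrightarrow> 2 * C * (256 / \<delta> ^ 4 * 0)"
      by (intro tendsto_intros lim_inverse_n')
    then have "eventually (\<lambda>m. 2 * C * (256 / \<delta> ^ 4 * (1 / real m)) < e / 4) sequentially"
      using e by (intro order_tendstoD(2)) auto
    moreover have "eventually (\<lambda>m. dist (\<integral>\<omega>. F (hat_interp m (\<lambda>l. \<sigma> *\<^sub>R B (real l / real m) \<omega>)) \<partial>N) (\<integral>\<omega>. F (\<lambda>t. \<sigma>
        *\<^sub>R B t \<omega>) \<partial>N) < e) sequentially"
      using Z_lim e by (rule tendstoD)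
    ultimately have "eventually (\<lambda>m. 0 < m \<and> 2 * C * (256 / \<delta> ^ 4 * (1 / real m)) < e / 4 \<and>
        dist (\<integral>\<omega>. F (hat_interp m (\<lambda>l. \<sigma> *\<^sub>R B (real l / real m) \<omega>)) \<partial>N) (\<integral>\<omega>. F (\<lambda>t. \<sigma> *\<^sub>R B t \<omega>) \<partial>N)
            < e) sequentially"
      using eventually_gt_at_top[of 0] by eventually_elim simp
    then obtain m where m: "0 < m" and m_tight: "2 * C * (256 / \<delta> ^ 4 * (1 / real m)) < e / 4"
      and m_Z: "dist (\<integral>\<omega>. F (hat_interp m (\<lambda>l. \<sigma> *\<^sub>R B (real l / real m) \<omega>)) \<partial>N) (\<integral>\<omega>. F (\<lambda>t. \<sigma> *\<^sub>R B t \<omega>) \<partial>N) < e"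
      by (auto simp: eventually_sequentially)
    define X where "X n l \<omega> = scaled_mart n ((n * Suc l) div m) \<omega> - scaled_mart n ((n * l) div m) \<omega>" for n l \<omega>
    define Y where "Y l \<omega> = of_real \<sigma> * (B (real (Suc l) / real m) \<omega> - B (real l / real m) \<omega>)" for l \<omega>
    \<comment> \<open>\<open>\<Phi>\<close> recovers the nodes from the increments. On the side of \<open>B\<close> this gives
      \<open>B (l / m) - B 0\<close>, equal to \<open>B (l / m)\<close> almost surely.\<close>
    define \<Phi> where "\<Phi> x = F (hat_interp m (\<lambda>l. \<Sum>i<l. x i))" for x
    have \<Phi>_lip: "\<bar>\<Phi> x - \<Phi> y\<bar> \<le> L * (real m + 1) * (\<Sum>i<m. cmod (x i - y i))" for x y
    proof -
      have "\<bar>\<Phi> x - \<Phi> y\<bar> \<le> L * (\<Sum>l\<in>{..m}. cmod ((\<Sum>i<l. x i) - (\<Sum>i<l. y i)))"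
        unfolding \<Phi>_def by (rule path_functional_hat_interp_Lipschitz[OF F])
      also have "\<dots> \<le> L * (\<Sum>l\<in>{..m}. \<Sum>i<m. cmod (x i - y i))"
      proof (intro mult_left_mono sum_mono L)
        fix l assume l: "l \<in> {..m}"
        have "cmod ((\<Sum>i<l. x i) - (\<Sum>i<l. y i)) \<le> (\<Sum>i<l. cmod (x i - y i))"
          unfolding sum_subtractf[symmetric] by (rule norm_sum)
        also have "\<dots> \<le> (\<Sum>i<m. cmod (x i - y i))" using l by (intro sum_mono2) auto
        finally show "cmod ((\<Sum>i<l. x i) - (\<Sum>i<l. y i)) \<le> (\<Sum>i<m. cmod (x i - y i))" .
      qed
      finally show ?thesis by (simp add: add.commute)
    qed
    have char: "(\<lambda>n. expectation (\<lambda>\<omega>. cis (\<Sum>l<m. Re (\<eta> l * X n l \<omega>))))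
        \<longlonglongrightarrow> (\<integral>\<omega>. cis (\<Sum>l<m. Re (\<eta> l * Y l \<omega>)) \<partial>N)" for \<eta>
    proof -
      have "(\<integral>\<omega>. cis (\<Sum>l<m. Re (\<eta> l * Y l \<omega>)) \<partial>N) = of_real (exp (- (\<sigma>\<^sup>2 / (2 * real m) * (\<Sum>l<m. (cmod (\<eta> l))\<^sup>2))))"
        unfolding Y_def by (rule N.expectation_cis_increments[OF m])
      also have "\<sigma>\<^sup>2 / (2 * real m) * (\<Sum>l<m. (cmod (\<eta> l))\<^sup>2)
          = (1 + r) / (4 * (1 - r)) * (\<Sum>l<m. (cmod (\<eta> l))\<^sup>2) / real m"
        unfolding \<sigma> by simp
      finally show ?thesis
        using char_block_increments_tendsto[OF m, of \<eta>] unfolding X_def by (simp only:)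
    qed
    have "(\<lambda>n. expectation (\<lambda>\<omega>. \<Phi> (\<lambda>l. X n l \<omega>))) \<longlonglongrightarrow> (\<integral>\<omega>. \<Phi> (\<lambda>l. Y l \<omega>) \<partial>N)"
    proof (rule multivariate_levy_complex[OF prob_space_axioms N.prob_space_axioms _ _ char _ \<Phi>_lip])
      show "X n l \<in> borel_measurable M" for n l unfolding X_def by measurable
      show "Y l \<in> borel_measurable N" for l
        unfolding Y_def by (intro borel_measurable_times borel_measurable_const borel_measurable_diff B_meas)
      show "\<bar>\<Phi> x\<bar> \<le> C" for x unfolding \<Phi>_def by (rule F_hat_le)
    qed (use L in simp)
    moreover have "\<Phi> (\<lambda>l. X n l \<omega>) = F (hat_interp m (\<lambda>l. scaled_mart n ((n * l) div m) \<omega>))" for n \<omega>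
    proof -
      have "(\<Sum>i<l. X n i \<omega>) = scaled_mart n ((n * l) div m) \<omega>" for l
        unfolding X_def by (subst sum_lessThan_telescope) (simp add: scaled_mart_def mart_def)
      then show ?thesis by (simp only: \<Phi>_def)
    qed
    moreover have "(\<integral>\<omega>. \<Phi> (\<lambda>l. Y l \<omega>) \<partial>N) = (\<integral>\<omega>. F (hat_interp m (\<lambda>l. \<sigma> *\<^sub>R B (real l / real m) \<omega>)) \<partial>N)"
    proof (rule integral_cong_AE)
      show "AE \<omega> in N. \<Phi> (\<lambda>l. Y l \<omega>) = F (hat_interp m (\<lambda>l. \<sigma> *\<^sub>R B (real l / real m) \<omega>))"
        using N.start
      proof eventually_elim
        case (elim \<omega>)
        have "(\<Sum>i<l. Y i \<omega>) = \<sigma> *\<^sub>R B (real l / real m) \<omega>" for l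
        proof -
          have "(\<Sum>i<l. Y i \<omega>) = of_real \<sigma> * (\<Sum>i<l. B (real (Suc i) / real m) \<omega> - B (real i / real m) \<omega>)"
            unfolding Y_def by (simp only: sum_distrib_left)
          also have "\<dots> = of_real \<sigma> * (B (real l / real m) \<omega> - B (real 0 / real m) \<omega>)"
            by (subst sum_lessThan_telescope) (rule refl)
          finally show ?thesis using elim by (simp add: scaleR_conv_of_real)
        qed
        then show ?case by (simp only: \<Phi>_def)
      qed
      have "Y l \<in> borel_measurable N" for l
        unfolding Y_def by (intro borel_measurable_times borel_measurable_const borel_measurable_diff B_meas)
      then show "(\<lambda>\<omega>. \<Phi> (\<lambda>l. Y l \<omega>)) \<in> borel_measurable N"
        by (rule borel_measurable_Lipschitz_coordinates[OF \<Phi>_lip])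
    qed (rule Z_hat_meas)
    ultimately have lim: "(\<lambda>n. expectation (\<lambda>\<omega>. F (hat_interp m (\<lambda>l. scaled_mart n ((n * l) div m) \<omega>))))
        \<longlonglongrightarrow> (\<integral>\<omega>. F (hat_interp m (\<lambda>l. \<sigma> *\<^sub>R B (real l / real m) \<omega>)) \<partial>N)"
      by (simp only:)
    have "(\<lambda>n. L * ((2 / (1 - r) + 1) * (1 / sqrt (real n)))) \<longlonglongrightarrow> L * ((2 / (1 - r) + 1) * 0)"
      by (intro tendsto_intros one_over_sqrt_tendsto)
    then have "eventually (\<lambda>n. L * ((2 / (1 - r) + 1) * (1 / sqrt (real n))) < e / 4) sequentially"
      using e by (intro order_tendstoD(2)) auto
    then have "eventually (\<lambda>n. norm (expectation (\<lambda>\<omega>. F (\<lambda>t. walk_path n t \<omega>)) -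
        expectation (\<lambda>\<omega>. F (hat_interp m (\<lambda>l. scaled_mart n ((n * l) div m) \<omega>)))) < e) sequentially"
      using eventually_ge_at_top[of m]
    proof eventually_elim
      case (elim n)
      have "256 / (real m * \<delta> ^ 4) = 256 / \<delta> ^ 4 * (1 / real m)" by simp
      then have "2 * C * (256 / (real m * \<delta> ^ 4)) < e / 4" using m_tight by (simp only:)
      moreover have "L * ((2 / (1 - r) + 1) * (1 / sqrt (real n)) + 2 * \<delta> / (1 - r)) < e / 4 + e / 4"
        unfolding distrib_left[of L] using elim(1) L\<delta> by (rule add_less_le_mono)
      ultimately show ?case
        using path_functional_error_le[OF F m elim(2) \<delta>] e unfolding real_norm_def by linarith
    qed
    moreover have "norm ((\<integral>\<omega>. F (\<lambda>t. \<sigma> *\<^sub>R B t \<omega>) \<partial>N)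
        - (\<integral>\<omega>. F (hat_interp m (\<lambda>l. \<sigma> *\<^sub>R B (real l / real m) \<omega>)) \<partial>N)) < e"
      using m_Z by (simp only: dist_norm norm_minus_commute)
    ultimately show "\<exists>a L. a \<longlonglongrightarrow> L \<and>
        eventually (\<lambda>n. norm (expectation (\<lambda>\<omega>. F (\<lambda>t. walk_path n t \<omega>)) - a n) < e) sequentially \<and>
        norm ((\<integral>\<omega>. F (\<lambda>t. \<sigma> *\<^sub>R B t \<omega>) \<partial>N) - L) < e"
      using lim by blast
  qed
qed

end

section \<open>Uniformly distributed angles\<close>

lemma sin_less_self: "0 < x \<Longrightarrow> sin x < x" for x :: real
proof (cases "x \<le> 1")
  case True
  assume x: "0 < x"
  have "\<exists>z. 0 < z \<and> z < x \<and> sin x - sin 0 = (x - 0) * cos z"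
    using x by (intro MVT2) (auto intro!: derivative_eq_intros)
  then obtain z where z: "0 < z" "z < x" "sin x = x * cos z" by auto
  have "cos z < cos 0" using z True pi_gt3 by (intro cos_monotone_0_pi) auto
  then show ?thesis using z x by simp
next
  case False
  then show ?thesis using sin_le_one[of x] by linarith
qed

lemma abs_sinc_less_1:
  fixes x :: real
  assumes "0 < x" shows "\<bar>sin x / x\<bar> < 1"
proof -
  have "- x < sin x"
  proof (cases "x \<le> 1")
    case True
    then have "0 < sin x" using assms pi_gt3 by (intro sin_gt_zero) auto
    then show ?thesis using assms by linarith
  next
    case False
    then show ?thesis using sin_ge_minus_one[of x] by linarith
  qed
  then show ?thesis using sin_less_self[OF assms] assms by (simp add: abs_less_iff field_simps)
qed

lemma integral_cis_uniform:
  assumes \<alpha>: "0 < \<alpha>" and k: "k \<noteq> 0"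
  shows "(\<integral>x. cis (k * x) \<partial>uniform_measure lborel {-\<alpha>..\<alpha>}) = of_real (sin (k * \<alpha>) / (k * \<alpha>))"
proof -
  have deriv: "((\<lambda>x. cis (k * x) / (\<i> * of_real k)) has_vector_derivative cis (k * x)) (at x within A)" for x A
  proof -
    have "((\<lambda>x. exp (\<i> * of_real k * of_real x) / (\<i> * of_real k)) has_vector_derivative exp (\<i> * of_real k
        * of_real x)) (at x within A)"
      by (rule has_vector_derivative_real_field) (use k in \<open>auto intro!: derivative_eq_intros\<close>)
    then show ?thesis by (simp add: cis_conv_exp mult.assoc)
  qed
  have dens: "uniform_measure lborel {-\<alpha>..\<alpha>} = density lborel (\<lambda>x. ennreal (indicator {-\<alpha>..\<alpha>} x / (2 * \<alpha>)))"
    unfolding uniform_measure_def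
    by (intro density_cong AE_I2) (use \<alpha> in \<open>auto simp: indicator_def divide_ennreal[symmetric]\<close>)
  have "(\<integral>x. cis (k * x) \<partial>uniform_measure lborel {-\<alpha>..\<alpha>})
      = (\<integral>x. (indicator {-\<alpha>..\<alpha>} x / (2 * \<alpha>)) *\<^sub>R cis (k * x) \<partial>lborel)"
    unfolding dens using \<alpha> by (intro integral_density) auto
  also have "\<dots> = (\<integral>x. (1 / (2 * \<alpha>)) *\<^sub>R (indicator {-\<alpha>..\<alpha>} x *\<^sub>R cis (k * x)) \<partial>lborel)" by simp
  also have "\<dots> = (1 / (2 * \<alpha>)) *\<^sub>R (\<integral>x. indicator {-\<alpha>..\<alpha>} x *\<^sub>R cis (k * x) \<partial>lborel)"
    by (rule integral_scaleR_right)
  also have "(\<integral>x. indicator {-\<alpha>..\<alpha>} x *\<^sub>R cis (k * x) \<partial>lborel)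
      = cis (k * \<alpha>) / (\<i> * of_real k) - cis (k * (-\<alpha>)) / (\<i> * of_real k)"
    using \<alpha> deriv by (intro integral_FTC_atLeastAtMost) (auto intro!: continuous_intros)
  also have "\<dots> = of_real (2 * sin (k * \<alpha>) / k)"
    using k by (simp add: complex_eq_iff diff_divide_distrib[symmetric] Re_divide Im_divide power2_eq_square)
  finally show ?thesis by (simp add: scaleR_conv_of_real mult.commute)
qed

text \<open>For finitely many angles the product formula is their independence. An event of the
  initial direction is added by means of the independence of \<open>U1\<close> from the whole sequence, since the
  intersection of the events of the angles belongs to the \<open>\<sigma>\<close>-algebra generated by that sequence.\<close>

lemma indep_vars_start_and_angles:
  fixes M :: "'a measure" and \<Theta> :: "nat \<Rightarrow> 'a \<Rightarrow> real" and U1 :: "'a \<Rightarrow> complex"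
  assumes M: "prob_space M"
    and \<Theta>: "prob_space.indep_vars M (\<lambda>_. borel) \<Theta> {2..}"
    and U1: "indep_rv M borel U1 (PiM {2..} (\<lambda>_. borel)) (\<lambda>\<omega>. \<lambda>j\<in>{2..}. \<Theta> j \<omega>)"
  shows "prob_space.indep_vars M (\<lambda>_. borel) (\<lambda>j \<omega>. if j = 0 then U1 \<omega> else cis (\<Theta> (Suc j) \<omega>)) UNIV"
proof -
  interpret prob_space M by fact
  let ?X = "\<lambda>j \<omega>. if j = 0 then U1 \<omega> else cis (\<Theta> (Suc j) \<omega>)"
  let ?F = "\<lambda>j. {?X j -` A \<inter> space M |A. A \<in> sets borel}"
  let ?T = "\<lambda>\<omega>. \<lambda>j\<in>{2..}. \<Theta> j \<omega>"
  let ?P = "PiM {2::nat..} (\<lambda>_. borel :: real measure)"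
  have U1_meas: "U1 \<in> borel_measurable M" and T_meas: "?T \<in> M \<rightarrow>\<^sub>M ?P"
    and ind: "indep_set (sets (vimage_algebra (space M) U1 borel)) (sets (vimage_algebra (space M) ?T ?P))"
    using U1 by (auto simp: indep_rv_def)
  have \<Theta>_meas: "\<Theta> j \<in> borel_measurable M" if "2 \<le> j" for j
    using \<Theta> that by (auto simp: indep_vars_def)
  have X_meas: "?X j \<in> borel_measurable M" for j
  proof (cases "j = 0")
    case False
    then have [measurable]: "\<Theta> (Suc j) \<in> borel_measurable M" by (intro \<Theta>_meas) simp
    show ?thesis using False by simp
  qed (use U1_meas in simp)
  have angles: "prob (\<Inter>j\<in>J. A j) = (\<Prod>j\<in>J. prob (A j))"
    if J: "0 \<notin> J" "J \<noteq> {}" "finite J" and A: "\<And>j. j \<in> J \<Longrightarrow> A j \<in> ?F j" for J A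
  proof -
    have "\<forall>i\<in>Suc ` J. A (i - 1) \<in> {\<Theta> i -` S \<inter> space M |S. S \<in> sets borel}"
    proof
      fix i assume "i \<in> Suc ` J"
      then obtain j where j: "j \<in> J" "i = Suc j" by auto
      then obtain S where S: "S \<in> sets borel" "A j = ?X j -` S \<inter> space M" using A[of j] by auto
      have "cis -` S \<in> sets borel" using measurable_sets[OF borel_measurable_cis S(1)] by simp
      moreover have "A j = \<Theta> (Suc j) -` (cis -` S) \<inter> space M" using S(2) j(1) J(1) by (auto split: if_splits)
      ultimately show "A (i - 1) \<in> {\<Theta> i -` S \<inter> space M |S. S \<in> sets borel}" using j(2) by auto
    qed
    moreover have "indep_sets (\<lambda>i. {\<Theta> i -` S \<inter> space M |S. S \<in> sets borel}) {2..}"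
      using \<Theta> unfolding indep_vars_def2 by simp
    moreover have "Suc ` J \<subseteq> {2..}"
    proof
      fix i assume "i \<in> Suc ` J"
      then obtain j where "j \<in> J" "i = Suc j" by auto
      then show "i \<in> {2..}" using J(1) by (cases j) auto
    qed
    ultimately have "prob (\<Inter>i\<in>Suc ` J. A (i - 1)) = (\<Prod>i\<in>Suc ` J. prob (A (i - 1)))"
      using J by (intro indep_setsD) auto
    then show ?thesis by (simp add: prod.reindex)
  qed
  have all: "prob (\<Inter>j\<in>J. A j) = (\<Prod>j\<in>J. prob (A j))"
    if J: "J \<noteq> {}" "finite J" and A: "\<And>j. j \<in> J \<Longrightarrow> A j \<in> ?F j" for J A
  proof (cases "0 \<in> J \<and> J \<noteq> {0}")
    case False
    show ?thesis
    proof (cases "0 \<in> J")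
      case True
      then have "J = {0}" using False by blast
      then show ?thesis by simp
    next
      case False
      then show ?thesis using J A by (intro angles) auto
    qed
  next
    case True
    define J' where "J' = J - {0}"
    have J': "0 \<notin> J'" "J' \<noteq> {}" "finite J'" "J = insert 0 J'" "\<And>j. j \<in> J' \<Longrightarrow> j \<in> J"
      using True J by (auto simp: J'_def)
    have A0: "A 0 \<in> sets (vimage_algebra (space M) U1 borel)"
      using A[of 0] True by (auto intro: in_vimage_algebra)
    have "(\<Inter>j\<in>J'. A j) \<in> sets (vimage_algebra (space M) ?T ?P)"
    proof (rule sets.finite_INT)
      fix j assume j: "j \<in> J'"
      then obtain S where S: "S \<in> sets borel" "A j = ?X j -` S \<inter> space M" using A[of j] J'(5) by auto
      have j2: "Suc j \<in> {2..}" using j J'(1) by (cases j) auto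
      have "?T \<in> vimage_algebra (space M) ?T ?P \<rightarrow>\<^sub>M ?P"
        using T_meas by (intro measurable_vimage_algebra1) (auto simp: measurable_def)
      from measurable_compose[OF this measurable_component_singleton[OF j2]]
      have "(\<lambda>\<omega>. ?T \<omega> (Suc j)) \<in> borel_measurable (vimage_algebra (space M) ?T ?P)" .
      then have "(\<lambda>\<omega>. cis (?T \<omega> (Suc j))) \<in> borel_measurable (vimage_algebra (space M) ?T ?P)"
        by (rule measurable_compose[OF _ borel_measurable_cis])
      from measurable_sets[OF this S(1)]
      have "(\<lambda>\<omega>. cis (?T \<omega> (Suc j))) -` S \<inter> space M \<in> sets (vimage_algebra (space M) ?T ?P)" by simp
      moreover have "(\<lambda>\<omega>. cis (?T \<omega> (Suc j))) -` S \<inter> space M = A j"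
        using S(2) j J'(1) j2 by (auto split: if_splits)
      ultimately show "A j \<in> sets (vimage_algebra (space M) ?T ?P)" by simp
    qed (use J' in auto)
    with ind A0 have "prob (A 0 \<inter> (\<Inter>j\<in>J'. A j)) = prob (A 0) * prob (\<Inter>j\<in>J'. A j)"
      by (rule indep_setD)
    also have "prob (\<Inter>j\<in>J'. A j) = (\<Prod>j\<in>J'. prob (A j))"
      using J' A by (intro angles) auto
    finally show ?thesis using J' by simp
  qed
  show ?thesis
    unfolding indep_vars_def2
  proof (intro conjI ballI X_meas)
    show "indep_sets ?F UNIV"
      unfolding indep_sets_def
    proof (intro conjI ballI allI impI)
      show "?F j \<subseteq> events" for j using measurable_sets[OF X_meas[of j]] by auto
      fix J A assume "J \<noteq> {}" "finite J" "A \<in> Pi J ?F"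
      then show "prob (\<Inter>j\<in>J. A j) = (\<Prod>j\<in>J. prob (A j))" by (intro all) auto
    qed
  qed
qed

theorem theorem1:
  fixes M :: "'a measure" and N :: "'b measure"
    and \<Theta> :: "nat \<Rightarrow> 'a \<Rightarrow> real" and U :: "nat \<Rightarrow> 'a \<Rightarrow> complex"
    and B :: "real \<Rightarrow> 'b \<Rightarrow> complex"
    and \<alpha> \<sigma> :: real
  assumes "0 < \<alpha>" and "\<alpha> \<le> pi"
    and "prob_space M"
    and "prob_space.indep_vars M (\<lambda>_. borel) \<Theta> {2..}"
    and "\<And>j. 2 \<le> j \<Longrightarrow> distr M borel (\<Theta> j) = uniform_measure lborel {-\<alpha>..\<alpha>}"
    and "distr M borel (U 1) = uniform_circle"
    and "indep_rv M borel (U 1) (PiM {2..} (\<lambda>_. borel)) (\<lambda>\<omega>. \<lambda>j\<in>{2..}. \<Theta> j \<omega>)"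
    and "\<And>j \<omega>. 2 \<le> j \<Longrightarrow> \<omega> \<in> space M \<Longrightarrow> U j \<omega> = cis (\<Theta> j \<omega>) * U (j - 1) \<omega>"
    and "\<sigma>\<^sup>2 = 1 / 2 * ((1 + sinc \<alpha>) / (1 - sinc \<alpha>))" and "0 \<le> \<sigma>"
    and "brownian_motion_2d N B"
  shows "conv_in_distribution C01
           M (\<lambda>n \<omega>. \<lambda>t\<in>{0..1}. (1 / sqrt (real n)) *\<^sub>R interpolated_walk U n t \<omega>)
           N (\<lambda>\<omega>. \<lambda>t\<in>{0..1}. \<sigma> *\<^sub>R B t \<omega>)"
proof -
  interpret M: prob_space M by fact
  interpret N: brownian_motion_2d N B by fact
  define r where "r = sin \<alpha> / \<alpha>"
  define s where "s = sin (2 * \<alpha>) / (2 * \<alpha>)"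
  have \<Theta>_meas: "\<Theta> j \<in> borel_measurable M" if "2 \<le> j" for j
    using assms(4) that by (auto simp: M.indep_vars_def)
  have U1_meas[measurable]: "U 1 \<in> borel_measurable M"
    using assms(7) by (simp add: indep_rv_def)
  have mean: "M.expectation (\<lambda>\<omega>. cis (k * \<Theta> j \<omega>)) = of_real (sin (k * \<alpha>) / (k * \<alpha>))"
    if "2 \<le> j" "k \<noteq> 0" for j k
  proof -
    have "M.expectation (\<lambda>\<omega>. cis (k * \<Theta> j \<omega>)) = (\<integral>x. cis (k * x) \<partial>distr M borel (\<Theta> j))"
      using \<Theta>_meas[OF that(1)] by (subst integral_distr) auto
    then show ?thesis
      unfolding assms(5)[OF that(1)] using integral_cis_uniform[OF assms(1) that(2)] by simp
  qed
  \<comment> \<open>\<open>U 1\<close> lies on the unit circle only almost surely. Its value is replaced by 1 on the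
    exceptional null set, since \<^locale>\<open>unit_steps\<close> asks for modulus 1 everywhere; the expectations are
    compared by \<open>integral_cong_AE\<close> at the end.\<close>
  define V where "V j \<omega> = (if j = 0 then (if cmod (U 1 \<omega>) = 1 then U 1 \<omega> else 1) else cis (\<Theta> (Suc j) \<omega>))" for j \<omega>
  have V_0: "V 0 \<omega> = U 1 \<omega>" if "cmod (U 1 \<omega>) = 1" for \<omega> using that by (simp add: V_def)
  have V_Suc: "V (Suc j) \<omega> = cis (\<Theta> (Suc (Suc j)) \<omega>)" for j \<omega> by (simp add: V_def)
  have cis_sq: "(cis x)\<^sup>2 = cis (2 * x)" for x by (simp add: power2_eq_square cis_mult)
  have V_indep: "M.indep_vars (\<lambda>_. borel) V UNIV"
  proof -
    let ?g = "\<lambda>(j::nat) z::complex. if j = 0 then (if cmod z = 1 then z else 1) else z"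
    have "M.indep_vars (\<lambda>_. borel) (\<lambda>j \<omega>. ?g j (if j = 0 then U 1 \<omega> else cis (\<Theta> (Suc j) \<omega>))) UNIV"
      by (rule M.indep_vars_compose2[OF indep_vars_start_and_angles[OF assms(3,4,7)]]) measurable
    moreover have "V = (\<lambda>j \<omega>. ?g j (if j = 0 then U 1 \<omega> else cis (\<Theta> (Suc j) \<omega>)))"
      by (auto simp: V_def fun_eq_iff)
    ultimately show ?thesis by simp
  qed
  interpret W: unit_steps M V r s
  proof (unfold_locales)
    show "M.indep_vars (\<lambda>_. borel) V UNIV" by (rule V_indep)
    show "cmod (V j \<omega>) = 1" for j \<omega> by (simp add: V_def)
    show "M.expectation (V (Suc j)) = of_real r" for j
      using mean[of "Suc (Suc j)" 1] by (simp add: V_def[abs_def] r_def)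
    show "M.expectation (\<lambda>\<omega>. (V (Suc j) \<omega>)\<^sup>2) = of_real s" for j
      using mean[of "Suc (Suc j)" 2] by (simp add: V_Suc s_def cis_sq)
    show "\<bar>r\<bar> < 1" unfolding r_def using assms(1) by (rule abs_sinc_less_1)
    show "\<bar>s\<bar> < 1" unfolding s_def using assms(1) by (intro abs_sinc_less_1) simp
  qed
  have \<sigma>: "\<sigma>\<^sup>2 = 1 / 2 * ((1 + r) / (1 - r))"
    using assms(9) assms(1) by (simp add: r_def)
  have U_meas: "U (Suc k) \<in> borel_measurable M" for k
  proof (induction k)
    case 0
    then show ?case using U1_meas by simp
  next
    case (Suc k)
    have [measurable]: "\<Theta> (Suc (Suc k)) \<in> borel_measurable M" by (intro \<Theta>_meas) simp
    have "(\<lambda>\<omega>. cis (\<Theta> (Suc (Suc k)) \<omega>) * U (Suc k) \<omega>) \<in> borel_measurable M" using Suc by measurable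
    then show ?case
      by (subst measurable_cong[where g="\<lambda>\<omega>. cis (\<Theta> (Suc (Suc k)) \<omega>) * U (Suc k) \<omega>"]) (use assms(8)[of
          "Suc (Suc k)"] in auto)
  qed
  have U_eq: "U (Suc k) \<omega> = W.U k \<omega>" if "\<omega> \<in> space M" "cmod (U 1 \<omega>) = 1" for k \<omega>
  proof (induction k)
    case 0
    then show ?case using that V_0 by (simp add: W.U_def)
  next
    case (Suc k)
    then show ?case using assms(8)[of "Suc (Suc k)" \<omega>] that(1) by (simp add: W.U_Suc V_Suc)
  qed
  have on_circle: "AE \<omega> in M. cmod (U 1 \<omega>) = 1"
  proof -
    have "AE z in uniform_circle. cmod z = 1"
      unfolding uniform_circle_def by (subst AE_distr_iff) auto
    then have "AE z in distr M borel (U 1). cmod z = 1" by (simp only: assms(6))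
    then show ?thesis using U1_meas by (subst (asm) AE_distr_iff) auto
  qed
  have walk_polygon: "interpolated_walk U n t \<omega> = polygon (\<lambda>j. U (Suc j) \<omega>) (real n * t)" for n t \<omega>
    by (simp add: interpolated_walk_def polygon_def sum.atLeast1_atMost_eq)
  have Y_cont: "continuous_on {0..1} (\<lambda>t. (1 / sqrt (real n)) *\<^sub>R interpolated_walk U n t \<omega>)" for n \<omega>
    unfolding walk_polygon by (rule continuous_on_polygon_scaled)
  have Y_meas: "(\<lambda>\<omega>. (1 / sqrt (real n)) *\<^sub>R interpolated_walk U n t \<omega>) \<in> borel_measurable M" for n t
    unfolding walk_polygon polygon_def using U_meas by measurable
  show ?thesis
  proof (rule conv_in_distribution_C01I[OF assms(3) N.prob_space_axioms Y_cont Y_meas])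
    show "continuous_on {0..1} (\<lambda>t. \<sigma> *\<^sub>R B t \<omega>)" if "\<omega> \<in> space N" for \<omega>
      using N.continuous_paths[OF that] by (intro continuous_intros) (rule continuous_on_subset, auto)
    show "(\<lambda>\<omega>. \<sigma> *\<^sub>R B t \<omega>) \<in> borel_measurable N" if "t \<in> {0..1}" for t
      using that by (intro borel_measurable_scaleR borel_measurable_const N.measurable) simp
    fix C L F assume F: "path_functional C L F"
    have "M.expectation (\<lambda>\<omega>. F (\<lambda>t. (1 / sqrt (real n)) *\<^sub>R interpolated_walk U n t \<omega>)) =
        M.expectation (\<lambda>\<omega>. F (\<lambda>t. W.walk_path n t \<omega>))" for n
    proof (rule integral_cong_AE)
      show "(\<lambda>\<omega>. F (\<lambda>t. (1 / sqrt (real n)) *\<^sub>R interpolated_walk U n t \<omega>)) \<in> borel_measurable M"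
        by (rule borel_measurable_path_functional[OF F Y_cont Y_meas])
      show "(\<lambda>\<omega>. F (\<lambda>t. W.walk_path n t \<omega>)) \<in> borel_measurable M"
        by (rule borel_measurable_path_functional[OF F W.continuous_on_walk_path W.measurable_walk_path])
      show "AE \<omega> in M. F (\<lambda>t. (1 / sqrt (real n)) *\<^sub>R interpolated_walk U n t \<omega>) = F (\<lambda>t. W.walk_path n t \<omega>)"
        using on_circle AE_space
      proof eventually_elim
        case (elim \<omega>)
        then have "(\<lambda>j. U (Suc j) \<omega>) = (\<lambda>j. W.U j \<omega>)" using U_eq by blast
        then show ?case by (simp only: walk_polygon W.walk_path_def)
      qed
    qed
    then show "(\<lambda>n. M.expectation (\<lambda>\<omega>. F (\<lambda>t. (1 / sqrt (real n)) *\<^sub>R interpolated_walk U n t \<omega>)))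
        \<longlonglongrightarrow> (\<integral>\<omega>. F (\<lambda>t. \<sigma> *\<^sub>R B t \<omega>) \<partial>N)"
      using W.functional_limit[OF assms(11) \<sigma> F] by (simp only:)
  qed
qed

end
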